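(* Let $Z$ and $Z'$ be real analytic germs of plane vector fields at $0\in\mathbb{R}^2$ inducing germs of foliations $\mathcal{F}$ and $\mathcal{F}'$. Assume that in the resolution process of $Z$ (resp. $Z'$) there is no real dicritical component and that $Z$ and $Z'$ are real generalized curves. Let $\nu$ (resp. $\nu'$) be the order of $Z$ (resp. $Z'$) at $0$. Let $h:(\mathbb{R}^2,0)\to(\mathbb{R}^2,0)$ be a homeomorphism which is a topological equivalence between $\mathcal{F}$ and $\mathcal{F}'$. If $h$ is a blow-spherical homeomorphism then $\nu\equiv\nu'\pmod 2$.
   Context: The germ $Z=P\,\partial_x+Q\,\partial_y$ has real analytic coefficients $P,Q$ vanishing at $0$ without common factor (isolated singularity); its order at $0$ is the minimum of the orders of vanishing of $P$ and $Q$ at $0$. The foliation $\mathcal{F}$ induced by $Z$ is the one whose leaves are the orbits of $Z$. A topological equivalence between $\mathcal{F}$ and $\mathcal{F}'$ is a homeomorphism germ mapping leaves of $\mathcal{F}$ to leaves of $\mathcal{F}'$. The resolution process is the standard (Seidenberg) one: a finite sequence of point blowing-ups, starting at $0$, of singular points of the (complexified) foliation, after which all singularities of the transformed foliation are reduced, i.e. given locally by a vector field whose linear part has eigenvalues $\lambda_1,\lambda_2$ with $\lambda_2\neq 0$ and $\lambda_1/\lambda_2\notin\mathbb{Q}_{>0}$; a reduced singularity is a saddle-node if $\lambda_1=0$. Blow-up centers, components and points are called real if they are invariant by complex conjugation (i.e. they arise from blowing up real points, or lie in the real part). A component of the exceptional divisor is dicritical if it is not invariant by the transformed foliation; a real dicritical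 component is a dicritical component arising from blowing up a real point. $Z$ is a real generalized curve if no real singular point of the resolved foliation is a saddle-node. Blow-spherical homeomorphism: for $k\ge 1$ let $\beta_k:\mathbb{S}^{k-1}\times[0,+\infty)\to\mathbb{R}^k$, $\beta_k(x,r)=rx$; for $X\subset\mathbb{R}^k$ with $0\in X$ put $X'=\overline{\beta_k^{-1}(X\setminus\{0\})}$ and $\partial X'=X'\cap(\mathbb{S}^{k-1}\times\{0\})$. A continuous map $\varphi:(X,0)\to(Y,0)$ between subsets of $\mathbb{R}^k$ containing $0$ with $0\notin\varphi(X\setminus\{0\})$ is a blow-spherical homeomorphism if $\beta_k^{-1}\circ\varphi\circ\beta_k:X'\setminus\partial X'\to Y'\setminus\partial Y'$ extends to a homeomorphism $\varphi':X'\to Y'$. Here it is applied to $h$ on (a neighborhood of $0$ in) $\mathbb{R}^2$. *)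

theory Defs
  imports "HOL-Analysis.Analysis" "HOL-Number_Theory.Cong"
begin

type_synonym 'a vfield = "'a \<times> 'a \<Rightarrow> 'a \<times> 'a"

definition expansion_at ::
  "('a::real_normed_field \<times> 'a \<Rightarrow> 'a) \<Rightarrow> 'a \<times> 'a \<Rightarrow> (nat \<Rightarrow> nat \<Rightarrow> 'a) \<Rightarrow> bool" where
  "expansion_at f p a \<longleftrightarrow>
     (\<exists>r>0. \<forall>x y. norm x < r \<longrightarrow> norm y < r \<longrightarrow>
        ((\<lambda>(i, j). a i j * x ^ i * y ^ j) has_sum f (fst p + x, snd p + y)) UNIV)"

definition analytic2_at :: "('a::real_normed_field \<times> 'a \<Rightarrow> 'a) \<Rightarrow> 'a \<times> 'a \<Rightarrow> bool" where
  "analytic2_at f p \<longleftrightarrow> (\<exists>a. expansion_at f p a)"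

definition vfield_analytic_at :: "'a::real_normed_field vfield \<Rightarrow> 'a \<times> 'a \<Rightarrow> bool" where
  "vfield_analytic_at X p \<longleftrightarrow> analytic2_at (fst \<circ> X) p \<and> analytic2_at (snd \<circ> X) p"

text \<open>A common factor is a non-unit of the ring of analytic germs at the origin,
  i.e. a germ vanishing at the origin.\<close>

definition no_common_factor ::
  "('a::real_normed_field \<times> 'a \<Rightarrow> 'a) \<Rightarrow> ('a \<times> 'a \<Rightarrow> 'a) \<Rightarrow> bool" where
  "no_common_factor f g \<longleftrightarrow>
     (\<forall>d p q. analytic2_at d 0 \<and> analytic2_at p 0 \<and> analytic2_at q 0 \<and>
        (\<forall>\<^sub>F w in nhds 0. f w = d w * p w \<and> g w = d w * q w) \<longrightarrow> d 0 \<noteq> 0)"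

definition real_vfield_germ :: "real vfield \<Rightarrow> bool" where
  "real_vfield_germ Z \<longleftrightarrow>
     vfield_analytic_at Z 0 \<and> Z 0 = 0 \<and> no_common_factor (fst \<circ> Z) (snd \<circ> Z)"

definition vanishing_order :: "('a::real_normed_field \<times> 'a \<Rightarrow> 'a) \<Rightarrow> enat" where
  "vanishing_order f = Inf {enat (i + j) | i j a. expansion_at f 0 a \<and> a i j \<noteq> 0}"

definition vfield_order :: "'a::real_normed_field vfield \<Rightarrow> enat" where
  "vfield_order X = min (vanishing_order (fst \<circ> X)) (vanishing_order (snd \<circ> X))"

definition complexification :: "real vfield \<Rightarrow> complex vfield \<Rightarrow> bool" where
  "complexification Z X \<longleftrightarrow> vfield_analytic_at X 0 \<and>
     (\<forall>\<^sub>F (x, y) in nhds 0. X (of_real x, of_real y) =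
        (of_real (fst (Z (x, y))), of_real (snd (Z (x, y)))))"

text \<open>The points of the projective line created by blowing up a point: the direction
  \<open>y = c x\<close>, or the direction \<open>x = 0\<close>. In the coordinates \<open>(u, v)\<close> centred at each of them
  the exceptional divisor is \<open>u = 0\<close>.\<close>

datatype direction = Slope complex | Vertical

fun blowup_chart :: "direction \<Rightarrow> complex \<times> complex \<Rightarrow> complex \<times> complex" where
  "blowup_chart (Slope c) (u, v) = (u, u * (c + v))"
| "blowup_chart Vertical (u, v) = (u * v, u)"

text \<open>\<open>Y\<close> generates, near the point \<open>s\<close> of the exceptional divisor, the transform of the
  foliation generated by \<open>X\<close>: the pull-back of \<open>X\<close> equals \<open>u ^ m\<close> times \<open>Y\<close>, the power of \<open>u\<close>
  being maximal. Since \<open>m\<close> is a natural number, this presupposes that \<open>X\<close> is singular at the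
  blown up point.\<close>

definition strict_transform :: "direction \<Rightarrow> complex vfield \<Rightarrow> complex vfield \<Rightarrow> bool" where
  "strict_transform s X Y \<longleftrightarrow> vfield_analytic_at Y 0 \<and>
     (\<exists>m. \<forall>\<^sub>F w in nhds 0. X (blowup_chart s w) =
        frechet_derivative (blowup_chart s) (at w)
          (fst w ^ m * fst (Y w), fst w ^ m * snd (Y w))) \<and>
     \<not> (\<forall>\<^sub>F v in nhds 0. Y (0, v) = 0)"

text \<open>An infinitely near point is the list of the directions leading to it: \<open>[]\<close> is the origin
  and \<open>p @ [s]\<close> is the point \<open>s\<close> of the divisor created by blowing up \<open>p\<close>. The relation
  \<open>transformed Z p Y\<close> says that \<open>Y\<close> generates the transform at \<open>p\<close> of the complexified
  foliation; it determines the germ of \<open>Y\<close> at \<open>0\<close>, so quantifying existentially or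
  universally over \<open>Y\<close> below makes no difference.\<close>

type_synonym inf_near_point = "direction list"

inductive transformed :: "real vfield \<Rightarrow> inf_near_point \<Rightarrow> complex vfield \<Rightarrow> bool"
  for Z :: "real vfield" where
  origin: "complexification Z X \<Longrightarrow> transformed Z [] X"
| blowup: "transformed Z p X \<Longrightarrow> strict_transform s X Y \<Longrightarrow> transformed Z (p @ [s]) Y"

fun cnj_direction :: "direction \<Rightarrow> direction" where
  "cnj_direction (Slope c) = Slope (cnj c)"
| "cnj_direction Vertical = Vertical"

definition real_point :: "inf_near_point \<Rightarrow> bool" where
  "real_point p \<longleftrightarrow> map cnj_direction p = p"

definition singular_point :: "real vfield \<Rightarrow> inf_near_point \<Rightarrow> bool" where
  "singular_point Z p \<longleftrightarrow> (\<exists>Y. transformed Z p Y \<and> Y 0 = 0)"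

definition linear_part :: "complex vfield \<Rightarrow> complex^2^2" where
  "linear_part X = (let D = frechet_derivative X (at 0) in
     vector [vector [fst (D (1, 0)), fst (D (0, 1))],
             vector [snd (D (1, 0)), snd (D (0, 1))]])"

definition eigenvalue_pair :: "complex vfield \<Rightarrow> complex \<Rightarrow> complex \<Rightarrow> bool" where
  "eigenvalue_pair X l1 l2 \<longleftrightarrow> (\<forall>z. det (mat z - linear_part X) = (z - l1) * (z - l2))"

definition reduced_point :: "real vfield \<Rightarrow> inf_near_point \<Rightarrow> bool" where
  "reduced_point Z p \<longleftrightarrow> (\<exists>Y l1 l2. transformed Z p Y \<and> Y 0 = 0 \<and> eigenvalue_pair Y l1 l2 \<and>
     l2 \<noteq> 0 \<and> l1 / l2 \<notin> of_rat ` {0<..})"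

definition saddle_node_point :: "real vfield \<Rightarrow> inf_near_point \<Rightarrow> bool" where
  "saddle_node_point Z p \<longleftrightarrow> (\<exists>Y l2. transformed Z p Y \<and> Y 0 = 0 \<and> eigenvalue_pair Y 0 l2 \<and>
     l2 \<noteq> 0)"

text \<open>The points over the origin of the surface obtained by blowing up the centres \<open>cs\<close>.\<close>

definition points_over :: "inf_near_point list \<Rightarrow> inf_near_point set" where
  "points_over cs = {p. p \<notin> set cs \<and> (p = [] \<or> butlast p \<in> set cs)}"

text \<open>Every centre is a singular point on the surface produced by the preceding blowing-ups.
  The list is empty only if the origin is already reduced.\<close>

definition resolution :: "real vfield \<Rightarrow> inf_near_point list \<Rightarrow> bool" where
  "resolution Z cs \<longleftrightarrow>
     (\<forall>k<length cs. cs ! k \<in> points_over (take k cs) \<and> singular_point Z (cs ! k)) \<and>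
     (\<forall>p\<in>points_over cs. singular_point Z p \<longrightarrow> reduced_point Z p)"

text \<open>The component created by blowing up \<open>p\<close> is invariant if the transformed foliation is
  tangent to it at each of its points.\<close>

definition invariant_component :: "real vfield \<Rightarrow> inf_near_point \<Rightarrow> bool" where
  "invariant_component Z p \<longleftrightarrow>
     (\<forall>s Y. transformed Z (p @ [s]) Y \<longrightarrow> (\<forall>\<^sub>F v in nhds 0. fst (Y (0, v)) = 0))"

definition no_real_dicritical_component :: "real vfield \<Rightarrow> inf_near_point list \<Rightarrow> bool" where
  "no_real_dicritical_component Z cs \<longleftrightarrow>
     (\<forall>p\<in>set cs. real_point p \<longrightarrow> invariant_component Z p)"

definition real_generalized_curve :: "real vfield \<Rightarrow> inf_near_point list \<Rightarrow> bool" where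
  "real_generalized_curve Z cs \<longleftrightarrow>
     (\<forall>p\<in>points_over cs. real_point p \<and> singular_point Z p \<longrightarrow> \<not> saddle_node_point Z p)"

definition orbit ::
  "(real \<times> real) set \<Rightarrow> real vfield \<Rightarrow> real \<times> real \<Rightarrow> (real \<times> real) set" where
  "orbit U Z p = {\<gamma> t |\<gamma> I t. open I \<and> connected I \<and> 0 \<in> I \<and> t \<in> I \<and> \<gamma> 0 = p \<and>
     (\<forall>s\<in>I. \<gamma> s \<in> U \<and> (\<gamma> has_vector_derivative Z (\<gamma> s)) (at s))}"

definition leaves :: "(real \<times> real) set \<Rightarrow> real vfield \<Rightarrow> (real \<times> real) set set" where
  "leaves U Z = orbit U Z ` U"

definition topological_equivalence ::
  "real vfield \<Rightarrow> real vfield \<Rightarrow> (real \<times> real \<Rightarrow> real \<times> real) \<Rightarrow> bool" where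
  "topological_equivalence Z Z' h \<longleftrightarrow> h 0 = 0 \<and>
     (\<exists>U V g. open U \<and> 0 \<in> U \<and> open V \<and> 0 \<in> V \<and>
        (\<forall>p\<in>U. vfield_analytic_at Z p) \<and> (\<forall>p\<in>V. vfield_analytic_at Z' p) \<and>
        homeomorphism U V h g \<and> (\<forall>L\<in>leaves U Z. h ` L \<in> leaves V Z'))"

definition sph_blow :: "'a::euclidean_space \<times> real \<Rightarrow> 'a" where
  "sph_blow z = snd z *\<^sub>R fst z"

text \<open>The inverse of \<open>sph_blow\<close> over the complement of the origin.\<close>

definition sph_blow_inv :: "'a::euclidean_space \<Rightarrow> 'a \<times> real" where
  "sph_blow_inv w = (w /\<^sub>R norm w, norm w)"

definition sph_transform :: "'a::euclidean_space set \<Rightarrow> ('a \<times> real) set" where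
  "sph_transform X = closure {z \<in> sphere 0 1 \<times> {0..}. sph_blow z \<in> X - {0}}"

definition sph_boundary :: "'a::euclidean_space set \<Rightarrow> ('a \<times> real) set" where
  "sph_boundary X = sph_transform X \<inter> (sphere 0 1 \<times> {0})"

definition blow_spherical_homeo ::
  "'a::euclidean_space set \<Rightarrow> 'a set \<Rightarrow> ('a \<Rightarrow> 'a) \<Rightarrow> bool" where
  "blow_spherical_homeo X Y \<phi> \<longleftrightarrow>
     0 \<in> X \<and> 0 \<in> Y \<and> continuous_on X \<phi> \<and> \<phi> ` X \<subseteq> Y \<and> \<phi> 0 = 0 \<and> 0 \<notin> \<phi> ` (X - {0}) \<and>
     (\<exists>\<Phi> \<Psi>. homeomorphism (sph_transform X) (sph_transform Y) \<Phi> \<Psi> \<and>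
        (\<forall>z\<in>sph_transform X - sph_boundary X.
           \<Phi> z \<in> sph_transform Y - sph_boundary Y \<and>
           \<Phi> z = sph_blow_inv (\<phi> (sph_blow z))))"

text \<open>For a germ at the origin, a compact neighbourhood is used as the domain: if \<open>X\<close> is not
  closed, \<open>sph_transform X\<close> contains points off the boundary sphere that do not lie over \<open>X\<close>.\<close>

definition blow_spherical_germ :: "('a::euclidean_space \<Rightarrow> 'a) \<Rightarrow> bool" where
  "blow_spherical_germ h \<longleftrightarrow>
     (\<exists>K. compact K \<and> 0 \<in> interior K \<and> blow_spherical_homeo K (h ` K) h)"

end

theory Submission
  imports Defs
begin

text \<open>
  The parity of the order \<open>\<nu>\<close> is read off from the circle of directions at the origin. Let
  \<open>Z = P \<partial>x + Q \<partial>y\<close> and let \<open>R\<close> be the homogeneous part of degree \<open>\<nu> + 1\<close> of \<open>x Q - y P\<close>; its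
  sign tells in which sense the orbits of \<open>Z\<close> near the origin turn when they cross a given
  direction. Since the first exceptional component is not dicritical, \<open>R\<close> is not identically zero
  (\<open>nondicritical_tangent_cone\<close>). As \<open>R (- v) = (- 1) ^ (\<nu> + 1) R v\<close>, the form \<open>R\<close> changes sign
  at \<open>2 k\<close> points of the circle with \<open>k\<close> congruent to \<open>\<nu> + 1\<close> modulo \<open>2\<close>
  (\<open>card_sign_changes_circle\<close>). So it suffices that the sign changes of \<open>R\<close> and of the form \<open>R'\<close>
  of \<open>Z'\<close> correspond to each other under a bijection of the circle.

  This bijection is the homeomorphism \<open>\<phi>\<close> of the circle that a blow-spherical \<open>h\<close> induces
  (\<open>blow_spherical_boundary_map\<close>). Take a direction \<open>x\<close> with \<open>R x\<close> and \<open>R' (\<phi> x)\<close> both nonzero.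
  Rescaling the plane shows that an orbit of \<open>Z\<close> through a point close to the origin in
  direction \<open>x\<close> sweeps a whole sector, whose opening does not shrink with the distance to the
  origin, in the sense given by the sign of \<open>R x\<close> (\<open>sector_solution\<close>). Its image under \<open>h\<close> sweeps,
  in the limit, the image of this sector under \<open>\<phi>\<close>, and it can do so only in the sense given by
  the sign of \<open>R' (\<phi> x)\<close> (\<open>boundary_direction\<close>). Hence the signs of \<open>R\<close> and of \<open>R' \<circ> \<phi>\<close> agree up
  to one global sign (\<open>direction_signs_agree\<close>), and \<open>\<phi>\<close> maps sign changes to sign changes
  (\<open>parity_of_tangent_cones\<close>).

  The global sign is the product of the sense in which \<open>\<phi>\<close> turns the circle and of the sense in
  which \<open>h\<close> maps oriented orbits of \<open>Z\<close> to oriented orbits of \<open>Z'\<close>. The latter is locally constant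
  because an orbit meets a flow box in countably many plaques only, so that the image of a plaque
  cannot jump from one plaque to another (\<open>leaf_map_locally_monotone\<close>). It is then constant on a
  punctured disc around the origin (\<open>leaf_map_monotone\<close>), provided that the origin is an isolated
  zero of both vector fields. This is the second use of the resolution: real zeros accumulating at
  the origin could be followed through the real infinitely near points up to a singular point that
  is reduced and not a saddle-node, but there the linear part is invertible
  (\<open>real_singularity_isolated\<close>).
\<close>

section \<open>Power series expansions in two variables\<close>

text \<open>Beyond a finite set of indices, every single term is a difference of two partial sums that are
  within distance \<open>1\<close> of the limit.\<close>

lemma has_sum_terms_bounded:
  fixes f :: "'b \<Rightarrow> 'a::real_normed_vector"
  assumes "(f has_sum S) A"
  shows "\<exists>M>0. \<forall>x\<in>A. norm (f x) \<le> M"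
proof -
  have "\<forall>\<^sub>F F in finite_subsets_at_top A. dist (sum f F) S < 1"
    using assms by (auto simp: has_sum_def tendsto_iff)
  then obtain X where X: "finite X" "X \<subseteq> A"
    and near: "\<And>Y. finite Y \<Longrightarrow> X \<subseteq> Y \<Longrightarrow> Y \<subseteq> A \<Longrightarrow> dist (sum f Y) S < 1"
    by (auto simp: eventually_finite_subsets_at_top)
  have "norm (f x) \<le> 2 + (\<Sum>x\<in>X. norm (f x))" if x: "x \<in> A" for x
  proof (cases "x \<in> X")
    case True
    then have "norm (f x) \<le> (\<Sum>x\<in>X. norm (f x))"
      by (intro member_le_sum) (use X in auto)
    then show ?thesis by simp
  next
    case False
    have "dist (sum f (insert x X)) S < 1" "dist (sum f X) S < 1"
      using near[of "insert x X"] near[of X] X x by auto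
    then have "dist (sum f (insert x X)) (sum f X) < 2"
      using dist_triangle2[of "sum f (insert x X)" "sum f X" S] by simp
    moreover have "sum f (insert x X) - sum f X = f x"
      using False X by simp
    ultimately have "norm (f x) < 2" by (simp add: dist_norm)
    moreover have "0 \<le> (\<Sum>x\<in>X. norm (f x))" by (simp add: sum_nonneg)
    ultimately show ?thesis by simp
  qed
  moreover have "0 < 2 + (\<Sum>x\<in>X. norm (f x))"
    by (simp add: add_pos_nonneg sum_nonneg)
  ultimately show ?thesis by blast
qed

text \<open>Cauchy estimates: the terms of the series at the point \<open>(r, r)\<close> are bounded. All convergence
  questions about the expansions below are reduced to such a geometric bound.\<close>

lemma expansion_coeff_bound:
  assumes "expansion_at f p a"
  obtains r M where "r > 0" "M > 0" "\<And>i j. norm (a i j) * r ^ (i + j) \<le> M"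
proof -
  obtain r where r: "r > 0" and
    s: "\<And>x y. norm x < r \<Longrightarrow> norm y < r \<Longrightarrow>
        ((\<lambda>(i, j). a i j * x ^ i * y ^ j) has_sum f (fst p + x, snd p + y)) UNIV"
    using assms unfolding expansion_at_def by blast
  have "norm (of_real (r/2) :: 'a) < r" using r by simp
  from has_sum_terms_bounded[OF s[OF this this]] obtain M where
    M: "M > 0" "\<And>i j. norm (a i j * of_real (r/2) ^ i * of_real (r/2) ^ j) \<le> M"
    by auto
  have "norm (a i j) * (r/2) ^ (i + j) \<le> M" for i j
    using M(2)[of i j] r by (simp add: norm_mult norm_power power_add mult.assoc norm_divide)
  then show ?thesis using that[of "r/2" M] r M(1) by simp
qed

lemma summable_on_geometric_pairs:
  fixes q :: real
  assumes "0 \<le> q" "q < 1"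
  shows "(\<lambda>(i::nat, j::nat). q ^ (i + j)) summable_on UNIV"
proof -
  have g: "((\<lambda>n. q ^ n) has_sum (1 / (1 - q))) (UNIV :: nat set)"
    using assms by (intro norm_summable_imp_has_sum geometric_sums) (auto simp: summable_geometric)
  have "(\<lambda>(i::nat, j::nat). q ^ (i + j)) summable_on Sigma UNIV (\<lambda>_. UNIV)"
  proof (rule summable_on_SigmaI[where g = "\<lambda>i. q ^ i * (1 / (1 - q))"])
    show "((\<lambda>y. case (x, y) of (i, j) \<Rightarrow> q ^ (i + j)) has_sum q ^ x * (1 / (1 - q))) UNIV" for x :: nat
      using has_sum_cmult_right[OF g, of "q ^ x"] by (simp add: power_add)
    show "(\<lambda>i. q ^ i * (1 / (1 - q))) summable_on (UNIV :: nat set)"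
      using has_sum_imp_summable[OF has_sum_cmult_left[OF g, of "1 / (1 - q)"]] by simp
  qed (use assms in auto)
  then show ?thesis by simp
qed

lemma coeff_summable:
  fixes a :: "nat \<Rightarrow> nat \<Rightarrow> 'a::real_normed_field"
  assumes "\<And>i j. norm (a i j) * r ^ (i + j) \<le> M" "0 \<le> \<rho>" "\<rho> < r"
  shows "(\<lambda>(i, j). norm (a i j) * \<rho> ^ (i + j)) summable_on UNIV"
proof -
  have r: "r > 0" using assms by simp
  have "(\<lambda>p. M * (case p of (i, j) \<Rightarrow> (\<rho> / r) ^ (i + j))) summable_on (UNIV :: (nat \<times> nat) set)"
    by (intro summable_on_cmult_right summable_on_geometric_pairs) (use assms r in auto)
  then show ?thesis
  proof (rule summable_on_comparison_test)
    fix p :: "nat \<times> nat"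
    obtain i j where p: "p = (i, j)" by (cases p)
    have "norm (a i j) * \<rho> ^ (i + j) = (norm (a i j) * r ^ (i + j)) * (\<rho> / r) ^ (i + j)"
      using r by (simp add: power_divide)
    also have "\<dots> \<le> M * (\<rho> / r) ^ (i + j)"
      by (intro mult_right_mono assms) (use assms r in simp)
    finally show "(case p of (i, j) \<Rightarrow> norm (a i j) * \<rho> ^ (i + j)) \<le> M * (case p of (i, j) \<Rightarrow> (\<rho> / r) ^ (i + j))"
      by (simp add: p)
  qed (use assms in auto)
qed

text \<open>The weight \<open>i + j\<close>, which comes from differentiating monomials, is absorbed by halving the
  radius, since \<open>n \<le> 2 ^ n\<close>.\<close>

lemma coeff_summable_weighted:
  fixes a :: "nat \<Rightarrow> nat \<Rightarrow> 'a::real_normed_field"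
  assumes "\<And>i j. norm (a i j) * r ^ (i + j) \<le> M" "0 \<le> \<rho>" "2 * \<rho> < r"
  shows "(\<lambda>(i, j). norm (a i j) * real (i + j) * \<rho> ^ (i + j)) summable_on UNIV"
proof -
  have "(\<lambda>(i, j). norm (a i j) * (2 * \<rho>) ^ (i + j)) summable_on UNIV"
    using assms by (intro coeff_summable[of a r M]) auto
  then show ?thesis
  proof (rule summable_on_comparison_test)
    fix p :: "nat \<times> nat"
    obtain i j where p: "p = (i, j)" by (cases p)
    have "real (i + j) \<le> 2 ^ (i + j)"
      using of_nat_less_two_power[of "i + j", where 'a = real] by simp
    then have "norm (a i j) * real (i + j) * \<rho> ^ (i + j) \<le> norm (a i j) * 2 ^ (i + j) * \<rho> ^ (i + j)"
      using assms by (intro mult_right_mono mult_left_mono) auto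
    then show "(case p of (i, j) \<Rightarrow> norm (a i j) * real (i + j) * \<rho> ^ (i + j))
        \<le> (case p of (i, j) \<Rightarrow> norm (a i j) * (2 * \<rho>) ^ (i + j))"
      by (simp add: p power_mult_distrib mult.assoc)
  qed (use assms in auto)
qed

lemma coeff_summable_eval:
  fixes a :: "nat \<Rightarrow> nat \<Rightarrow> 'a::{real_normed_field, banach}"
  assumes "\<And>i j. norm (a i j) * r ^ (i + j) \<le> M" "norm x < r" "norm y < r"
  shows "(\<lambda>(i, j). a i j * x ^ i * y ^ j) summable_on UNIV"
proof -
  define m where "m = max (norm x) (norm y)"
  have m: "norm x \<le> m" "norm y \<le> m" "m < r" "0 \<le> m"
    using assms norm_ge_zero[of x] by (auto simp: m_def simp del: norm_ge_zero)
  have "(\<lambda>(i, j). norm (a i j) * m ^ (i + j)) summable_on UNIV"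
    using assms m by (intro coeff_summable[of a r M]) auto
  then have "(\<lambda>p. norm (case p of (i, j) \<Rightarrow> a i j * x ^ i * y ^ j)) summable_on UNIV"
  proof (rule Infinite_Sum.abs_summable_on_comparison_test')
    fix p :: "nat \<times> nat"
    obtain i j where p: "p = (i, j)" by (cases p)
    have "norm x ^ i * norm y ^ j \<le> m ^ i * m ^ j"
      using m by (intro mult_mono power_mono zero_le_power norm_ge_zero)
    then have "norm (a i j) * (norm x ^ i * norm y ^ j) \<le> norm (a i j) * (m ^ i * m ^ j)"
      by (rule mult_left_mono) simp
    then show "norm (case p of (i, j) \<Rightarrow> a i j * x ^ i * y ^ j)
        \<le> (case p of (i, j) \<Rightarrow> norm (a i j) * m ^ (i + j))"
      by (simp add: p norm_mult norm_power power_add mult.assoc)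
  qed
  then show ?thesis by (rule Infinite_Sum.abs_summable_summable)
qed

lemma monomial_diff_bound:
  fixes x y x' y' :: "'a::real_normed_field"
  assumes "norm x \<le> \<rho>" "norm y \<le> \<rho>" "norm x' \<le> \<rho>" "norm y' \<le> \<rho>"
  shows "norm (x ^ i * y ^ j - x' ^ i * y' ^ j)
    \<le> real (i + j) * \<rho> ^ (i + j - 1) * (norm (x - x') + norm (y - y'))"
proof -
  have \<rho>: "\<rho> \<ge> 0" using assms(1) norm_ge_zero order_trans by blast
  have pw: "norm (z ^ n - z' ^ n) \<le> real n * \<rho> ^ (n - 1) * norm (z - z')"
    if "norm z \<le> \<rho>" "norm z' \<le> \<rho>" for z z' :: 'a and n
  proof (cases n)
    case (Suc m)
    have "z ^ n - z' ^ n = (z - z') * (\<Sum>k<n. z' ^ (n - Suc k) * z ^ k)"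
      by (rule power_diff_sumr2)
    also have "norm \<dots> \<le> norm (z - z') * (\<Sum>k<n. \<rho> ^ (n - 1))"
      unfolding norm_mult
    proof (intro mult_left_mono sum_norm_le)
      fix k assume "k \<in> {..<n}"
      then have *: "n - 1 = (n - Suc k) + k" by auto
      have "norm z' ^ (n - Suc k) * norm z ^ k \<le> \<rho> ^ (n - Suc k) * \<rho> ^ k"
        by (intro mult_mono power_mono that) (auto simp: \<rho>)
      then show "norm (z' ^ (n - Suc k) * z ^ k) \<le> \<rho> ^ (n - 1)"
        by (subst *) (simp add: norm_mult norm_power power_add)
    qed auto
    finally show ?thesis by (simp add: mult_ac)
  qed simp
  have "x ^ i * y ^ j - x' ^ i * y' ^ j = (x ^ i - x' ^ i) * y ^ j + x' ^ i * (y ^ j - y' ^ j)"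
    by (simp add: algebra_simps)
  also have "norm \<dots> \<le> norm (x ^ i - x' ^ i) * norm y ^ j + norm x' ^ i * norm (y ^ j - y' ^ j)"
    using norm_triangle_ineq[of "(x ^ i - x' ^ i) * y ^ j" "x' ^ i * (y ^ j - y' ^ j)"]
    by (simp only: norm_mult norm_power)
  also have "\<dots> \<le> (real i * \<rho> ^ (i - 1) * norm (x - x')) * \<rho> ^ j
      + \<rho> ^ i * (real j * \<rho> ^ (j - 1) * norm (y - y'))"
    by (intro add_mono mult_mono power_mono pw assms) (auto simp: \<rho>)
  also have "\<dots> = real i * \<rho> ^ (i + j - 1) * norm (x - x') + real j * \<rho> ^ (i + j - 1) * norm (y - y')"
    by (cases i; cases j) (auto simp: power_add)
  also have "\<dots> \<le> real (i + j) * \<rho> ^ (i + j - 1) * norm (x - x')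
      + real (i + j) * \<rho> ^ (i + j - 1) * norm (y - y')"
    by (intro add_mono mult_right_mono) (auto simp: \<rho>)
  finally show ?thesis by (simp add: algebra_simps)
qed

text \<open>If all terms of positive degree less than \<open>n\<close> vanish, then \<open>f\<close> is Lipschitz on the bidisc of
  radius \<open>\<rho>\<close> with a constant of the order of \<open>\<rho> ^ (n - 1)\<close>. Three facts are instances of this
  estimate: local Lipschitz continuity and differentiability of analytic functions, a Lipschitz
  constant independent of the scale for a rescaled vector field, and the size of the remainder
  after the leading homogeneous part.\<close>

lemma expansion_lipschitz:
  fixes f :: "'a::real_normed_field \<times> 'a \<Rightarrow> 'a"
  assumes f: "expansion_at f p a" and n: "n \<ge> 1"
    and zero: "\<And>i j. 0 < i + j \<Longrightarrow> i + j < n \<Longrightarrow> a i j = 0"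
  shows "\<exists>C>0. \<exists>\<delta>>0. \<forall>\<rho> x y x' y'. \<rho> \<le> \<delta> \<longrightarrow> norm x \<le> \<rho> \<longrightarrow> norm y \<le> \<rho> \<longrightarrow>
     norm x' \<le> \<rho> \<longrightarrow> norm y' \<le> \<rho> \<longrightarrow>
     norm (f (fst p + x, snd p + y) - f (fst p + x', snd p + y'))
       \<le> C * \<rho> ^ (n - 1) * (norm (x - x') + norm (y - y'))"
proof -
  obtain r0 where r0: "r0 > 0" and
    s: "\<And>x y. norm x < r0 \<Longrightarrow> norm y < r0 \<Longrightarrow>
        ((\<lambda>(i, j). a i j * x ^ i * y ^ j) has_sum f (fst p + x, snd p + y)) UNIV"
    using f unfolding expansion_at_def by blast
  obtain r M where r: "r > 0" "M > 0" "\<And>i j. norm (a i j) * r ^ (i + j) \<le> M"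
    using expansion_coeff_bound[OF f] by blast
  define \<delta> where "\<delta> = min (r0 / 2) (r / 4)"
  have \<delta>: "\<delta> > 0" "\<delta> < r0" "2 * \<delta> < r" using r r0 by (auto simp: \<delta>_def)
  let ?t = "\<lambda>(i, j). norm (a i j) * real (i + j) * \<delta> ^ (i + j)"
  define T where "T = infsum ?t UNIV"
  have T: "(?t has_sum T) UNIV"
    unfolding T_def by (intro has_sum_infsum coeff_summable_weighted[OF r(3)]) (use \<delta> in auto)
  have "T \<ge> 0" using has_sum_nonneg[OF T] \<delta> by (auto simp: case_prod_unfold)
  \<comment> \<open>Adding \<open>1\<close> keeps the constant positive even if all coefficients in question vanish.\<close>
  define C where "C = (T + 1) / \<delta> ^ n"
  have C: "C > 0" "T / \<delta> ^ n \<le> C"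
    using \<open>T \<ge> 0\<close> \<delta> by (auto simp: C_def divide_simps)
  have "norm (f (fst p + x, snd p + y) - f (fst p + x', snd p + y'))
       \<le> C * \<rho> ^ (n - 1) * (norm (x - x') + norm (y - y'))"
    if "\<rho> \<le> \<delta>" and b: "norm x \<le> \<rho>" "norm y \<le> \<rho>" "norm x' \<le> \<rho>" "norm y' \<le> \<rho>" for \<rho> x y x' y'
  proof -
    define D where "D = norm (x - x') + norm (y - y')"
    have "\<rho> \<ge> 0" using b(1) norm_ge_zero order_trans by blast
    have "D \<ge> 0" by (simp add: D_def)
    have lt: "norm x < r0" "norm y < r0" "norm x' < r0" "norm y' < r0"
      using b that \<delta> by auto
    have hs: "((\<lambda>(i, j). a i j * x ^ i * y ^ j - a i j * x' ^ i * y' ^ j) has_sum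
        (f (fst p + x, snd p + y) - f (fst p + x', snd p + y'))) UNIV"
      using has_sum_add[OF s[OF lt(1,2)] has_sum_uminusI[OF s[OF lt(3,4)]]]
      by (simp add: case_prod_unfold)
    have "norm (f (fst p + x, snd p + y) - f (fst p + x', snd p + y'))
        \<le> T * (\<rho> ^ (n - 1) * D / \<delta> ^ n)"
    proof (rule norm_infsum_le[OF hs has_sum_cmult_left[OF T]])
      fix q :: "nat \<times> nat"
      obtain i j where q: "q = (i, j)" by (cases q)
      have "norm (a i j * x ^ i * y ^ j - a i j * x' ^ i * y' ^ j)
          = norm (a i j) * norm (x ^ i * y ^ j - x' ^ i * y' ^ j)"
        by (simp add: norm_mult[symmetric] algebra_simps)
      also have "\<dots> \<le> norm (a i j) * (real (i + j) * \<rho> ^ (i + j - 1) * D)"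
        unfolding D_def by (intro mult_left_mono monomial_diff_bound b) auto
      also have "\<dots> \<le> norm (a i j) * real (i + j) * \<delta> ^ (i + j) * (\<rho> ^ (n - 1) * D / \<delta> ^ n)"
      proof (cases "i + j < n")
        case True
        then show ?thesis using zero[of i j] by (cases "i + j = 0") auto
      next
        case False
        then have e: "i + j - 1 = (n - 1) + (i + j - n)" "i + j = n + (i + j - n)" using n by auto
        have "\<rho> ^ (i + j - 1) = \<rho> ^ (n - 1) * \<rho> ^ (i + j - n)" by (subst e(1)) (simp only: power_add)
        also have "\<dots> \<le> \<rho> ^ (n - 1) * \<delta> ^ (i + j - n)"
          using \<open>\<rho> \<ge> 0\<close> that by (intro mult_left_mono power_mono) auto
        also have "\<delta> ^ (i + j - n) = \<delta> ^ (i + j) / \<delta> ^ n"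
          using \<delta> False by (simp add: power_diff)
        finally have "norm (a i j) * (real (i + j) * \<rho> ^ (i + j - 1) * D)
            \<le> norm (a i j) * (real (i + j) * (\<rho> ^ (n - 1) * (\<delta> ^ (i + j) / \<delta> ^ n)) * D)"
          using \<open>D \<ge> 0\<close> by (intro mult_left_mono mult_right_mono) auto
        then show ?thesis by (simp add: mult_ac)
      qed
      finally show "norm (case q of (i, j) \<Rightarrow> a i j * x ^ i * y ^ j - a i j * x' ^ i * y' ^ j)
          \<le> (case q of (i, j) \<Rightarrow> norm (a i j) * real (i + j) * \<delta> ^ (i + j)) * (\<rho> ^ (n - 1) * D / \<delta> ^ n)"
        by (simp add: q)
    qed
    also have "\<dots> = T / \<delta> ^ n * (\<rho> ^ (n - 1) * D)" by simp
    also have "\<dots> \<le> C * (\<rho> ^ (n - 1) * D)"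
      using C \<open>\<rho> \<ge> 0\<close> \<open>D \<ge> 0\<close> by (intro mult_right_mono) auto
    finally show ?thesis by (simp add: D_def mult.assoc)
  qed
  then show ?thesis using C(1) \<delta>(1) by blast
qed

lemma expansion_at_value: "expansion_at f p a \<Longrightarrow> f p = a 0 0"
proof -
  assume "expansion_at f p a"
  then obtain r where "r > 0" "\<And>x y. norm x < r \<Longrightarrow> norm y < r \<Longrightarrow>
        ((\<lambda>(i, j). a i j * x ^ i * y ^ j) has_sum f (fst p + x, snd p + y)) UNIV"
    unfolding expansion_at_def by blast
  from this(2)[of 0 0] this(1) have "((\<lambda>(i, j). a i j * 0 ^ i * 0 ^ j) has_sum f p) UNIV"
    by simp
  moreover have "((\<lambda>(i, j). a i j * 0 ^ i * 0 ^ j) has_sum a 0 0) UNIV"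
    by (rule has_sum_finite_neutralI[of "{(0, 0)}"]) auto
  ultimately show ?thesis using has_sum_unique by blast
qed

lemma expansion_tail:
  fixes f :: "'a::real_normed_field \<times> 'a \<Rightarrow> 'a"
  assumes "expansion_at f 0 a"
  shows "expansion_at (\<lambda>(x, y). f (x, y) - (\<Sum>(i, j)\<in>{(i, j). i + j < n}. a i j * x ^ i * y ^ j)) 0
     (\<lambda>i j. if i + j < n then 0 else a i j)"
proof -
  have fin: "finite {(i, j). i + j < n}"
    by (rule finite_subset[of _ "{..<n} \<times> {..<n}"]) auto
  obtain r where r: "r > 0" and
    s: "\<And>x y. norm x < r \<Longrightarrow> norm y < r \<Longrightarrow>
        ((\<lambda>(i, j). a i j * x ^ i * y ^ j) has_sum f (x, y)) UNIV"
    using assms unfolding expansion_at_def by auto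
  have "((\<lambda>(i, j). (if i + j < n then 0 else a i j) * x ^ i * y ^ j) has_sum
       f (x, y) - (\<Sum>(i, j)\<in>{(i, j). i + j < n}. a i j * x ^ i * y ^ j)) UNIV"
    if "norm x < r" "norm y < r" for x y
  proof -
    have "((\<lambda>(i, j). if i + j < n then a i j * x ^ i * y ^ j else 0) has_sum
       (\<Sum>(i, j)\<in>{(i, j). i + j < n}. a i j * x ^ i * y ^ j)) UNIV"
      by (rule has_sum_finite_neutralI[OF fin]) (auto intro!: sum.cong)
    from has_sum_add[OF s[OF that] has_sum_uminusI[OF this]]
    have "((\<lambda>q. (case q of (i, j) \<Rightarrow> a i j * x ^ i * y ^ j)
          + - (case q of (i, j) \<Rightarrow> if i + j < n then a i j * x ^ i * y ^ j else 0)) has_sum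
       f (x, y) - (\<Sum>(i, j)\<in>{(i, j). i + j < n}. a i j * x ^ i * y ^ j)) UNIV"
      by simp
    moreover have "(\<lambda>q. (case q of (i, j) \<Rightarrow> a i j * x ^ i * y ^ j)
          + - (case q of (i, j) \<Rightarrow> if i + j < n then a i j * x ^ i * y ^ j else 0))
        = (\<lambda>(i, j). (if i + j < n then 0 else a i j) * x ^ i * y ^ j)"
      by (auto simp: fun_eq_iff)
    ultimately show ?thesis by simp
  qed
  then show ?thesis unfolding expansion_at_def using r by auto
qed

lemma expansion_has_derivative:
  fixes f :: "'a::real_normed_field \<times> 'a \<Rightarrow> 'a"
  assumes f: "expansion_at f 0 a"
  shows "(f has_derivative (\<lambda>(x, y). a 1 0 * x + a 0 1 * y)) (at 0)"
proof -
  have set2: "{(i, j). i + j < (2::nat)} = {(0, 0), (1, 0), (0, 1)}" by auto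
  have fs: "(\<Sum>(i, j)\<in>{(i, j). i + j < 2}. a i j * x ^ i * y ^ j) = a 0 0 + a 1 0 * x + a 0 1 * y" for x y
    by (simp add: set2)
  let ?g = "\<lambda>(x, y). f (x, y) - (\<Sum>(i, j)\<in>{(i, j). i + j < 2}. a i j * x ^ i * y ^ j)"
  have "\<exists>C>0. \<exists>\<delta>>0. \<forall>\<rho> x y x' y'. \<rho> \<le> \<delta> \<longrightarrow> norm x \<le> \<rho> \<longrightarrow> norm y \<le> \<rho> \<longrightarrow>
     norm x' \<le> \<rho> \<longrightarrow> norm y' \<le> \<rho> \<longrightarrow>
     norm (?g (x, y) - ?g (x', y')) \<le> C * \<rho> ^ (2 - 1) * (norm (x - x') + norm (y - y'))"
    by (rule expansion_lipschitz[OF expansion_tail[OF f, of 2], of 2, unfolded fst_zero snd_zero add_0]) auto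
  then obtain C \<delta> where C: "C > 0" and \<delta>: "\<delta> > 0" and
    est: "\<And>\<rho> x y x' y'. \<rho> \<le> \<delta> \<Longrightarrow> norm x \<le> \<rho> \<Longrightarrow> norm y \<le> \<rho> \<Longrightarrow>
     norm x' \<le> \<rho> \<Longrightarrow> norm y' \<le> \<rho> \<Longrightarrow>
     norm (?g (x, y) - ?g (x', y')) \<le> C * \<rho> ^ (2 - 1) * (norm (x - x') + norm (y - y'))"
    by blast
  have g0: "?g (0, 0) = 0" using expansion_at_value[OF f] by (simp add: fs zero_prod_def)
  have "bounded_linear (\<lambda>(x, y). a 1 0 * x + a 0 1 * y)"
    unfolding case_prod_unfold by (intro bounded_linear_intros)
  moreover have "(\<lambda>h. norm (f (0 + h) - f 0 - (case h of (x, y) \<Rightarrow> a 1 0 * x + a 0 1 * y)) / norm h)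
      \<midarrow>0\<rightarrow> 0"
  proof (rule Lim_null_comparison)
    show "\<forall>\<^sub>F h in at 0. norm (norm (f (0 + h) - f 0 - (case h of (x, y) \<Rightarrow> a 1 0 * x + a 0 1 * y)) / norm h)
        \<le> 2 * C * norm h"
      unfolding eventually_at
    proof (intro exI[of _ \<delta>] conjI ballI impI \<delta>)
      fix h :: "'a \<times> 'a" assume h: "h \<noteq> 0 \<and> dist h 0 < \<delta>"
      obtain x y where hxy: "h = (x, y)" by (cases h)
      have n: "norm x \<le> norm h" "norm y \<le> norm h" unfolding hxy
        by (rule norm_fst_le norm_snd_le)+
      have "norm (?g (x, y) - ?g (0, 0)) \<le> C * norm h ^ (2 - 1) * (norm (x - 0) + norm (y - 0))"
        by (rule est) (use h n in auto)
      also have "\<dots> \<le> C * norm h * (norm h + norm h)"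
        using C n by (intro mult_mono add_mono) auto
      finally have "norm (f (x, y) - (a 0 0 + a 1 0 * x + a 0 1 * y)) \<le> 2 * C * norm h * norm h"
        unfolding g0 by (simp add: fs)
      moreover have "f (0 + h) - f 0 - (case h of (x, y) \<Rightarrow> a 1 0 * x + a 0 1 * y)
          = f (x, y) - (a 0 0 + a 1 0 * x + a 0 1 * y)"
        using expansion_at_value[OF f] by (simp add: hxy)
      ultimately show "norm (norm (f (0 + h) - f 0 - (case h of (x, y) \<Rightarrow> a 1 0 * x + a 0 1 * y)) / norm h)
        \<le> 2 * C * norm h"
        using h by (simp add: pos_divide_le_eq)
    qed
    show "((\<lambda>h::'a \<times> 'a. 2 * C * norm h) \<longlongrightarrow> 0) (at 0)"
      by (intro tendsto_mult_right_zero tendsto_norm_zero tendsto_ident_at)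
  qed
  ultimately show ?thesis unfolding has_derivative_at by simp
qed

lemma eventually_nhds_pair_iff:
  fixes P :: "'a::real_normed_vector \<times> 'b::real_normed_vector \<Rightarrow> bool"
  shows "(\<forall>\<^sub>F w in nhds 0. P w) \<longleftrightarrow> (\<exists>r>0. \<forall>x y. norm x < r \<longrightarrow> norm y < r \<longrightarrow> P (x, y))"
proof
  assume "\<forall>\<^sub>F w in nhds 0. P w"
  then obtain d where d: "d > 0" "\<And>w. dist w 0 < d \<Longrightarrow> P w"
    unfolding eventually_nhds_metric by blast
  have "P (x, y)" if "norm x < d / 2" "norm y < d / 2" for x y
    using d(2)[of "(x, y)"] norm_Pair_le[of x y] that by simp
  then show "\<exists>r>0. \<forall>x y. norm x < r \<longrightarrow> norm y < r \<longrightarrow> P (x, y)"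
    using d(1) by (intro exI[of _ "d / 2"]) auto
next
  assume "\<exists>r>0. \<forall>x y. norm x < r \<longrightarrow> norm y < r \<longrightarrow> P (x, y)"
  then obtain r where r: "r > 0" "\<And>x y. norm x < r \<Longrightarrow> norm y < r \<Longrightarrow> P (x, y)" by blast
  have "P w" if "dist w 0 < r" for w
    using r(2)[of "fst w" "snd w"] norm_fst_le[of "fst w" "snd w"] norm_snd_le[of "snd w" "fst w"] that
    by simp
  then show "\<forall>\<^sub>F w in nhds 0. P w" unfolding eventually_nhds_metric using r(1) by blast
qed

lemma expansion_at_origin_iff:
  "expansion_at f 0 a \<longleftrightarrow> (\<exists>r>0. \<forall>x y. norm x < r \<longrightarrow> norm y < r \<longrightarrow>
     ((\<lambda>(i, j). a i j * x ^ i * y ^ j) has_sum f (x, y)) UNIV)"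
  unfolding expansion_at_def by simp

text \<open>The coefficients of a real expansion satisfy a geometric bound, so that the same series converges
  on a complex bidisc.\<close>

lemma expansion_complexify:
  fixes f :: "real \<times> real \<Rightarrow> real"
  assumes f: "expansion_at f 0 a"
  shows "\<exists>F. expansion_at F 0 (\<lambda>i j. complex_of_real (a i j)) \<and>
     (\<forall>\<^sub>F w in nhds 0. F (of_real (fst w), of_real (snd w)) = of_real (f w))"
proof -
  obtain r0 where r0: "r0 > 0" and
    s: "\<And>x y. norm x < r0 \<Longrightarrow> norm y < r0 \<Longrightarrow>
        ((\<lambda>(i, j). a i j * x ^ i * y ^ j) has_sum f (x, y)) UNIV"
    using f unfolding expansion_at_origin_iff by blast
  obtain r M where r: "r > 0" "M > 0" "\<And>i j. norm (a i j) * r ^ (i + j) \<le> M"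
    using expansion_coeff_bound[OF f] by blast
  define F where "F w = infsum (\<lambda>(i, j). complex_of_real (a i j) * fst w ^ i * snd w ^ j) UNIV" for w
  have F: "((\<lambda>(i, j). complex_of_real (a i j) * x ^ i * y ^ j) has_sum F (x, y)) UNIV"
    if "norm x < r" "norm y < r" for x y
    unfolding F_def fst_conv snd_conv
    by (intro has_sum_infsum coeff_summable_eval[of _ r M]) (use r that in auto)
  have "F (of_real x, of_real y) = of_real (f (x, y))"
    if "norm x < min r r0" "norm y < min r r0" for x y
  proof -
    have "((\<lambda>(i, j). complex_of_real (a i j) * of_real x ^ i * of_real y ^ j) has_sum of_real (f (x, y))) UNIV"
      using has_sum_of_real[OF s[of x y], where 'a = complex] that by (simp add: case_prod_unfold)
    then show ?thesis using has_sum_unique[OF F[of "of_real x" "of_real y"]] that by simp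
  qed
  then have "\<forall>\<^sub>F w in nhds 0. F (of_real (fst w), of_real (snd w)) = of_real (f w)"
    unfolding eventually_nhds_pair_iff using r r0 by (intro exI[of _ "min r r0"]) auto
  then show ?thesis using F r(1) unfolding expansion_at_origin_iff by blast
qed

lemma expansion_swap:
  assumes "expansion_at f 0 a"
  shows "expansion_at (\<lambda>(x, y). f (y, x)) 0 (\<lambda>i j. a j i)"
proof -
  obtain r where r: "r > 0" and
    s: "\<And>x y. norm x < r \<Longrightarrow> norm y < r \<Longrightarrow>
        ((\<lambda>(i, j). a i j * x ^ i * y ^ j) has_sum f (x, y)) UNIV"
    using assms unfolding expansion_at_origin_iff by blast
  have "((\<lambda>(i, j). a j i * x ^ i * y ^ j) has_sum f (y, x)) UNIV"
    if "norm x < r" "norm y < r" for x y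
    using s[OF that(2,1)]
    by (rule iffD1[OF has_sum_reindex_bij_witness[of _ prod.swap prod.swap], rotated -1])
       (auto simp: mult_ac)
  then show ?thesis unfolding expansion_at_origin_iff using r by auto
qed

lemma expansion_diff_cmult:
  assumes "expansion_at f 0 a" "expansion_at g 0 b"
  shows "expansion_at (\<lambda>w. f w - c * g w) 0 (\<lambda>i j. a i j - c * b i j)"
proof -
  obtain r where r: "r > 0" and
    s: "\<And>x y. norm x < r \<Longrightarrow> norm y < r \<Longrightarrow>
        ((\<lambda>(i, j). a i j * x ^ i * y ^ j) has_sum f (x, y)) UNIV"
    using assms(1) unfolding expansion_at_origin_iff by blast
  obtain r' where r': "r' > 0" and
    s': "\<And>x y. norm x < r' \<Longrightarrow> norm y < r' \<Longrightarrow>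
        ((\<lambda>(i, j). b i j * x ^ i * y ^ j) has_sum g (x, y)) UNIV"
    using assms(2) unfolding expansion_at_origin_iff by blast
  have "((\<lambda>(i, j). (a i j - c * b i j) * x ^ i * y ^ j) has_sum f (x, y) - c * g (x, y)) UNIV"
    if "norm x < min r r'" "norm y < min r r'" for x y
  proof -
    have "((\<lambda>q. (case q of (i, j) \<Rightarrow> a i j * x ^ i * y ^ j) + - (c * (case q of (i, j) \<Rightarrow> b i j * x ^ i * y ^ j)))
        has_sum f (x, y) + - (c * g (x, y))) UNIV"
      by (intro has_sum_add has_sum_uminusI has_sum_cmult_right s s') (use that in auto)
    then show ?thesis by (simp add: case_prod_unfold algebra_simps)
  qed
  then show ?thesis unfolding expansion_at_origin_iff using r r' by (intro exI[of _ "min r r'"]) auto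
qed

text \<open>The coefficients of \<open>x g - y f\<close>, where \<open>a\<close> and \<open>b\<close> are those of \<open>f\<close> and \<open>g\<close>.\<close>

definition tangency_coeff :: "(nat \<Rightarrow> nat \<Rightarrow> 'a) \<Rightarrow> (nat \<Rightarrow> nat \<Rightarrow> 'a) \<Rightarrow> nat \<Rightarrow> nat \<Rightarrow> 'a::real_normed_field" where
  "tangency_coeff a b i j = (if i = 0 then 0 else b (i - 1) j) - (if j = 0 then 0 else a i (j - 1))"

lemma expansion_tangency:
  assumes "expansion_at f 0 a" "expansion_at g 0 b"
  shows "expansion_at (\<lambda>(x, y). x * g (x, y) - y * f (x, y)) 0 (tangency_coeff a b)"
proof -
  obtain r where r: "r > 0" and
    s: "\<And>x y. norm x < r \<Longrightarrow> norm y < r \<Longrightarrow>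
        ((\<lambda>(i, j). a i j * x ^ i * y ^ j) has_sum f (x, y)) UNIV"
    using assms(1) unfolding expansion_at_origin_iff by blast
  obtain r' where r': "r' > 0" and
    s': "\<And>x y. norm x < r' \<Longrightarrow> norm y < r' \<Longrightarrow>
        ((\<lambda>(i, j). b i j * x ^ i * y ^ j) has_sum g (x, y)) UNIV"
    using assms(2) unfolding expansion_at_origin_iff by blast
  have "((\<lambda>(i, j). tangency_coeff a b i j * x ^ i * y ^ j) has_sum x * g (x, y) - y * f (x, y)) UNIV"
    if "norm x < min r r'" "norm y < min r r'" for x y
  proof -
    have "((\<lambda>(i, j). (if i = 0 then 0 else b (i - 1) j) * x ^ i * y ^ j) has_sum x * g (x, y)) (range (\<lambda>(i, j). (Suc i, j)))"
      using has_sum_cmult_right[OF s'[of x y], of x] that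
      by (subst has_sum_reindex) (auto simp: inj_def o_def case_prod_unfold mult_ac)
    then have g: "((\<lambda>(i, j). (if i = 0 then 0 else b (i - 1) j) * x ^ i * y ^ j) has_sum x * g (x, y)) UNIV"
      by (rule iffD1[OF has_sum_cong_neutral, rotated -1])
         (auto simp: image_iff gr0_conv_Suc elim: not0_implies_Suc)
    have "((\<lambda>(i, j). (if j = 0 then 0 else a i (j - 1)) * x ^ i * y ^ j) has_sum y * f (x, y)) (range (\<lambda>(i, j). (i, Suc j)))"
      using has_sum_cmult_right[OF s[of x y], of y] that
      by (subst has_sum_reindex) (auto simp: inj_def o_def case_prod_unfold mult_ac)
    then have f: "((\<lambda>(i, j). (if j = 0 then 0 else a i (j - 1)) * x ^ i * y ^ j) has_sum y * f (x, y)) UNIV"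
      by (rule iffD1[OF has_sum_cong_neutral, rotated -1])
         (auto simp: image_iff gr0_conv_Suc elim: not0_implies_Suc)
    have "(\<lambda>q. (case q of (i, j) \<Rightarrow> (if i = 0 then 0 else b (i - 1) j) * x ^ i * y ^ j) +
          - (case q of (i, j) \<Rightarrow> (if j = 0 then 0 else a i (j - 1)) * x ^ i * y ^ j))
        = (\<lambda>(i, j). tangency_coeff a b i j * x ^ i * y ^ j)"
      unfolding tangency_coeff_def by (auto simp: fun_eq_iff left_diff_distrib)
    then show ?thesis using has_sum_add[OF g has_sum_uminusI[OF f]] by simp
  qed
  then show ?thesis unfolding expansion_at_origin_iff using r r' by (intro exI[of _ "min r r'"]) auto
qed

text \<open>Expand \<open>(y + c x) ^ j\<close> by the binomial theorem and regroup the resulting series over triples of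
  indices; a fixed monomial \<open>x ^ k y ^ l\<close> collects finitely many of its terms, those with
  \<open>i + j = k + l\<close>.\<close>

lemma analytic_shear:
  fixes f :: "'a::{real_normed_field, banach} \<times> 'a \<Rightarrow> 'a"
  assumes "expansion_at f 0 a"
  shows "analytic2_at (\<lambda>(x, y). f (x, y + c * x)) 0"
proof -
  obtain r0 where r0: "r0 > 0" and
    s: "\<And>x y. norm x < r0 \<Longrightarrow> norm y < r0 \<Longrightarrow>
        ((\<lambda>(i, j). a i j * x ^ i * y ^ j) has_sum f (x, y)) UNIV"
    using assms unfolding expansion_at_origin_iff by blast
  obtain r1 M where r1: "r1 > 0" "M > 0" "\<And>i j. norm (a i j) * r1 ^ (i + j) \<le> M"
    using expansion_coeff_bound[OF assms] by blast
  define r where "r = min r0 r1 / (2 * (1 + norm c))"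
  have c1: "1 + norm c > 0" by (simp add: add_pos_nonneg)
  have "2 * (1 + norm c) > 0" by (rule mult_pos_pos[OF _ c1]) simp
  then have r: "r > 0" unfolding r_def by (rule divide_pos_pos[rotated]) (use r0 r1 in simp)
  define b where "b k l = (\<Sum>j\<in>{l..k + l}. a (k + l - j) j * of_nat (j choose l) * c ^ (j - l))" for k l
  have "((\<lambda>(k, l). b k l * x ^ k * y ^ l) has_sum f (x, y + c * x)) UNIV"
    if xy: "norm x < r" "norm y < r" for x y
  proof -
    have "r + norm c * r = (1 + norm c) * r" by (simp add: algebra_simps)
    also have "\<dots> = min r0 r1 / 2"
      unfolding r_def using c1 by (simp add: field_simps)
    finally have rr: "r + norm c * r = min r0 r1 / 2" .
    have "norm y + norm c * norm x \<le> r + norm c * r"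
      using xy by (intro add_mono mult_left_mono) auto
    moreover have "min r0 r1 / 2 < min r0 r1" using r0 r1 by (simp add: min_def)
    ultimately have y1: "norm y + norm c * norm x < min r0 r1" using rr by linarith
    have "0 \<le> norm c * r" using r by simp
    with xy rr r0 r1 have x1: "norm x < min r0 r1" by linarith
    have y2: "norm (y + c * x) < min r0 r1"
      using y1 norm_triangle_ineq[of y "c * x"] by (simp add: norm_mult)
    let ?F = "\<lambda>((i, j), l). a i j * of_nat (j choose l) * c ^ (j - l) * (x ^ i * x ^ (j - l)) * y ^ l"
    have inner: "(\<Sum>l\<le>j. A * of_nat (j choose l) * C ^ (j - l) * (X ^ i * X ^ (j - l)) * Y ^ l)
        = A * X ^ i * (Y + C * X) ^ j" for A C X Y :: "'b::real_normed_field" and i j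
      by (simp add: binomial_ring sum_distrib_left power_mult_distrib mult_ac)
    have "(\<lambda>q. norm (?F q)) summable_on Sigma UNIV (\<lambda>(i, j). {..j})"
    proof (rule summable_on_SigmaI)
      fix ij :: "nat \<times> nat"
      obtain i j where ij: "ij = (i, j)" by (cases ij)
      show "((\<lambda>l. norm (?F (ij, l))) has_sum
          (case ij of (i, j) \<Rightarrow> norm (a i j) * norm x ^ i * (norm y + norm c * norm x) ^ j))
          (case ij of (i, j) \<Rightarrow> {..j})"
        using inner[of "norm (a i j)" j "norm c" "norm x" i "norm y"]
        by (intro has_sum_finiteI) (auto simp: ij norm_mult norm_power)
    next
      show "(\<lambda>(i, j). norm (a i j) * norm x ^ i * (norm y + norm c * norm x) ^ j) summable_on UNIV"
        by (rule coeff_summable_eval[of _ r1 M]) (use r1 x1 y1 in auto)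
    qed auto
    then have sum: "?F summable_on Sigma UNIV (\<lambda>(i, j). {..j})"
      by (rule Infinite_Sum.abs_summable_summable)
    have "(?F has_sum f (x, y + c * x)) (Sigma UNIV (\<lambda>(i, j). {..j}))"
    proof (rule has_sum_SigmaI[OF _ s sum])
      fix ij :: "nat \<times> nat"
      obtain i j where ij: "ij = (i, j)" by (cases ij)
      show "((\<lambda>l. ?F (ij, l)) has_sum (case ij of (i, j) \<Rightarrow> a i j * x ^ i * (y + c * x) ^ j))
          (case ij of (i, j) \<Rightarrow> {..j})"
        using inner[of "a i j" j c x i y] by (intro has_sum_finiteI) (auto simp: ij)
    qed (use x1 y2 in auto)
    then have "((\<lambda>((k, l), j). a (k + l - j) j * of_nat (j choose l) * c ^ (j - l) * x ^ k * y ^ l)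
        has_sum f (x, y + c * x)) (Sigma UNIV (\<lambda>(k, l). {l..k + l}))"
      by (rule iffD1[OF has_sum_reindex_bij_witness
            [of _ "\<lambda>((k, l), j). ((k + l - j, j), l)" "\<lambda>((i, j), l). ((i + j - l, l), j)"], rotated -1])
         (auto simp flip: power_add)
    then show "((\<lambda>(k, l). b k l * x ^ k * y ^ l) has_sum f (x, y + c * x)) UNIV"
      by (rule has_sum_SigmaD) (auto intro!: has_sum_finiteI simp: b_def sum_distrib_right)
  qed
  then show ?thesis unfolding analytic2_at_def expansion_at_origin_iff using r
    by (intro exI[of _ b] exI[of _ r]) auto
qed

section \<open>Strict transforms\<close>

text \<open>The quotient of the pull-back of \<open>f\<close> under \<open>(u, v) \<mapsto> (u, u v)\<close> by \<open>u ^ m\<close>. On the exceptional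
  divisor \<open>u = 0\<close> it has to be the part of degree \<open>m\<close> of \<open>f\<close>, evaluated at \<open>(1, v)\<close>.\<close>

definition exceptional_quotient ::
  "(nat \<Rightarrow> nat \<Rightarrow> 'a::real_normed_field) \<Rightarrow> ('a \<times> 'a \<Rightarrow> 'a) \<Rightarrow> nat \<Rightarrow> 'a \<times> 'a \<Rightarrow> 'a" where
  "exceptional_quotient a f m = (\<lambda>(u, v). if u = 0 then \<Sum>j\<le>m. a (m - j) j * v ^ j else f (u, u * v) / u ^ m)"

lemma expansion_exceptional_quotient:
  fixes f :: "'a::real_normed_field \<times> 'a \<Rightarrow> 'a"
  assumes "expansion_at f 0 a" and zero: "\<And>i j. i + j < m \<Longrightarrow> a i j = 0"
  shows "expansion_at (exceptional_quotient a f m) 0 (\<lambda>k j. if j \<le> k + m then a (k + m - j) j else 0)"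
proof -
  obtain r where r: "r > 0" and
    s: "\<And>x y. norm x < r \<Longrightarrow> norm y < r \<Longrightarrow>
        ((\<lambda>(i, j). a i j * x ^ i * y ^ j) has_sum f (x, y)) UNIV"
    using assms(1) unfolding expansion_at_origin_iff by blast
  have "((\<lambda>(k, j). (if j \<le> k + m then a (k + m - j) j else 0) * u ^ k * v ^ j)
      has_sum exceptional_quotient a f m (u, v)) UNIV"
    if uv: "norm u < min r 1" "norm v < min r 1" for u v
  proof (cases "u = 0")
    case True
    show ?thesis
    proof (rule has_sum_finite_neutralI[of "Pair 0 ` {..m}"])
      fix q :: "nat \<times> nat" assume q: "q \<in> UNIV - Pair 0 ` {..m}"
      obtain k j where kj: "q = (k, j)" by (cases q)
      have "k = 0 \<Longrightarrow> \<not> j \<le> m" using q kj by blast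
      then show "(case q of (k, j) \<Rightarrow> (if j \<le> k + m then a (k + m - j) j else 0) * u ^ k * v ^ j) = 0"
        by (auto simp: kj True)
    qed (auto simp: True exceptional_quotient_def sum.reindex inj_on_def)
  next
    case False
    have "norm u * norm v \<le> norm u * 1" using uv by (intro mult_left_mono) auto
    then have "norm (u * v) < r" using uv by (simp add: norm_mult)
    then have "((\<lambda>(i, j). a i j * u ^ i * (u * v) ^ j / u ^ m) has_sum f (u, u * v) / u ^ m) UNIV"
      using has_sum_divide_const[OF s[of u "u * v"], of "u ^ m"] uv by (simp add: case_prod_unfold)
    then have "((\<lambda>(i, j). a i j * u ^ i * (u * v) ^ j / u ^ m) has_sum f (u, u * v) / u ^ m) {(i, j). m \<le> i + j}"
      by (rule iffD1[OF has_sum_cong_neutral, rotated -1]) (auto simp: zero)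
    then have "((\<lambda>(k, j). a (k + m - j) j * u ^ k * v ^ j) has_sum f (u, u * v) / u ^ m) {(k, j). j \<le> k + m}"
    proof (rule iffD1[OF has_sum_reindex_bij_witness
          [of _ "\<lambda>(k, j). (k + m - j, j)" "\<lambda>(i, j). (i + j - m, j)"], rotated -1])
      fix p :: "nat \<times> nat" assume p: "p \<in> {(i, j). m \<le> i + j}"
      obtain i j where ij: "p = (i, j)" by (cases p)
      have "u ^ (i + j - m) = u ^ (i + j) / u ^ m" using p ij False by (simp add: power_diff)
      then show "(case (case p of (i, j) \<Rightarrow> (i + j - m, j)) of (k, j) \<Rightarrow> a (k + m - j) j * u ^ k * v ^ j)
          = (case p of (i, j) \<Rightarrow> a i j * u ^ i * (u * v) ^ j / u ^ m)"
        using p by (simp add: ij power_add power_mult_distrib mult_ac)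
    qed auto
    then have "((\<lambda>(k, j). (if j \<le> k + m then a (k + m - j) j else 0) * u ^ k * v ^ j)
        has_sum f (u, u * v) / u ^ m) UNIV"
      by (rule iffD1[OF has_sum_cong_neutral, rotated -1]) auto
    then show ?thesis using False by (simp add: exceptional_quotient_def)
  qed
  then show ?thesis unfolding expansion_at_origin_iff using r by (intro exI[of _ "min r 1"]) auto
qed

lemma frechet_derivative_chart_Slope:
  "frechet_derivative (blowup_chart (Slope c)) (at (u, v)) = (\<lambda>(\<xi>, \<eta>). (\<xi>, \<xi> * (c + v) + u * \<eta>))"
proof -
  have "(blowup_chart (Slope c) has_derivative (\<lambda>(\<xi>, \<eta>). (\<xi>, \<xi> * (c + v) + u * \<eta>))) (at (u, v))"
  proof -
    have "((\<lambda>w. (fst w, fst w * (c + snd w))) has_derivative (\<lambda>(\<xi>, \<eta>). (\<xi>, \<xi> * (c + v) + u * \<eta>))) (at (u, v))"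
      by (auto intro!: derivative_eq_intros simp: fun_eq_iff algebra_simps)
    moreover have "(\<lambda>w. (fst w, fst w * (c + snd w))) = blowup_chart (Slope c)"
      by (auto simp: fun_eq_iff)
    ultimately show ?thesis by simp
  qed
  then show ?thesis by (rule frechet_derivative_at[symmetric])
qed

lemma frechet_derivative_chart_Vertical:
  "frechet_derivative (blowup_chart Vertical) (at (u, v)) = (\<lambda>(\<xi>, \<eta>). (\<xi> * v + u * \<eta>, \<xi>))"
proof -
  have "(blowup_chart Vertical has_derivative (\<lambda>(\<xi>, \<eta>). (\<xi> * v + u * \<eta>, \<xi>))) (at (u, v))"
  proof -
    have "((\<lambda>w. (fst w * snd w, fst w)) has_derivative (\<lambda>(\<xi>, \<eta>). (\<xi> * v + u * \<eta>, \<xi>))) (at (u, v))"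
      by (auto intro!: derivative_eq_intros simp: fun_eq_iff algebra_simps)
    moreover have "(\<lambda>w. (fst w * snd w, fst w)) = blowup_chart Vertical"
      by (auto simp: fun_eq_iff)
    ultimately show ?thesis by simp
  qed
  then show ?thesis by (rule frechet_derivative_at[symmetric])
qed

text \<open>The chart at the direction of slope \<open>c\<close> is the chart at slope \<open>0\<close> followed by the shear
  \<open>(x, y) \<mapsto> (x, y + c x)\<close>, so only the direction of slope \<open>0\<close> has to be treated by hand.\<close>

lemma strict_transform_Slope_shear:
  assumes "strict_transform (Slope 0)
     (\<lambda>(x, y). (fst (X (x, y + c * x)), snd (X (x, y + c * x)) - c * fst (X (x, y + c * x)))) Y"
  shows "strict_transform (Slope c) X Y"
proof -
  let ?X = "\<lambda>(x, y). (fst (X (x, y + c * x)), snd (X (x, y + c * x)) - c * fst (X (x, y + c * x)))"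
  have *: "X (blowup_chart (Slope c) w) = frechet_derivative (blowup_chart (Slope c)) (at w)
          (fst w ^ m * fst (Y w), fst w ^ m * snd (Y w))"
    if "?X (blowup_chart (Slope 0) w) = frechet_derivative (blowup_chart (Slope 0)) (at w)
          (fst w ^ m * fst (Y w), fst w ^ m * snd (Y w))" for w m
  proof -
    obtain u v where w: "w = (u, v)" by (cases w)
    have "u * v + c * u = u * (c + v)" by (simp add: algebra_simps)
    with that show ?thesis
      by (auto simp: w frechet_derivative_chart_Slope prod_eq_iff algebra_simps)
  qed
  then show ?thesis using assms
    unfolding strict_transform_def by (fast elim: eventually_mono)
qed

lemma strict_transform_Vertical_swap:
  assumes "strict_transform (Slope 0) (\<lambda>(x, y). (snd (X (y, x)), fst (X (y, x)))) Y"
  shows "strict_transform Vertical X Y"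
proof -
  let ?X = "\<lambda>(x, y). (snd (X (y, x)), fst (X (y, x)))"
  have *: "X (blowup_chart Vertical w) = frechet_derivative (blowup_chart Vertical) (at w)
          (fst w ^ m * fst (Y w), fst w ^ m * snd (Y w))"
    if "?X (blowup_chart (Slope 0) w) = frechet_derivative (blowup_chart (Slope 0)) (at w)
          (fst w ^ m * fst (Y w), fst w ^ m * snd (Y w))" for w m
  proof -
    obtain u v where w: "w = (u, v)" by (cases w)
    with that show ?thesis
      by (auto simp: w frechet_derivative_chart_Slope frechet_derivative_chart_Vertical prod_eq_iff)
  qed
  then show ?thesis using assms
    unfolding strict_transform_def by (fast elim: eventually_mono)
qed

lemma polynomial_not_eventually_zero:
  fixes e :: "nat \<Rightarrow> complex"
  assumes "j \<le> n" "e j \<noteq> 0"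
  shows "\<not> (\<forall>\<^sub>F v in nhds 0. (\<Sum>j\<le>n. e j * v ^ j) = 0)"
proof
  assume "\<forall>\<^sub>F v in nhds 0. (\<Sum>j\<le>n. e j * v ^ j) = 0"
  then obtain d where d: "d > 0" "\<And>v. dist v 0 < d \<Longrightarrow> (\<Sum>j\<le>n. e j * v ^ j) = 0"
    unfolding eventually_nhds_metric by blast
  have "finite {v. (\<Sum>j\<le>n. e j * v ^ j) = 0}"
    using polyfun_finite_roots[of e n] assms by blast
  moreover have "ball 0 d \<subseteq> {v. (\<Sum>j\<le>n. e j * v ^ j) = 0}"
    using d by (auto simp: dist_commute)
  ultimately have "finite (ball (0::complex) d)" using finite_subset by blast
  then show False using d(1) finite_imp_not_open[of "ball (0::complex) d"] by simp
qed

text \<open>In the chart \<open>(u, u v)\<close> the transform of \<open>X = P \<partial>x + Q \<partial>y\<close> has the components \<open>P / u ^ m\<close> and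
  \<open>(x Q - y P) / u ^ (m + 2)\<close>. The largest possible \<open>m\<close> depends on whether the leading part, of
  degree \<open>n + 1\<close>, of \<open>x Q - y P\<close> vanishes. If it does, then the first component does not vanish
  along the divisor, that is, the divisor is dicritical.\<close>

lemma strict_transform_Slope_0:
  fixes X :: "complex vfield"
  assumes a: "expansion_at (fst \<circ> X) 0 a" and b: "expansion_at (snd \<circ> X) 0 b"
    and X0: "X 0 = 0"
    and low: "\<And>i j. i + j < n \<Longrightarrow> a i j = 0 \<and> b i j = 0"
    and top: "i\<^sub>0 + j\<^sub>0 = n" "a i\<^sub>0 j\<^sub>0 \<noteq> 0 \<or> b i\<^sub>0 j\<^sub>0 \<noteq> 0"
  shows "\<exists>Y. strict_transform (Slope 0) X Y \<and>
    ((\<forall>i j. i + j = Suc n \<longrightarrow> tangency_coeff a b i j = 0) \<longrightarrow> \<not> (\<forall>\<^sub>F v in nhds 0. fst (Y (0, v)) = 0))"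
proof -
  define T where "T = (\<lambda>(x, y). x * (snd \<circ> X) (x, y) - y * (fst \<circ> X) (x, y))"
  define t where "t = tangency_coeff a b"
  have T: "expansion_at T 0 t" unfolding T_def t_def by (rule expansion_tangency[OF a b])
  have tlow: "t i j = 0" if "i + j \<le> n" for i j
    using that low[of "i - 1" j] low[of i "j - 1"] by (auto simp: t_def tangency_coeff_def)
  have a00: "a 0 0 = 0" "b 0 0 = 0"
    using expansion_at_value[OF a] expansion_at_value[OF b] X0 by auto
  then have n: "n \<ge> 1" using top by (cases n) auto
  define dic where "dic \<longleftrightarrow> (\<forall>i j. i + j = Suc n \<longrightarrow> t i j = 0)"
  \<comment> \<open>The exponent of the largest power of \<open>u\<close> dividing the pull-back.\<close>
  define m where "m = (if dic then n else n - 1)"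
  define Y where "Y w = (exceptional_quotient a (fst \<circ> X) m w, exceptional_quotient t T (m + 2) w)" for w
  have alow: "a i j = 0" if "i + j < m" for i j
    using low[of i j] that by (auto simp: m_def split: if_splits)
  have tlow': "t i j = 0" if "i + j < m + 2" for i j
  proof (cases "i + j = Suc n")
    case True
    then show ?thesis using that n by (auto simp: m_def dic_def split: if_splits)
  next
    case False
    then show ?thesis using that n tlow[of i j] by (auto simp: m_def split: if_splits)
  qed
  have "vfield_analytic_at Y 0"
    using expansion_exceptional_quotient[OF a alow] expansion_exceptional_quotient[OF T tlow']
    unfolding vfield_analytic_at_def analytic2_at_def Y_def[abs_def] by (auto simp: o_def)
  moreover have "X (blowup_chart (Slope 0) w) = frechet_derivative (blowup_chart (Slope 0)) (at w)
          (fst w ^ m * fst (Y w), fst w ^ m * snd (Y w))" for w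
  proof -
    obtain u v where w: "w = (u, v)" by (cases w)
    show ?thesis
    proof (cases "u = 0")
      case True
      then show ?thesis using X0 a00
        by (cases m) (auto simp: w frechet_derivative_chart_Slope Y_def exceptional_quotient_def zero_prod_def)
    next
      case False
      then show ?thesis
        by (auto simp: w frechet_derivative_chart_Slope Y_def exceptional_quotient_def T_def prod_eq_iff
            divide_simps power2_eq_square algebra_simps)
    qed
  qed
  moreover have A: "dic \<Longrightarrow> \<not> (\<forall>\<^sub>F v in nhds 0. fst (Y (0, v)) = 0)"
  proof -
    assume dic
    have "\<exists>j\<le>n. a (n - j) j \<noteq> 0"
    proof (cases "a i\<^sub>0 j\<^sub>0 = 0")
      case False
      then show ?thesis using top by (intro exI[of _ j\<^sub>0]) auto
    next
      case True
      then have "b i\<^sub>0 j\<^sub>0 \<noteq> 0" using top by simp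
      moreover have "t (Suc i\<^sub>0) j\<^sub>0 = 0" using \<open>dic\<close> top(1) by (auto simp: dic_def)
      ultimately have "j\<^sub>0 > 0" "a (Suc i\<^sub>0) (j\<^sub>0 - 1) \<noteq> 0"
        by (auto simp: t_def tangency_coeff_def split: if_splits)
      moreover have "n - (j\<^sub>0 - 1) = Suc i\<^sub>0" using top(1) \<open>j\<^sub>0 > 0\<close> by simp
      ultimately show ?thesis using top(1) by (intro exI[of _ "j\<^sub>0 - 1"]) auto
    qed
    then obtain j where "j \<le> n" "a (n - j) j \<noteq> 0" by blast
    from polynomial_not_eventually_zero[of j n "\<lambda>j. a (n - j) j", OF this] \<open>dic\<close> show ?thesis
      by (simp add: Y_def m_def exceptional_quotient_def)
  qed
  moreover have "\<not> (\<forall>\<^sub>F v in nhds 0. Y (0, v) = 0)"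
  proof (cases dic)
    case True
    show ?thesis
    proof
      assume "\<forall>\<^sub>F v in nhds 0. Y (0, v) = 0"
      then have "\<forall>\<^sub>F v in nhds 0. fst (Y (0, v)) = 0" by eventually_elim simp
      with A True show False by blast
    qed
  next
    case False
    then obtain i j where ij: "i + j = Suc n" "t i j \<noteq> 0" by (auto simp: dic_def)
    have m2: "m + 2 = Suc n" using False n by (simp add: m_def)
    have "j \<le> Suc n" "t (Suc n - j) j \<noteq> 0" using ij by (auto simp flip: ij(1))
    from polynomial_not_eventually_zero[of j "Suc n" "\<lambda>j. t (Suc n - j) j", OF this]
    have nz: "\<not> (\<forall>\<^sub>F v in nhds 0. snd (Y (0, v)) = 0)"
      unfolding Y_def m2 by (simp add: exceptional_quotient_def)
    show ?thesis
    proof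
      assume "\<forall>\<^sub>F v in nhds 0. Y (0, v) = 0"
      then have "\<forall>\<^sub>F v in nhds 0. snd (Y (0, v)) = 0" by eventually_elim simp
      with nz show False by blast
    qed
  qed
  ultimately have "strict_transform (Slope 0) X Y"
    unfolding strict_transform_def by (intro conjI exI[of _ m] always_eventually allI)
  then show ?thesis using A unfolding dic_def t_def by blast
qed

lemma vfield_expansionsE:
  assumes "vfield_analytic_at X 0"
  obtains a b where "expansion_at (fst \<circ> X) 0 a" "expansion_at (snd \<circ> X) 0 b"
  using assms unfolding vfield_analytic_at_def analytic2_at_def by blast

lemma expansion_zero_eventually:
  assumes "expansion_at f 0 a" "\<And>i j. a i j = 0"
  shows "\<forall>\<^sub>F w in nhds 0. f w = 0"
proof -
  obtain r where r: "r > 0" and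
    s: "\<And>x y. norm x < r \<Longrightarrow> norm y < r \<Longrightarrow>
        ((\<lambda>(i, j). a i j * x ^ i * y ^ j) has_sum f (x, y)) UNIV"
    using assms(1) unfolding expansion_at_origin_iff by blast
  have "f (x, y) = 0" if "norm x < r" "norm y < r" for x y
    using has_sum_unique[OF s[OF that], of 0] by (simp add: assms(2) case_prod_unfold)
  then show ?thesis unfolding eventually_nhds_pair_iff using r by blast
qed

text \<open>Any expansion of a vector field that is not identically zero has a nonzero coefficient, and
  one of lowest degree provides the order needed above.\<close>

lemma strict_transform_Slope_0_exists:
  fixes X :: "complex vfield"
  assumes X: "vfield_analytic_at X 0" "X 0 = 0" and nz: "\<not> (\<forall>\<^sub>F w in nhds 0. X w = 0)"
  shows "\<exists>Y. strict_transform (Slope 0) X Y"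
proof -
  obtain a b where a: "expansion_at (fst \<circ> X) 0 a" and b: "expansion_at (snd \<circ> X) 0 b"
    using vfield_expansionsE[OF X(1)] by blast
  define P where "P n \<longleftrightarrow> (\<exists>i j. i + j = n \<and> (a i j \<noteq> 0 \<or> b i j \<noteq> 0))" for n
  have "\<exists>n. P n"
  proof (rule ccontr)
    assume "\<not> ?thesis"
    then have z: "a i j = 0" "b i j = 0" for i j by (auto simp: P_def)
    have "\<forall>\<^sub>F w in nhds 0. X w = 0"
      using expansion_zero_eventually[OF a z(1)] expansion_zero_eventually[OF b z(2)]
      by eventually_elim (simp add: prod_eq_iff)
    with nz show False by blast
  qed
  then have P: "P (LEAST n. P n)" by (rule LeastI_ex)
  then obtain i j where ij: "i + j = (LEAST n. P n)" "a i j \<noteq> 0 \<or> b i j \<noteq> 0"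
    unfolding P_def[of "LEAST n. P n"] by blast
  have "a k l = 0 \<and> b k l = 0" if "k + l < (LEAST n. P n)" for k l
    using not_less_Least[OF that] by (auto simp: P_def)
  from strict_transform_Slope_0[OF a b X(2) this ij] show ?thesis by blast
qed

lemma analytic2_diff_cmult:
  "analytic2_at f 0 \<Longrightarrow> analytic2_at g 0 \<Longrightarrow> analytic2_at (\<lambda>w. f w - c * g w) 0"
  unfolding analytic2_at_def using expansion_diff_cmult by blast

lemma eventually_nhds_0_linear_pullback:
  fixes A :: "'a::real_normed_vector \<Rightarrow> 'b::real_normed_vector"
  assumes "isCont A 0" "A 0 = 0" "\<forall>\<^sub>F w in nhds 0. P w"
  shows "\<forall>\<^sub>F w in nhds 0. P (A w)"
proof -
  have "(A \<longlongrightarrow> A 0) (nhds 0)" using assms(1) by (simp add: isCont_def tendsto_at_iff_tendsto_nhds)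
  then show ?thesis using assms(2,3) by (simp add: filterlim_iff)
qed

lemma strict_transform_exists:
  fixes X :: "complex vfield"
  assumes X: "vfield_analytic_at X 0" "X 0 = 0" and nz: "\<not> (\<forall>\<^sub>F w in nhds 0. X w = 0)"
  shows "\<exists>Y. strict_transform s X Y"
proof (cases s)
  case (Slope c)
  let ?X = "\<lambda>(x, y). (fst (X (x, y + c * x)), snd (X (x, y + c * x)) - c * fst (X (x, y + c * x)))"
  obtain a b where a: "expansion_at (fst \<circ> X) 0 a" and b: "expansion_at (snd \<circ> X) 0 b"
    using vfield_expansionsE[OF X(1)] by blast
  have "analytic2_at (\<lambda>(x, y). (fst \<circ> X) (x, y + c * x)) 0"
    "analytic2_at (\<lambda>w. (case w of (x, y) \<Rightarrow> (snd \<circ> X) (x, y + c * x))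
        - c * (case w of (x, y) \<Rightarrow> (fst \<circ> X) (x, y + c * x))) 0"
    by (intro analytic2_diff_cmult analytic_shear[OF a] analytic_shear[OF b])+
  then have "vfield_analytic_at ?X 0"
    unfolding vfield_analytic_at_def by (simp add: o_def case_prod_unfold)
  moreover have "?X 0 = 0" using X(2) by (simp add: zero_prod_def)
  moreover have "\<not> (\<forall>\<^sub>F w in nhds 0. ?X w = 0)"
  proof
    assume "\<forall>\<^sub>F w in nhds 0. ?X w = 0"
    then have "\<forall>\<^sub>F w in nhds 0. ?X (fst w, snd w - c * fst w) = 0"
      by (rule eventually_nhds_0_linear_pullback[rotated 2]) (auto intro!: continuous_intros simp: zero_prod_def)
    then have "\<forall>\<^sub>F w in nhds 0. X w = 0"
      by eventually_elim (auto simp: prod_eq_iff)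
    with nz show False by blast
  qed
  ultimately show ?thesis
    using strict_transform_Slope_0_exists[of ?X] strict_transform_Slope_shear[of X c] Slope by blast
next
  case Vertical
  let ?X = "\<lambda>(x, y). (snd (X (y, x)), fst (X (y, x)))"
  obtain a b where a: "expansion_at (fst \<circ> X) 0 a" and b: "expansion_at (snd \<circ> X) 0 b"
    using vfield_expansionsE[OF X(1)] by blast
  have "vfield_analytic_at ?X 0"
    using expansion_swap[OF a] expansion_swap[OF b]
    unfolding vfield_analytic_at_def analytic2_at_def by (auto simp: o_def case_prod_unfold)
  moreover have "?X 0 = 0" using X(2) by (simp add: zero_prod_def)
  moreover have "\<not> (\<forall>\<^sub>F w in nhds 0. ?X w = 0)"
  proof
    assume "\<forall>\<^sub>F w in nhds 0. ?X w = 0"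
    then have "\<forall>\<^sub>F w in nhds 0. ?X (prod.swap w) = 0"
      by (rule eventually_nhds_0_linear_pullback[rotated 2])
         (auto intro!: continuous_intros simp: zero_prod_def prod.swap_def)
    then have "\<forall>\<^sub>F w in nhds 0. X w = 0"
      by eventually_elim (auto simp: prod_eq_iff prod.swap_def)
    with nz show False by blast
  qed
  ultimately show ?thesis
    using strict_transform_Slope_0_exists[of ?X] strict_transform_Vertical_swap[of X] Vertical by blast
qed

section \<open>Order, complexification and linear part\<close>

lemma Inf_enat_in: "S \<noteq> {} \<Longrightarrow> Inf S \<in> (S :: enat set)"
  unfolding Inf_enat_def using LeastI[of "\<lambda>x. x \<in> S"] by auto

lemma vanishing_order_le: "expansion_at f 0 a \<Longrightarrow> a i j \<noteq> 0 \<Longrightarrow> vanishing_order f \<le> enat (i + j)"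
  unfolding vanishing_order_def by (intro Inf_lower) blast

lemma vanishing_order_attained:
  assumes "vanishing_order f = enat n"
  obtains a i j where "expansion_at f 0 a" "i + j = n" "a i j \<noteq> 0"
proof -
  let ?S = "{enat (i + j) | i j a. expansion_at f 0 a \<and> a i j \<noteq> 0}"
  have "?S \<noteq> {}" using assms unfolding vanishing_order_def Inf_enat_def by (simp split: if_splits)
  from Inf_enat_in[OF this] have "enat n \<in> ?S" using assms unfolding vanishing_order_def by simp
  then show ?thesis using that by auto
qed

text \<open>The order of a vector field is defined through all expansions of its components. Here it is
  realized by one pair of expansions.\<close>

lemma vfield_order_expansions:
  assumes X: "vfield_analytic_at X 0" and o: "vfield_order X = enat n"
  obtains a b i\<^sub>0 j\<^sub>0 where "expansion_at (fst \<circ> X) 0 a" "expansion_at (snd \<circ> X) 0 b"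
    "\<And>i j. i + j < n \<Longrightarrow> a i j = 0 \<and> b i j = 0" "i\<^sub>0 + j\<^sub>0 = n" "a i\<^sub>0 j\<^sub>0 \<noteq> 0 \<or> b i\<^sub>0 j\<^sub>0 \<noteq> 0"
proof -
  obtain a' b' where ab': "expansion_at (fst \<circ> X) 0 a'" "expansion_at (snd \<circ> X) 0 b'"
    using vfield_expansionsE[OF X] by blast
  have le: "enat n \<le> vanishing_order (fst \<circ> X)" "enat n \<le> vanishing_order (snd \<circ> X)"
    using o unfolding vfield_order_def by (metis min.cobounded1, metis min.cobounded2)
  have low: "a i j = 0 \<and> b i j = 0"
    if "expansion_at (fst \<circ> X) 0 a" "expansion_at (snd \<circ> X) 0 b" "i + j < n" for a b i j
    using order_trans[OF le(1) vanishing_order_le[OF that(1)], of i j]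
      order_trans[OF le(2) vanishing_order_le[OF that(2)], of i j] that(3) by (auto simp: not_le)
  consider "vanishing_order (fst \<circ> X) = enat n" | "vanishing_order (snd \<circ> X) = enat n"
    using o unfolding vfield_order_def min_def by (auto split: if_splits)
  then show ?thesis
  proof cases
    case 1
    then obtain a i j where "expansion_at (fst \<circ> X) 0 a" "i + j = n" "a i j \<noteq> 0"
      by (rule vanishing_order_attained)
    then show ?thesis using that[of a b' i j] low ab' by blast
  next
    case 2
    then obtain b i j where "expansion_at (snd \<circ> X) 0 b" "i + j = n" "b i j \<noteq> 0"
      by (rule vanishing_order_attained)
    then show ?thesis using that[of a' b i j] low ab' by blast
  qed
qed

definition complex_point :: "real \<times> real \<Rightarrow> complex \<times> complex" where
  "complex_point w = (of_real (fst w), of_real (snd w))"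

lemma complex_point_tendsto_0:
  "(w \<longlongrightarrow> 0) F \<Longrightarrow> ((\<lambda>n. complex_point (w n)) \<longlongrightarrow> 0) F"
  unfolding complex_point_def zero_prod_def by (auto intro!: tendsto_eq_intros)

lemma complexification_eventually:
  "complexification Z X \<Longrightarrow> \<forall>\<^sub>F w in nhds 0. X (complex_point w) = complex_point (Z w)"
  unfolding complexification_def complex_point_def by (simp add: case_prod_unfold)

lemma complexification_exists:
  assumes a: "expansion_at (fst \<circ> Z) 0 a" and b: "expansion_at (snd \<circ> Z) 0 b"
  obtains X where "complexification Z X"
    "expansion_at (fst \<circ> X) 0 (\<lambda>i j. of_real (a i j))" "expansion_at (snd \<circ> X) 0 (\<lambda>i j. of_real (b i j))"
proof -
  obtain P where P: "expansion_at P 0 (\<lambda>i j. complex_of_real (a i j))"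
    "\<forall>\<^sub>F w in nhds 0. P (of_real (fst w), of_real (snd w)) = of_real ((fst \<circ> Z) w)"
    using expansion_complexify[OF a] by blast
  obtain Q where Q: "expansion_at Q 0 (\<lambda>i j. complex_of_real (b i j))"
    "\<forall>\<^sub>F w in nhds 0. Q (of_real (fst w), of_real (snd w)) = of_real ((snd \<circ> Z) w)"
    using expansion_complexify[OF b] by blast
  have "complexification Z (\<lambda>w. (P w, Q w))"
    unfolding complexification_def vfield_analytic_at_def analytic2_at_def case_prod_unfold
    using P(1) Q(1) eventually_conj[OF P(2) Q(2)] by (auto simp: o_def elim: eventually_mono)
  with that[of "\<lambda>w. (P w, Q w)"] P(1) Q(1) show ?thesis by (simp add: o_def)
qed

text \<open>The derivatives of \<open>F\<close> along the real axes are those of \<open>f\<close>. This determines the linear part of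
  an arbitrary complexification.\<close>

lemma complexification_linear_coeffs:
  fixes f :: "real \<times> real \<Rightarrow> real"
  assumes f: "expansion_at f 0 a" and F: "expansion_at F 0 a'"
    and eq: "\<forall>\<^sub>F w in nhds 0. F (complex_point w) = of_real (f w)"
  shows "a' 1 0 = of_real (a 1 0)" "a' 0 1 = of_real (a 0 1)"
proof -
  have z: "complex_point 0 = 0" by (simp add: complex_point_def zero_prod_def)
  have "(complex_point has_derivative complex_point) (at 0)"
    unfolding complex_point_def[abs_def] by (auto intro!: derivative_eq_intros)
  from has_derivative_compose[OF this, of F, unfolded z, OF expansion_has_derivative[OF F]]
  have "((\<lambda>w. F (complex_point w)) has_derivative
      (\<lambda>w. case complex_point w of (x, y) \<Rightarrow> a' 1 0 * x + a' 0 1 * y)) (at 0)" .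
  then have 1: "((\<lambda>w. of_real (f w)) has_derivative
      (\<lambda>w. case complex_point w of (x, y) \<Rightarrow> a' 1 0 * x + a' 0 1 * y)) (at 0)"
    by (rule has_derivative_transform_eventually)
       (use eq in \<open>auto simp: eventually_at_filter dest: eventually_nhds_x_imp_x elim: eventually_mono\<close>)
  have "((\<lambda>w. complex_of_real (f w)) has_derivative
      (\<lambda>w. of_real (case w of (x, y) \<Rightarrow> a 1 0 * x + a 0 1 * y))) (at 0)"
    by (rule has_derivative_of_real[OF expansion_has_derivative[OF f]])
  from has_derivative_unique[OF 1 this]
  have eq: "(case complex_point w of (x, y) \<Rightarrow> a' 1 0 * x + a' 0 1 * y)
      = of_real (case w of (x, y) \<Rightarrow> a 1 0 * x + a 0 1 * y)" for w by (rule fun_cong)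
  show "a' 1 0 = of_real (a 1 0)" "a' 0 1 = of_real (a 0 1)"
    using eq[of "(1, 0)"] eq[of "(0, 1)"] by (auto simp: complex_point_def)
qed

lemma vfield_has_derivative:
  assumes "expansion_at (fst \<circ> X) 0 a" "expansion_at (snd \<circ> X) 0 b"
  shows "(X has_derivative (\<lambda>(x, y). (a 1 0 * x + a 0 1 * y, b 1 0 * x + b 0 1 * y))) (at 0)"
  using has_derivative_Pair[OF expansion_has_derivative[OF assms(1)] expansion_has_derivative[OF assms(2)]]
  by (simp add: case_prod_unfold)

lemma linear_part_expansion:
  assumes "expansion_at (fst \<circ> X) 0 a" "expansion_at (snd \<circ> X) 0 b"
  shows "linear_part X = vector [vector [a 1 0, a 0 1], vector [b 1 0, b 0 1]]"
  using frechet_derivative_at[OF vfield_has_derivative[OF assms], symmetric]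
  by (simp add: linear_part_def)

lemma vfield_analytic_isCont:
  assumes "vfield_analytic_at X 0"
  shows "isCont X 0"
proof -
  obtain a b where "expansion_at (fst \<circ> X) 0 a" "expansion_at (snd \<circ> X) 0 b"
    using vfield_expansionsE[OF assms] by blast
  from has_derivative_continuous[OF vfield_has_derivative[OF this]] show ?thesis .
qed

lemma transformed_analytic: "transformed Z p X \<Longrightarrow> vfield_analytic_at X 0"
  by (cases rule: transformed.cases) (auto simp: complexification_def strict_transform_def)

lemma transformed_NilD: "transformed Z [] X \<Longrightarrow> complexification Z X"
  by (cases rule: transformed.cases) auto

lemma transformed_snocE:
  assumes "transformed Z (p @ [s]) Y"
  obtains X where "transformed Z p X" "strict_transform s X Y"
  using assms by (cases rule: transformed.cases) auto

section \<open>The tangent cone in the absence of dicritical components\<close>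

text \<open>If the form \<open>R\<close> were zero and the origin were blown up, the explicit transform would make the
  first component dicritical. If the origin is not blown up, then it is a reduced singularity; but
  a linear part with \<open>R = 0\<close> is a multiple of the identity, whose eigenvalue ratio is \<open>1\<close>.\<close>

lemma nondicritical_tangent_cone:
  assumes germ: "real_vfield_germ Z" and res: "resolution Z cs"
    and nodic: "no_real_dicritical_component Z cs"
    and a: "expansion_at (fst \<circ> Z) 0 a" and b: "expansion_at (snd \<circ> Z) 0 b"
    and low: "\<And>i j. i + j < n \<Longrightarrow> a i j = 0 \<and> b i j = 0"
    and top: "i\<^sub>0 + j\<^sub>0 = n" "a i\<^sub>0 j\<^sub>0 \<noteq> 0 \<or> b i\<^sub>0 j\<^sub>0 \<noteq> 0"
  shows "\<exists>i j. i + j = Suc n \<and> tangency_coeff a b i j \<noteq> 0"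
proof (rule ccontr)
  assume "\<not> ?thesis"
  then have dic: "tangency_coeff a b i j = 0" if "i + j = Suc n" for i j using that by blast
  obtain X where X: "complexification Z X"
    and Xa: "expansion_at (fst \<circ> X) 0 (\<lambda>i j. of_real (a i j))"
    and Xb: "expansion_at (snd \<circ> X) 0 (\<lambda>i j. of_real (b i j))"
    using complexification_exists[OF a b] by blast
  have Z0: "Z 0 = 0" using germ by (simp add: real_vfield_germ_def)
  have X0: "X 0 = 0"
    using eventually_nhds_x_imp_x[OF complexification_eventually[OF X]] Z0
    by (simp add: complex_point_def zero_prod_def)
  show False
  proof (cases cs)
    case (Cons c cs')
    have "c \<in> points_over []" using res Cons unfolding resolution_def by force
    then have "[] \<in> set cs" using Cons by (auto simp: points_over_def)
    then have inv: "invariant_component Z []"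
      using nodic by (auto simp: no_real_dicritical_component_def real_point_def)
    have "tangency_coeff (\<lambda>i j. complex_of_real (a i j)) (\<lambda>i j. of_real (b i j)) i j
        = of_real (tangency_coeff a b i j)" for i j
      by (simp add: tangency_coeff_def)
    then obtain Y where Y: "strict_transform (Slope 0) X Y" "\<not> (\<forall>\<^sub>F v in nhds 0. fst (Y (0, v)) = 0)"
      using strict_transform_Slope_0[OF Xa Xb X0, of n i\<^sub>0 j\<^sub>0] low top dic by auto
    have "transformed Z ([] @ [Slope 0]) Y" by (rule transformed.blowup[OF transformed.origin[OF X] Y(1)])
    with inv Y(2) show False unfolding invariant_component_def by blast
  next
    case Nil
    have "singular_point Z []" using transformed.origin[OF X] X0 by (auto simp: singular_point_def)
    then have "reduced_point Z []" using res Nil by (auto simp: resolution_def points_over_def)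
    then obtain Y l1 l2 where Y: "transformed Z [] Y" "eigenvalue_pair Y l1 l2"
      "l2 \<noteq> 0" "l1 / l2 \<notin> of_rat ` {0<..}"
      unfolding reduced_point_def by blast
    have cY: "complexification Z Y" by (rule transformed_NilD[OF Y(1)])
    obtain a' b' where a': "expansion_at (fst \<circ> Y) 0 a'" and b': "expansion_at (snd \<circ> Y) 0 b'"
      using vfield_expansionsE[OF transformed_analytic[OF Y(1)]] by blast
    have "\<forall>\<^sub>F w in nhds 0. (fst \<circ> Y) (complex_point w) = of_real ((fst \<circ> Z) w)"
      "\<forall>\<^sub>F w in nhds 0. (snd \<circ> Y) (complex_point w) = of_real ((snd \<circ> Z) w)"
      using complexification_eventually[OF cY] by (auto simp: complex_point_def elim: eventually_mono)
    note lin = complexification_linear_coeffs[OF a a' this(1)] complexification_linear_coeffs[OF b b' this(2)]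
    have "n \<noteq> 0"
    proof
      assume "n = 0"
      then have "i\<^sub>0 = 0" "j\<^sub>0 = 0" using top(1) by auto
      then show False using top(2) expansion_at_value[OF a] expansion_at_value[OF b] Z0 by simp
    qed
    have "a 0 1 = 0 \<and> b 1 0 = 0 \<and> b 0 1 = a 1 0"
    proof (cases "n = 1")
      case True
      then show ?thesis using dic[of 2 0] dic[of 1 1] dic[of 0 2]
        by (simp add: tangency_coeff_def numeral_2_eq_2)
    next
      case False
      then show ?thesis using low[of 1 0] low[of 0 1] \<open>n \<noteq> 0\<close> by simp
    qed
    then have "linear_part Y = vector [vector [of_real (a 1 0), 0], vector [0, of_real (a 1 0)]]"
      using linear_part_expansion[OF a' b'] lin by simp
    then have "(z - of_real (a 1 0)) * (z - of_real (a 1 0)) = (z - l1) * (z - l2)" for z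
      using Y(2) unfolding eigenvalue_pair_def by (simp add: det_2 mat_def)
    from this[of l1] this[of l2] have "l1 = l2" by simp
    then have "l1 / l2 = of_rat 1" using Y(3) by simp
    with Y(4) show False by (metis greaterThan_iff imageI zero_less_one)
  qed
qed

section \<open>Isolation of the real singularity\<close>

text \<open>One sequence of real points serves all vector fields generating the transform. In particular it
  serves the one through which a point of the resolved foliation is known to be reduced.\<close>

definition real_zeros_accumulate :: "real vfield \<Rightarrow> inf_near_point \<Rightarrow> bool" where
  "real_zeros_accumulate Z p \<longleftrightarrow> (\<exists>w. w \<longlonglongrightarrow> 0 \<and> (\<forall>\<^sub>F n in sequentially. w n \<noteq> 0) \<and>
     (\<forall>Y. transformed Z p Y \<longrightarrow> (\<forall>\<^sub>F n in sequentially. Y (complex_point (w n)) = 0)))"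

lemma real_zeros_accumulate_lift:
  assumes w: "w \<longlonglongrightarrow> 0" and w': "w' \<longlonglongrightarrow> 0"
    and zero: "\<And>X. transformed Z p X \<Longrightarrow> \<forall>\<^sub>F n in sequentially. X (complex_point (w n)) = 0"
    and chart: "\<forall>\<^sub>F n in sequentially. fst (w' n) \<noteq> 0 \<and> blowup_chart s (complex_point (w' n)) = complex_point (w n)"
  shows "real_zeros_accumulate Z (p @ [s])"
  unfolding real_zeros_accumulate_def
proof (intro exI conjI allI impI)
  show "w' \<longlonglongrightarrow> 0" by (fact w')
  show "\<forall>\<^sub>F n in sequentially. w' n \<noteq> 0" using chart by eventually_elim auto
  fix Y assume "transformed Z (p @ [s]) Y"
  then obtain X where X: "transformed Z p X" "strict_transform s X Y" by (rule transformed_snocE)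
  then obtain m where m: "\<forall>\<^sub>F w in nhds 0. X (blowup_chart s w) =
        frechet_derivative (blowup_chart s) (at w) (fst w ^ m * fst (Y w), fst w ^ m * snd (Y w))"
    unfolding strict_transform_def by blast
  have "\<forall>\<^sub>F n in sequentially. X (blowup_chart s (complex_point (w' n))) =
        frechet_derivative (blowup_chart s) (at (complex_point (w' n)))
          (fst (complex_point (w' n)) ^ m * fst (Y (complex_point (w' n))),
           fst (complex_point (w' n)) ^ m * snd (Y (complex_point (w' n))))"
    by (rule eventually_compose_filterlim[OF m complex_point_tendsto_0[OF w']])
  with zero[OF X(1)] chart show "\<forall>\<^sub>F n in sequentially. Y (complex_point (w' n)) = 0"
  proof eventually_elim
    case (elim n)
    obtain u v where uv: "complex_point (w' n) = (u, v)" by (cases "complex_point (w' n)")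
    have "u \<noteq> 0" using elim uv by (auto simp: complex_point_def)
    have "frechet_derivative (blowup_chart s) (at (u, v)) (u ^ m * fst (Y (u, v)), u ^ m * snd (Y (u, v))) = 0"
      using elim uv by auto
    then show ?case using \<open>u \<noteq> 0\<close>
      by (cases s) (auto simp: uv frechet_derivative_chart_Slope frechet_derivative_chart_Vertical prod_eq_iff)
  qed
qed

text \<open>Along a subsequence the directions of the zeros converge, to a real point of the exceptional
  divisor. In the chart there the zeros again converge to the origin, and they lie off the divisor,
  where the chart is invertible.\<close>

lemma real_zeros_accumulate_step:
  assumes "real_zeros_accumulate Z p"
  shows "\<exists>s. cnj_direction s = s \<and> real_zeros_accumulate Z (p @ [s])"
proof -
  obtain w where w: "w \<longlonglongrightarrow> 0" "\<forall>\<^sub>F n in sequentially. w n \<noteq> 0" and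
    zero: "\<And>X. transformed Z p X \<Longrightarrow> \<forall>\<^sub>F n in sequentially. X (complex_point (w n)) = 0"
    using assms unfolding real_zeros_accumulate_def by blast
  define z where "z n = (if w n = 0 then (1, 0) else w n /\<^sub>R norm (w n))" for n
  have "z n \<in> sphere 0 1" for n by (simp add: z_def norm_Pair)
  then obtain l r where l: "l \<in> sphere 0 1" and r: "strict_mono r" "(z \<circ> r) \<longlonglongrightarrow> l"
    using compact_sphere[of "0 :: real \<times> real" 1] unfolding compact_def by blast
  have sub: "filterlim r sequentially sequentially" by (rule filterlim_subseq[OF r(1)])
  have wr: "(\<lambda>n. w (r n)) \<longlonglongrightarrow> 0" by (rule filterlim_compose[OF w(1) sub])
  have wr0: "\<forall>\<^sub>F n in sequentially. w (r n) \<noteq> 0" by (rule eventually_compose_filterlim[OF w(2) sub])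
  have zr: "\<And>X. transformed Z p X \<Longrightarrow> \<forall>\<^sub>F n in sequentially. X (complex_point (w (r n))) = 0"
    by (rule eventually_compose_filterlim[OF zero sub])
  have x: "(\<lambda>n. fst (w (r n))) \<longlonglongrightarrow> 0" and y: "(\<lambda>n. snd (w (r n))) \<longlonglongrightarrow> 0"
    using tendsto_fst[OF wr] tendsto_snd[OF wr] by auto
  have zx: "(\<lambda>n. fst (z (r n))) \<longlonglongrightarrow> fst l" and zy: "(\<lambda>n. snd (z (r n))) \<longlonglongrightarrow> snd l"
    using tendsto_fst[OF r(2)] tendsto_snd[OF r(2)] by (auto simp: o_def)
  show ?thesis
  proof (cases "fst l = 0")
    case False
    define c where "c = snd l / fst l"
    define w' where "w' n = (fst (w (r n)), snd (w (r n)) / fst (w (r n)) - c)" for n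
    have nz: "\<forall>\<^sub>F n in sequentially. fst (z (r n)) \<noteq> 0" using tendsto_imp_eventually_ne[OF zx False] .
    have "(\<lambda>n. snd (z (r n)) / fst (z (r n))) \<longlonglongrightarrow> c"
      unfolding c_def by (intro tendsto_divide zx zy False)
    moreover have "\<forall>\<^sub>F n in sequentially. snd (z (r n)) / fst (z (r n)) = snd (w (r n)) / fst (w (r n))"
      using wr0 by eventually_elim (simp add: z_def)
    ultimately have "(\<lambda>n. snd (w (r n)) / fst (w (r n))) \<longlonglongrightarrow> c"
      by (rule Lim_transform_eventually)
    then have "w' \<longlonglongrightarrow> 0"
      unfolding w'_def zero_prod_def using x by (intro tendsto_Pair) (auto simp: LIM_zero)
    moreover have "\<forall>\<^sub>F n in sequentially. fst (w' n) \<noteq> 0 \<and>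
        blowup_chart (Slope (of_real c)) (complex_point (w' n)) = complex_point (w (r n))"
      using nz wr0 by eventually_elim (auto simp: w'_def z_def complex_point_def field_simps)
    ultimately have "real_zeros_accumulate Z (p @ [Slope (of_real c)])"
      using real_zeros_accumulate_lift[OF wr _ zr] by blast
    then show ?thesis by (intro exI[of _ "Slope (of_real c)"]) simp
  next
    case True
    then have False2: "snd l \<noteq> 0" using l by (auto simp: norm_prod_def)
    define w' where "w' n = (snd (w (r n)), fst (w (r n)) / snd (w (r n)))" for n
    have nz: "\<forall>\<^sub>F n in sequentially. snd (z (r n)) \<noteq> 0" using tendsto_imp_eventually_ne[OF zy False2] .
    have "(\<lambda>n. fst (z (r n)) / snd (z (r n))) \<longlonglongrightarrow> 0 / snd l"
      using zx True by (intro tendsto_divide zy False2) simp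
    moreover have "\<forall>\<^sub>F n in sequentially. fst (z (r n)) / snd (z (r n)) = fst (w (r n)) / snd (w (r n))"
      using wr0 by eventually_elim (simp add: z_def)
    ultimately have "(\<lambda>n. fst (w (r n)) / snd (w (r n))) \<longlonglongrightarrow> 0 / snd l"
      by (rule Lim_transform_eventually)
    then have "w' \<longlonglongrightarrow> 0"
      unfolding w'_def zero_prod_def using y by (intro tendsto_Pair) auto
    moreover have "\<forall>\<^sub>F n in sequentially. fst (w' n) \<noteq> 0 \<and>
        blowup_chart Vertical (complex_point (w' n)) = complex_point (w (r n))"
      using nz wr0 by eventually_elim (auto simp: w'_def z_def complex_point_def field_simps)
    ultimately have "real_zeros_accumulate Z (p @ [Vertical])"
      using real_zeros_accumulate_lift[OF wr _ zr] by blast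
    then show ?thesis by (intro exI[of _ Vertical]) simp
  qed
qed

lemma real_zeros_accumulate_singular:
  assumes "real_zeros_accumulate Z p" "transformed Z p X"
  shows "X 0 = 0"
proof -
  obtain w where w: "w \<longlonglongrightarrow> 0" "\<forall>\<^sub>F n in sequentially. X (complex_point (w n)) = 0"
    using assms unfolding real_zeros_accumulate_def by blast
  have "(\<lambda>n. X (complex_point (w n))) \<longlonglongrightarrow> X 0"
    by (rule isCont_tendsto_compose[OF vfield_analytic_isCont[OF transformed_analytic[OF assms(2)]]
        complex_point_tendsto_0[OF w(1)]])
  moreover have "(\<lambda>n. X (complex_point (w n))) \<longlonglongrightarrow> 0" by (rule tendsto_eventually[OF w(2)])
  ultimately show ?thesis using LIMSEQ_unique by blast
qed

text \<open>An invertible derivative \<open>D\<close> satisfies \<open>B |h| \<le> |D h|\<close>, whereas at a zero \<open>h\<close> of \<open>Y\<close> the value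
  \<open>D h\<close> is of smaller order than \<open>h\<close>.\<close>

lemma nondegenerate_zero_isolated:
  assumes Y: "vfield_analytic_at Y 0" "Y 0 = 0" and ev: "eigenvalue_pair Y l1 l2" "l1 \<noteq> 0" "l2 \<noteq> 0"
    and w: "w \<longlonglongrightarrow> 0" "\<forall>\<^sub>F n in sequentially. w n \<noteq> 0"
  shows "\<not> (\<forall>\<^sub>F n in sequentially. Y (complex_point (w n)) = 0)"
proof
  assume zero: "\<forall>\<^sub>F n in sequentially. Y (complex_point (w n)) = 0"
  obtain a b where ab: "expansion_at (fst \<circ> Y) 0 a" "expansion_at (snd \<circ> Y) 0 b"
    using vfield_expansionsE[OF Y(1)] by blast
  define D where "D = (\<lambda>(x, y). (a 1 0 * x + a 0 1 * y, b 1 0 * x + b 0 1 * y))"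
  have der: "(Y has_derivative D) (at 0)" unfolding D_def by (rule vfield_has_derivative[OF ab])
  define \<Delta> where "\<Delta> = a 1 0 * b 0 1 - a 0 1 * b 1 0"
  have "\<Delta> = l1 * l2"
    using ev(1)[unfolded eigenvalue_pair_def, rule_format, of 0]
    by (simp add: linear_part_expansion[OF ab] det_2 mat_def \<Delta>_def)
  then have "\<Delta> \<noteq> 0" using ev by simp
  have "inj D"
  proof (rule injI)
    fix h k assume "D h = D k"
    then have "D (h - k) = 0" using linear_diff[OF has_derivative_linear[OF der]] by simp
    moreover obtain x y where xy: "h - k = (x, y)" by (cases "h - k")
    ultimately have 1: "a 1 0 * x + a 0 1 * y = 0" "b 1 0 * x + b 0 1 * y = 0"
      by (auto simp: D_def zero_prod_def)
    have "\<Delta> * x = b 0 1 * (a 1 0 * x + a 0 1 * y) - a 0 1 * (b 1 0 * x + b 0 1 * y)"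
      "\<Delta> * y = a 1 0 * (b 1 0 * x + b 0 1 * y) - b 1 0 * (a 1 0 * x + a 0 1 * y)"
      by (simp_all add: \<Delta>_def algebra_simps)
    then have "\<Delta> * x = 0" "\<Delta> * y = 0" unfolding 1 by simp_all
    then have "h - k = 0" using \<open>\<Delta> \<noteq> 0\<close> xy by (simp add: zero_prod_def)
    then show "h = k" by simp
  qed
  then obtain B where B: "B > 0" "\<And>h. B * norm h \<le> norm (D h)"
    using linear_inj_bounded_below_pos[OF has_derivative_linear[OF der]] by blast
  have "B / 2 > 0" using B(1) by simp
  then obtain d where "d > 0" "\<forall>h. norm (h - 0) < d \<longrightarrow> norm (Y h - Y 0 - D (h - 0)) \<le> B / 2 * norm (h - 0)"
    using der[unfolded has_derivative_at_alt] by blast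
  then have d: "d > 0" "\<And>h. norm h < d \<Longrightarrow> norm (Y h - D h) \<le> B / 2 * norm h"
    using Y(2) by auto
  have "\<forall>\<^sub>F n in sequentially. norm (complex_point (w n)) < d"
    using order_tendstoD(2)[OF tendsto_norm_zero[OF complex_point_tendsto_0[OF w(1)]] d(1)] .
  with zero w(2) have "\<forall>\<^sub>F n in sequentially. False"
  proof eventually_elim
    case (elim n)
    let ?h = "complex_point (w n)"
    have "?h \<noteq> 0" using elim(2) by (auto simp: complex_point_def zero_prod_def prod_eq_iff)
    have "B * norm ?h \<le> B / 2 * norm ?h"
      using B(2)[of ?h] d(2)[OF elim(3)] elim(1) by simp
    then show False using B(1) \<open>?h \<noteq> 0\<close> by (simp add: field_simps)
  qed
  then show False by simp
qed

text \<open>Follow accumulating real zeros from the origin through the tree of real infinitely near points.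
  There are finitely many centres, so the path leaves them, and it does so at a singular point of
  the resolved foliation that is real, hence reduced and not a saddle-node.\<close>

lemma real_singularity_isolated:
  assumes germ: "real_vfield_germ Z" and res: "resolution Z cs"
    and rgc: "real_generalized_curve Z cs"
  shows "\<forall>\<^sub>F w in at 0. Z w \<noteq> 0"
proof (rule ccontr)
  assume "\<not> ?thesis"
  then have freq: "\<exists>\<^sub>F w in at 0. Z w = 0" by (simp add: frequently_def)
  have "\<exists>w. w \<noteq> 0 \<and> norm w < inverse (real (Suc n)) \<and> Z w = 0" for n
    using freq[unfolded frequently_at, rule_format, of "inverse (real (Suc n))"] by (auto simp: dist_norm)
  then obtain w where w: "\<And>n. w n \<noteq> 0" "\<And>n. norm (w n) < inverse (real (Suc n))" "\<And>n. Z (w n) = 0"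
    by metis
  have w0: "w \<longlonglongrightarrow> 0"
    by (rule Lim_null_comparison[OF _ LIMSEQ_inverse_real_of_nat]) (use w(2) in \<open>auto intro: always_eventually less_imp_le\<close>)
  have an: "vfield_analytic_at Z 0" using germ by (simp add: real_vfield_germ_def)
  obtain a b where ab: "expansion_at (fst \<circ> Z) 0 a" "expansion_at (snd \<circ> Z) 0 b"
    using vfield_expansionsE[OF an] by blast
  obtain X where X: "complexification Z X" using complexification_exists[OF ab] by blast
  \<comment> \<open>A point is good if zeros accumulate at it and the transform there exists and is nonzero,
    so that it can be blown up again.\<close>
  define good where "good p \<longleftrightarrow> real_point p \<and> real_zeros_accumulate Z p \<and>
     (\<exists>Y. transformed Z p Y \<and> \<not> (\<forall>\<^sub>F w in nhds 0. Y w = 0))" for p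
  have X_nz: "\<not> (\<forall>\<^sub>F w in nhds 0. X w = 0)"
  proof
    assume "\<forall>\<^sub>F w in nhds 0. X w = 0"
    then have "\<forall>\<^sub>F w in nhds 0. X (complex_point w) = 0"
      by (rule eventually_nhds_0_linear_pullback[rotated 2])
         (auto simp: complex_point_def zero_prod_def intro!: continuous_intros)
    with complexification_eventually[OF X] have "\<forall>\<^sub>F w in nhds 0. Z w = 0"
      by eventually_elim (auto simp: complex_point_def zero_prod_def prod_eq_iff)
    moreover have "analytic2_at (\<lambda>_. 0 :: real) 0"
      unfolding analytic2_at_def expansion_at_def by (intro exI[of _ "\<lambda>_ _. 0"] exI[of _ 1]) (auto simp: case_prod_unfold)
    moreover from calculation(1)
    have "\<forall>\<^sub>F w in nhds 0. (fst \<circ> Z) w = 0 * 0 \<and> (snd \<circ> Z) w = 0 * 0"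
      by eventually_elim simp
    ultimately show False
      using germ[unfolded real_vfield_germ_def no_common_factor_def, THEN conjunct2, THEN conjunct2,
          rule_format, of "\<lambda>_. 0" "\<lambda>_. 0" "\<lambda>_. 0"] by blast
  qed
  have "good []"
    unfolding good_def real_zeros_accumulate_def
  proof (intro conjI exI[of _ w] exI[of _ X] allI impI)
    fix Y assume "transformed Z [] Y"
    then have "\<forall>\<^sub>F n in sequentially. Y (complex_point (w n)) = complex_point (Z (w n))"
      by (intro eventually_compose_filterlim[OF complexification_eventually w0] transformed_NilD)
    then show "\<forall>\<^sub>F n in sequentially. Y (complex_point (w n)) = 0"
      by eventually_elim (simp add: w(3) complex_point_def zero_prod_def)
  qed (use w(1) w0 X_nz transformed.origin[OF X] in \<open>auto simp: real_point_def\<close>)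
  have step: "\<exists>s. good (p @ [s])" if p: "good p" for p
  proof -
    obtain s where s: "cnj_direction s = s" "real_zeros_accumulate Z (p @ [s])"
      using real_zeros_accumulate_step p unfolding good_def by blast
    obtain Y where Y: "transformed Z p Y" "\<not> (\<forall>\<^sub>F w in nhds 0. Y w = 0)"
      using p unfolding good_def by blast
    have "Y 0 = 0" using real_zeros_accumulate_singular Y(1) p unfolding good_def by blast
    then obtain Y' where Y': "strict_transform s Y Y'"
      using strict_transform_exists[OF transformed_analytic[OF Y(1)] _ Y(2)] by blast
    have "\<not> (\<forall>\<^sub>F w in nhds 0. Y' w = 0)"
    proof
      assume "\<forall>\<^sub>F w in nhds 0. Y' w = 0"
      then have "\<forall>\<^sub>F v in nhds 0. Y' (0, v) = 0"
        by (rule eventually_nhds_0_linear_pullback[rotated 2]) (auto simp: zero_prod_def intro!: continuous_intros)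
      with Y' show False by (simp add: strict_transform_def)
    qed
    then show ?thesis
      using s p transformed.blowup[OF Y(1) Y'] unfolding good_def real_point_def by auto
  qed
  have "\<exists>p\<in>points_over cs. good p"
  proof (cases "[] \<in> set cs")
    case False
    then show ?thesis using \<open>good []\<close> by (auto simp: points_over_def)
  next
    case True
    \<comment> \<open>A good centre of maximal length has a good successor, which is not a centre.\<close>
    define N where "N = Max (length ` {p \<in> set cs. good p})"
    have fin: "finite (length ` {p \<in> set cs. good p})" by simp
    moreover have "length ` {p \<in> set cs. good p} \<noteq> {}" using True \<open>good []\<close> by blast
    ultimately have "N \<in> length ` {p \<in> set cs. good p}" unfolding N_def by (rule Max_in)
    then obtain p where p: "p \<in> set cs" "good p" "length p = N" by auto
    obtain s where s: "good (p @ [s])" using step p(2) by blast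
    have "p @ [s] \<notin> set cs"
    proof
      assume "p @ [s] \<in> set cs"
      then have "length (p @ [s]) \<le> N" unfolding N_def using s by (intro Max_ge[OF fin]) blast
      with p(3) show False by simp
    qed
    then show ?thesis using s p(1) by (intro bexI[of _ "p @ [s]"]) (auto simp: points_over_def)
  qed
  then obtain p where p: "p \<in> points_over cs" "real_point p" "real_zeros_accumulate Z p"
    and ex: "\<exists>Y. transformed Z p Y" unfolding good_def by blast
  have sing: "singular_point Z p"
    using ex real_zeros_accumulate_singular[OF p(3)] unfolding singular_point_def by blast
  then have "reduced_point Z p" using res p(1) unfolding resolution_def by blast
  then obtain Y l1 l2 where Y: "transformed Z p Y" "Y 0 = 0" "eigenvalue_pair Y l1 l2" "l2 \<noteq> 0"
    unfolding reduced_point_def by blast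
  have "l1 \<noteq> 0"
    using rgc sing p(1,2) Y unfolding real_generalized_curve_def saddle_node_point_def by blast
  obtain v where "v \<longlonglongrightarrow> 0" "\<forall>\<^sub>F n in sequentially. v n \<noteq> 0" "\<forall>\<^sub>F n in sequentially. Y (complex_point (v n)) = 0"
    using p(3) Y(1) unfolding real_zeros_accumulate_def by blast
  with nondegenerate_zero_isolated[OF transformed_analytic[OF Y(1)] Y(2,3) \<open>l1 \<noteq> 0\<close> Y(4)]
  show False by blast
qed

section \<open>Solutions of ordinary differential equations and flow boxes\<close>

lemma vector_derivative_bound:
  fixes \<gamma> :: "real \<Rightarrow> 'a::real_normed_vector"
  assumes "convex S" "\<And>t. t \<in> S \<Longrightarrow> (\<gamma> has_vector_derivative \<gamma>' t) (at t within S)"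
    "\<And>t. t \<in> S \<Longrightarrow> norm (\<gamma>' t) \<le> B" "x \<in> S" "y \<in> S"
  shows "norm (\<gamma> x - \<gamma> y) \<le> B * \<bar>x - y\<bar>"
proof -
  have "norm (\<gamma> x - \<gamma> y) \<le> B * norm (x - y)"
  proof (rule differentiable_bound[OF assms(1)])
    show "(\<gamma> has_derivative (\<lambda>h. h *\<^sub>R \<gamma>' t)) (at t within S)" if "t \<in> S" for t
      using assms(2)[OF that] by (simp add: has_vector_derivative_def)
    show "onorm (\<lambda>h. h *\<^sub>R \<gamma>' t) \<le> B" if "t \<in> S" for t
      by (rule onorm_le) (simp add: assms(3)[OF that] mult.commute[of B] mult_left_mono)
  qed (use assms in auto)
  then show ?thesis by simp
qed

text \<open>Picard iteration is a contraction on the bounded continuous functions on the whole line, once the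
  vector field is composed with the projection to the ball and time is clamped to \<open>[- \<tau>, \<tau>]\<close>. The
  speed bound \<open>M\<close> keeps the fixed point inside the ball, where the projection is the identity.\<close>

lemma picard_existence:
  fixes Z :: "'a::euclidean_space \<Rightarrow> 'a"
  assumes lip: "\<And>x y. x \<in> cball p \<rho> \<Longrightarrow> y \<in> cball p \<rho> \<Longrightarrow> norm (Z x - Z y) \<le> L * norm (x - y)"
    and bound: "\<And>x. x \<in> cball p \<rho> \<Longrightarrow> norm (Z x) \<le> M"
    and pos: "\<tau> > 0" "\<rho> > 0" "L \<ge> 0"
    and q: "norm (q - p) + M * \<tau> \<le> \<rho>" and small: "6 * \<tau> * L \<le> 1"
  shows "\<exists>\<gamma>. \<gamma> 0 = q \<and> (\<forall>t\<in>{-\<tau>..\<tau>}. \<gamma> t \<in> cball p \<rho> \<and>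
           (\<gamma> has_vector_derivative Z (\<gamma> t)) (at t within {-\<tau>..\<tau>}))"
proof -
  \<comment> \<open>The projection is \<open>1\<close>-Lipschitz, so \<open>Z \<circ> \<pi>\<close> is Lipschitz and bounded on the whole space.\<close>
  define \<pi> where "\<pi> = closest_point (cball p \<rho>)"
  have \<pi>_in: "\<pi> x \<in> cball p \<rho>" for x
    unfolding \<pi>_def by (rule closest_point_in_set) (use pos in auto)
  have \<pi>_lip: "dist (\<pi> x) (\<pi> y) \<le> dist x y" for x y
    unfolding \<pi>_def by (rule closest_point_lipschitz) (use pos in auto)
  define X where "X = Z \<circ> \<pi>"
  have X_lip: "norm (X x - X y) \<le> L * norm (x - y)" for x y
  proof -
    have "norm (X x - X y) \<le> L * norm (\<pi> x - \<pi> y)" unfolding X_def o_def by (intro lip \<pi>_in)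
    also have "\<dots> \<le> L * norm (x - y)" using \<pi>_lip[of x y] pos by (intro mult_left_mono) (auto simp: dist_norm)
    finally show ?thesis .
  qed
  have X_cont: "continuous_on UNIV X"
  proof (rule lipschitz_on_continuous_on)
    show "L-lipschitz_on UNIV X" by (rule lipschitz_onI) (use X_lip pos in \<open>auto simp: dist_norm\<close>)
  qed
  have X_bound: "norm (X x) \<le> M" for x unfolding X_def o_def by (intro bound \<pi>_in)
  have "M \<ge> 0" using X_bound[of p] norm_ge_zero order_trans by blast
  have Xu: "continuous_on S (\<lambda>s. X (u s))" for S and u :: "real \<Rightarrow>\<^sub>C 'a"
    by (rule continuous_on_compose2[OF X_cont]) auto
  define c where "c t = max (-\<tau>) (min \<tau> t)" for t
  have c: "c t \<in> {-\<tau>..\<tau>}" for t using pos by (auto simp: c_def)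
  define F where "F u t = q + integral {-\<tau>..t} (\<lambda>s. X (u s)) - integral {-\<tau>..0} (\<lambda>s. X (u s))"
    for u :: "real \<Rightarrow>\<^sub>C 'a" and t
  have F_cont: "continuous_on {-\<tau>..\<tau>} (F u)" for u
    unfolding F_def by (intro continuous_intros indefinite_integral_continuous_1 integrable_continuous_real Xu)
  have "(\<lambda>t. F u (c t)) \<in> bcontfun" for u
    unfolding bcontfun_def
  proof (intro CollectI conjI)
    show "continuous_on UNIV (\<lambda>t. F u (c t))"
      by (rule continuous_on_compose2[OF F_cont, of _ c]) (use c in \<open>auto simp: c_def intro!: continuous_intros\<close>)
    have "bounded (F u ` {-\<tau>..\<tau>})"
      by (intro compact_imp_bounded compact_continuous_image F_cont compact_Icc)
    then show "bounded (range (\<lambda>t. F u (c t)))" by (rule bounded_subset) (use c in auto)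
  qed
  then have T: "apply_bcontfun (Bcontfun (\<lambda>t. F u (c t))) t = F u (c t)" for u t
    by (simp add: Bcontfun_inverse)
  have contr: "dist (Bcontfun (\<lambda>t. F u (c t))) (Bcontfun (\<lambda>t. F v (c t))) \<le> 1 / 2 * dist u v" for u v
  proof (rule dist_bound)
    fix t
    have ib: "norm (integral {-\<tau>..b} (\<lambda>s. X (u s)) - integral {-\<tau>..b} (\<lambda>s. X (v s))) \<le> L * dist u v * (b - (-\<tau>))"
      if "b \<in> {-\<tau>..\<tau>}" for b
    proof -
      have "integral {-\<tau>..b} (\<lambda>s. X (u s)) - integral {-\<tau>..b} (\<lambda>s. X (v s)) = integral {-\<tau>..b} (\<lambda>s. X (u s) - X (v s))"
        by (intro integral_diff[symmetric] integrable_continuous_real Xu)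
      also have "norm \<dots> \<le> L * dist u v * (b - (-\<tau>))"
      proof (rule integral_bound)
        fix s
        have "norm (X (u s) - X (v s)) \<le> L * dist (u s) (v s)" using X_lip by (simp add: dist_norm)
        also have "\<dots> \<le> L * dist u v" using pos by (intro mult_left_mono dist_bounded) auto
        finally show "norm (X (u s) - X (v s)) \<le> L * dist u v" .
      qed (use that in \<open>auto intro!: continuous_intros Xu\<close>)
      finally show ?thesis .
    qed
    have "dist (F u (c t)) (F v (c t)) = norm ((integral {-\<tau>..c t} (\<lambda>s. X (u s)) - integral {-\<tau>..c t} (\<lambda>s. X (v s)))
        - (integral {-\<tau>..0} (\<lambda>s. X (u s)) - integral {-\<tau>..0} (\<lambda>s. X (v s))))"
      by (simp add: F_def dist_norm algebra_simps)
    also have "\<dots> \<le> L * dist u v * (c t - (-\<tau>)) + L * dist u v * (0 - (-\<tau>))"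
      by (rule order_trans[OF norm_triangle_ineq4]) (intro add_mono ib; use c pos in auto)
    also have "\<dots> \<le> L * dist u v * (2 * \<tau>) + L * dist u v * \<tau>"
      using c[of t] pos by (intro add_mono mult_left_mono) auto
    also have "\<dots> = (6 * \<tau> * L) * (1 / 2 * dist u v)" by simp
    also have "\<dots> \<le> 1 * (1 / 2 * dist u v)" by (intro mult_right_mono small) auto
    finally show "dist (apply_bcontfun (Bcontfun (\<lambda>t. F u (c t))) t) (apply_bcontfun (Bcontfun (\<lambda>t. F v (c t))) t)
        \<le> 1 / 2 * dist u v"
      by (simp add: T)
  qed
  obtain u where u: "Bcontfun (\<lambda>t. F u (c t)) = u"
    using banach_fix_type[of "1/2" "\<lambda>u. Bcontfun (\<lambda>t. F u (c t))"] contr by auto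
  have uF: "u t = F u t" if "t \<in> {-\<tau>..\<tau>}" for t
    using T[of u t] u that by (auto simp: c_def)
  have der: "(apply_bcontfun u has_vector_derivative X (u t)) (at t within {-\<tau>..\<tau>})" if t: "t \<in> {-\<tau>..\<tau>}" for t
  proof -
    have "((\<lambda>t. integral {-\<tau>..t} (\<lambda>s. X (u s))) has_vector_derivative X (u t)) (at t within {-\<tau>..\<tau>})"
      by (rule integral_has_vector_derivative[OF Xu t])
    then have "(F u has_vector_derivative X (u t)) (at t within {-\<tau>..\<tau>})"
      unfolding F_def by (auto intro!: derivative_eq_intros)
    then show ?thesis by (rule has_vector_derivative_transform[OF t, rotated]) (use uF in auto)
  qed
  have u0: "u 0 = q" using uF[of 0] pos by (simp add: F_def)
  have inb: "u t \<in> cball p \<rho>" if t: "t \<in> {-\<tau>..\<tau>}" for t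
  proof -
    have "norm (u t - u 0) \<le> M * \<bar>t - 0\<bar>"
      by (rule vector_derivative_bound[OF _ der X_bound]) (use t pos in auto)
    also have "\<dots> \<le> M * \<tau>" using t \<open>M \<ge> 0\<close> by (intro mult_left_mono) auto
    finally have "norm (u t - p) \<le> \<rho>"
      using norm_triangle_ineq[of "u t - q" "q - p"] q u0 by simp
    then show ?thesis by (simp add: dist_norm norm_minus_commute)
  qed
  have "(apply_bcontfun u has_vector_derivative Z (u t)) (at t within {-\<tau>..\<tau>})" if t: "t \<in> {-\<tau>..\<tau>}" for t
    using der[OF t] inb[OF t] by (simp add: X_def \<pi>_def closest_point_self)
  then show ?thesis using u0 inb by blast
qed

text \<open>On an interval that is short compared to the Lipschitz constant, the distance of two solutions
  cannot vary by more than half of its maximum.\<close>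

lemma solution_dependence:
  fixes f g :: "real \<Rightarrow> 'a::real_normed_vector"
  assumes d1: "\<And>t. t \<in> {a..b} \<Longrightarrow> f t \<in> S \<and> (f has_vector_derivative Z (f t)) (at t within {a..b})"
    and d2: "\<And>t. t \<in> {a..b} \<Longrightarrow> g t \<in> S \<and> (g has_vector_derivative Z (g t)) (at t within {a..b})"
    and lip: "\<And>x y. x \<in> S \<Longrightarrow> y \<in> S \<Longrightarrow> norm (Z x - Z y) \<le> L * norm (x - y)"
    and small: "2 * (b - a) * L \<le> 1" "L \<ge> 0" and t0: "t0 \<in> {a..b}" and t: "t \<in> {a..b}"
  shows "norm (f t - g t) \<le> 2 * norm (f t0 - g t0)"
proof -
  define d where "d t = f t - g t" for t
  have der: "(d has_vector_derivative Z (f t) - Z (g t)) (at t within {a..b})" if "t \<in> {a..b}" for t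
    unfolding d_def using d1[OF that] d2[OF that] by (auto intro!: derivative_eq_intros)
  have "continuous_on {a..b} (\<lambda>t. norm (d t))"
    by (intro continuous_on_norm) (meson der has_vector_derivative_continuous continuous_on_eq_continuous_within)
  then obtain t1 where t1: "t1 \<in> {a..b}" "\<And>t. t \<in> {a..b} \<Longrightarrow> norm (d t) \<le> norm (d t1)"
    using continuous_attains_sup[of "{a..b}" "\<lambda>t. norm (d t)"] t0 by auto
  have "norm (d t1 - d t0) \<le> (L * norm (d t1)) * \<bar>t1 - t0\<bar>"
  proof (rule vector_derivative_bound[OF _ der])
    fix s assume s: "s \<in> {a..b}"
    have "norm (Z (f s) - Z (g s)) \<le> L * norm (d s)" unfolding d_def using d1[OF s] d2[OF s] by (intro lip) auto
    also have "\<dots> \<le> L * norm (d t1)" using t1(2)[OF s] small by (intro mult_left_mono) auto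
    finally show "norm (Z (f s) - Z (g s)) \<le> L * norm (d t1)" .
  qed (use t0 t1 in auto)
  also have "\<dots> \<le> (L * norm (d t1)) * (b - a)" using t0 t1 small by (intro mult_left_mono) auto
  also have "\<dots> = (2 * (b - a) * L) * (norm (d t1) / 2)" by simp
  also have "\<dots> \<le> 1 * (norm (d t1) / 2)" by (intro mult_right_mono small) auto
  finally have "norm (d t1 - d t0) \<le> norm (d t1) / 2" by simp
  then have "norm (d t1) \<le> 2 * norm (d t0)" using norm_triangle_sub[of "d t1" "d t0"] by simp
  with t1(2)[OF t] show ?thesis unfolding d_def by simp
qed

text \<open>The inclusion \<open>cball p \<rho> \<subseteq> U\<close> makes \<open>U\<close> open and lets curves be continued inside \<open>U\<close>.\<close>

definition loc_lip :: "('a::euclidean_space \<Rightarrow> 'a) \<Rightarrow> 'a set \<Rightarrow> bool" where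
  "loc_lip Z U \<longleftrightarrow> (\<forall>p\<in>U. \<exists>\<rho>>0. \<exists>L\<ge>0. cball p \<rho> \<subseteq> U \<and>
     (\<forall>x\<in>cball p \<rho>. \<forall>y\<in>cball p \<rho>. norm (Z x - Z y) \<le> L * norm (x - y)))"

definition integral_curve :: "('a::euclidean_space \<Rightarrow> 'a) \<Rightarrow> 'a set \<Rightarrow> (real \<Rightarrow> 'a) \<Rightarrow> real set \<Rightarrow> bool" where
  "integral_curve Z U \<gamma> I \<longleftrightarrow> open I \<and> connected I \<and>
     (\<forall>s\<in>I. \<gamma> s \<in> U \<and> (\<gamma> has_vector_derivative Z (\<gamma> s)) (at s))"

lemma integral_curve_isCont: "integral_curve Z U \<gamma> I \<Longrightarrow> s \<in> I \<Longrightarrow> isCont \<gamma> s"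
  unfolding integral_curve_def by (blast intro: has_vector_derivative_continuous)

lemma integral_curve_shift:
  assumes "integral_curve Z U \<gamma> I"
  shows "integral_curve Z U (\<lambda>t. \<gamma> (t + c)) ((\<lambda>t. t - c) ` I)"
  unfolding integral_curve_def
proof (intro conjI ballI)
  have "open ((\<lambda>t. - c + t) ` I)"
    by (rule open_translation) (use assms in \<open>simp add: integral_curve_def\<close>)
  then show "open ((\<lambda>t. t - c) ` I)" by simp
  show "connected ((\<lambda>t. t - c) ` I)"
    using assms by (intro connected_continuous_image continuous_intros) (simp add: integral_curve_def)
  fix s assume "s \<in> (\<lambda>t. t - c) ` I"
  then have s: "s + c \<in> I" by auto
  then show "\<gamma> (s + c) \<in> U" using assms by (simp add: integral_curve_def)
  have "(\<gamma> has_vector_derivative Z (\<gamma> (s + c))) (at (s + c))"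
    using assms s by (simp add: integral_curve_def)
  moreover have "((\<lambda>t. t + c) has_vector_derivative 1) (at s)" by (auto intro!: derivative_eq_intros)
  ultimately show "((\<lambda>t. \<gamma> (t + c)) has_vector_derivative Z (\<gamma> (s + c))) (at s)"
    using vector_diff_chain_at[of "\<lambda>t. t + c" 1 s \<gamma> "Z (\<gamma> (s + c))"] by (simp add: o_def)
qed

lemma integral_curve_subset:
  "integral_curve Z U \<gamma> I \<Longrightarrow> open J \<Longrightarrow> connected J \<Longrightarrow> J \<subseteq> I \<Longrightarrow> integral_curve Z U \<gamma> J"
  unfolding integral_curve_def by blast

text \<open>The set where two curves agree is closed by continuity and open by the local estimate
  \<open>solution_dependence\<close>.\<close>

lemma integral_curve_unique:
  assumes Z: "loc_lip Z U" and 1: "integral_curve Z U \<gamma>1 I" and 2: "integral_curve Z U \<gamma>2 J"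
    and t0: "t0 \<in> I" "t0 \<in> J" "\<gamma>1 t0 = \<gamma>2 t0" and t: "t \<in> I" "t \<in> J"
  shows "\<gamma>1 t = \<gamma>2 t"
proof -
  define K where "K = I \<inter> J"
  have "open K" "connected K"
    using 1 2 unfolding K_def integral_curve_def
    by (auto simp: is_interval_connected_1[symmetric] intro: is_interval_Int)
  define E where "E = {t \<in> K. \<gamma>1 t = \<gamma>2 t}"
  define D where "D = {t \<in> K. \<gamma>1 t \<noteq> \<gamma>2 t}"
  have cont: "isCont \<gamma>1 t" "isCont \<gamma>2 t" if "t \<in> K" for t
    using integral_curve_isCont 1 2 that unfolding K_def by blast+
  have "open D"
  proof -
    have "continuous_on K (\<lambda>t. \<gamma>1 t - \<gamma>2 t)"
      by (intro continuous_on_diff continuous_at_imp_continuous_on ballI cont)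
    then have "open ((\<lambda>t. \<gamma>1 t - \<gamma>2 t) -` (- {0}) \<inter> K)"
      using continuous_on_open_vimage[OF \<open>open K\<close>] by blast
    moreover have "(\<lambda>t. \<gamma>1 t - \<gamma>2 t) -` (- {0}) \<inter> K = D" by (auto simp: D_def)
    ultimately show ?thesis by simp
  qed
  moreover have "open E"
  proof (subst open_subopen, rule ballI)
    fix s assume "s \<in> E"
    then have s: "s \<in> K" "\<gamma>1 s = \<gamma>2 s" by (auto simp: E_def)
    have "\<gamma>1 s \<in> U" using s 1 by (auto simp: K_def integral_curve_def)
    then obtain \<rho> L where \<rho>: "\<rho> > 0" "L \<ge> 0"
      and lip: "\<And>x y. x \<in> cball (\<gamma>1 s) \<rho> \<Longrightarrow> y \<in> cball (\<gamma>1 s) \<rho> \<Longrightarrow> norm (Z x - Z y) \<le> L * norm (x - y)"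
      using Z unfolding loc_lip_def by blast
    have lim: "(\<gamma>1 \<longlongrightarrow> \<gamma>1 s) (nhds s)" "(\<gamma>2 \<longlongrightarrow> \<gamma>2 s) (nhds s)"
      using cont[OF s(1)] unfolding isCont_def tendsto_at_iff_tendsto_nhds .
    have "\<forall>\<^sub>F t in nhds s. dist (\<gamma>1 t) (\<gamma>1 s) < \<rho> \<and> dist (\<gamma>2 t) (\<gamma>1 s) < \<rho> \<and> t \<in> K"
      using tendstoD[OF lim(1) \<rho>(1)] tendstoD[OF lim(2) \<rho>(1)] eventually_nhds_in_open[OF \<open>open K\<close> s(1)]
      by eventually_elim (simp add: s(2))
    then obtain \<delta>0 where \<delta>0: "\<delta>0 > 0"
      "\<And>t. dist t s < \<delta>0 \<Longrightarrow> dist (\<gamma>1 t) (\<gamma>1 s) < \<rho> \<and> dist (\<gamma>2 t) (\<gamma>1 s) < \<rho> \<and> t \<in> K"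
      unfolding eventually_nhds_metric by blast
    define \<delta> where "\<delta> = min (\<delta>0 / 2) (1 / (4 * (L + 1)))"
    have \<delta>: "\<delta> > 0" "\<delta> < \<delta>0" "\<delta> \<le> 1 / (4 * (L + 1))" using \<delta>0 \<rho> by (auto simp: \<delta>_def)
    have "4 * \<delta> * L \<le> 1"
    proof -
      have "4 * \<delta> * L \<le> 4 * \<delta> * (L + 1)" using \<delta> by (intro mult_left_mono) auto
      also have "\<dots> \<le> 4 * (1 / (4 * (L + 1))) * (L + 1)" using \<delta> \<rho> by (intro mult_right_mono mult_left_mono) auto
      finally show ?thesis using \<rho> by simp
    qed
    then have small: "2 * (s + \<delta> - (s - \<delta>)) * L \<le> 1" by (simp add: algebra_simps)
    have near: "dist t s < \<delta>0" if "t \<in> {s - \<delta>..s + \<delta>}" for t using that \<delta> by (auto simp: dist_real_def)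
    have eq: "\<gamma>1 t = \<gamma>2 t" if t: "t \<in> {s - \<delta>..s + \<delta>}" for t
    proof -
      have "norm (\<gamma>1 t - \<gamma>2 t) \<le> 2 * norm (\<gamma>1 s - \<gamma>2 s)"
      proof (rule solution_dependence[where S = "cball (\<gamma>1 s) \<rho>" and Z = Z and f = \<gamma>1 and g = \<gamma>2, OF _ _ lip small \<rho>(2)])
        fix u assume u: "u \<in> {s - \<delta>..s + \<delta>}"
        from \<delta>0(2)[OF near[OF u]] have "u \<in> K" "\<gamma>1 u \<in> cball (\<gamma>1 s) \<rho>" "\<gamma>2 u \<in> cball (\<gamma>1 s) \<rho>"
          by (auto simp: dist_commute)
        then show "\<gamma>1 u \<in> cball (\<gamma>1 s) \<rho> \<and> (\<gamma>1 has_vector_derivative Z (\<gamma>1 u)) (at u within {s - \<delta>..s + \<delta>})"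
          "\<gamma>2 u \<in> cball (\<gamma>1 s) \<rho> \<and> (\<gamma>2 has_vector_derivative Z (\<gamma>2 u)) (at u within {s - \<delta>..s + \<delta>})"
          using 1 2 by (auto simp: K_def integral_curve_def intro: has_vector_derivative_at_within)
      qed (use t \<delta> in auto)
      then show ?thesis using s by simp
    qed
    have "{s - \<delta><..<s + \<delta>} \<subseteq> E"
    proof
      fix t assume "t \<in> {s - \<delta><..<s + \<delta>}"
      then have t: "t \<in> {s - \<delta>..s + \<delta>}" by simp
      show "t \<in> E" using \<delta>0(2)[OF near[OF t]] eq[OF t] by (simp add: E_def)
    qed
    then show "\<exists>T. open T \<and> s \<in> T \<and> T \<subseteq> E" using \<delta> by (intro exI[of _ "{s - \<delta><..<s + \<delta>}"]) auto
  qed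
  moreover have "E \<inter> D \<inter> K = {}" "K \<subseteq> E \<union> D" by (auto simp: E_def D_def)
  ultimately have "E \<inter> K = {} \<or> D \<inter> K = {}" using connectedD[OF \<open>connected K\<close>] by blast
  moreover have "t0 \<in> E \<inter> K" using t0 by (auto simp: E_def K_def)
  ultimately have "D \<inter> K = {}" by blast
  then show ?thesis using t by (auto simp: D_def K_def)
qed

text \<open>The first coordinate is time and the second one labels the plaques. The plaques are integral
  curves in \<open>W\<close>, which allows flow boxes to be chosen inside a given neighbourhood.\<close>

definition flow_box :: "('a::euclidean_space \<Rightarrow> 'a) \<Rightarrow> 'a set \<Rightarrow> real \<Rightarrow> (real \<times> real \<Rightarrow> 'a) \<Rightarrow> bool" where
  "flow_box Z W \<tau> G \<longleftrightarrow> \<tau> > 0 \<and> continuous_on ({-\<tau><..<\<tau>} \<times> {-\<tau><..<\<tau>}) G \<and>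
     inj_on G ({-\<tau><..<\<tau>} \<times> {-\<tau><..<\<tau>}) \<and>
     (\<forall>y\<in>{-\<tau><..<\<tau>}. integral_curve Z W (\<lambda>s. G (s, y)) {-\<tau><..<\<tau>})"

text \<open>Start the solutions on the line through \<open>p\<close> orthogonal to \<open>v = Z p\<close>. Along each of them the inner
  product with \<open>v\<close> increases, so that none meets this line twice; together with uniqueness this
  makes the box injective.\<close>

lemma flow_box_exists:
  fixes Z :: "real vfield"
  assumes Z: "loc_lip Z W" and p: "p \<in> W" and nz: "Z p \<noteq> 0"
  shows "\<exists>\<tau> G. flow_box Z W \<tau> G \<and> G (0, 0) = p"
proof -
  obtain \<rho>0 L where \<rho>0: "\<rho>0 > 0" "L \<ge> 0" "cball p \<rho>0 \<subseteq> W"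
    and lip0: "\<And>x y. x \<in> cball p \<rho>0 \<Longrightarrow> y \<in> cball p \<rho>0 \<Longrightarrow> norm (Z x - Z y) \<le> L * norm (x - y)"
    using Z p unfolding loc_lip_def by blast
  define v where "v = Z p"
  have v: "norm v > 0" using nz by (simp add: v_def)
  define n where "n = (- snd v, fst v)"
  have n: "n \<bullet> v = 0" "norm n = norm v" by (simp_all add: n_def inner_prod_def norm_prod_def)
  \<comment> \<open>On this ball \<open>Z\<close> deviates from \<open>v\<close> by at most half of \<open>|v|\<close>.\<close>
  define \<rho> where "\<rho> = min \<rho>0 (norm v / (2 * (L + 1)))"
  have \<rho>: "\<rho> > 0" "\<rho> \<le> \<rho>0" using \<rho>0 v by (auto simp: \<rho>_def)
  have "(L + 1) * \<rho> \<le> (L + 1) * (norm v / (2 * (L + 1)))"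
    using \<rho>0 by (intro mult_left_mono) (auto simp: \<rho>_def)
  also have "\<dots> = norm v / 2" using \<rho>0 by (simp add: field_simps)
  finally have L\<rho>: "L * \<rho> \<le> norm v / 2" using \<rho>(1) by (simp only: distrib_right)
  have sub: "cball p \<rho> \<subseteq> cball p \<rho>0" using \<rho> by auto
  have lip: "norm (Z x - Z y) \<le> L * norm (x - y)" if "x \<in> cball p \<rho>" "y \<in> cball p \<rho>" for x y
    using lip0 that sub by blast
  have dev: "norm (Z x - v) \<le> norm v / 2" if x: "x \<in> cball p \<rho>" for x
  proof -
    have "norm (Z x - v) \<le> L * norm (x - p)" unfolding v_def using \<rho> by (intro lip x) auto
    also have "\<dots> \<le> L * \<rho>" using x \<rho>0 by (intro mult_left_mono) (auto simp: dist_norm norm_minus_commute)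
    finally show ?thesis using L\<rho> by simp
  qed
  define M where "M = 2 * norm v"
  have bound: "norm (Z x) \<le> M" if "x \<in> cball p \<rho>" for x
    using dev[OF that] norm_triangle_sub[of "Z x" v] v unfolding M_def by linarith
  have dir: "Z x \<bullet> v > 0" if "x \<in> cball p \<rho>" for x
  proof -
    have "\<bar>(Z x - v) \<bullet> v\<bar> \<le> norm v / 2 * norm v"
      using Cauchy_Schwarz_ineq2[of "Z x - v" v] dev[OF that] v
      by (meson mult_right_mono norm_ge_zero order_trans)
    moreover have "(Z x - v) \<bullet> v = Z x \<bullet> v - norm v * norm v"
      by (simp add: inner_diff_left power2_norm_eq_inner[symmetric] power2_eq_square)
    ultimately have "Z x \<bullet> v \<ge> norm v * norm v / 2" by linarith
    moreover have "norm v * norm v > 0" using v by simp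
    ultimately show ?thesis by linarith
  qed
  define \<tau>0 where "\<tau>0 = min (\<rho> / (2 * M)) (1 / (6 * (L + 1)))"
  have M: "M > 0" using v by (simp add: M_def)
  have \<tau>0: "\<tau>0 > 0" using \<rho> M \<rho>0 by (auto simp: \<tau>0_def)
  have "M * \<tau>0 \<le> M * (\<rho> / (2 * M))" using M by (intro mult_left_mono) (auto simp: \<tau>0_def)
  then have M\<tau>: "M * \<tau>0 \<le> \<rho> / 2" using M by simp
  have "6 * \<tau>0 * L \<le> 6 * \<tau>0 * (L + 1)" using \<tau>0 by (intro mult_left_mono) auto
  also have "\<dots> \<le> 6 * (1 / (6 * (L + 1))) * (L + 1)"
    using \<rho>0 by (intro mult_right_mono mult_left_mono) (auto simp: \<tau>0_def)
  also have "\<dots> = 1" using \<rho>0 by (simp add: field_simps)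
  finally have \<tau>L: "6 * \<tau>0 * L \<le> 1" .
  \<comment> \<open>The difference of two times in the box has to stay in the interval of existence,
    and the starting points in the ball of half the radius.\<close>
  define \<tau> where "\<tau> = min (\<tau>0 / 3) (\<rho> / (2 * norm v))"
  have \<tau>: "\<tau> > 0" "3 * \<tau> \<le> \<tau>0" using \<tau>0 \<rho> v by (auto simp: \<tau>_def)
  have "\<tau> * norm v \<le> \<rho> / (2 * norm v) * norm v" using v by (intro mult_right_mono) (auto simp: \<tau>_def)
  then have \<tau>v: "\<tau> * norm v \<le> \<rho> / 2" using v by simp
  have "\<exists>\<gamma>. \<gamma> 0 = p + y *\<^sub>R n \<and> (\<forall>t\<in>{-\<tau>0..\<tau>0}. \<gamma> t \<in> cball p \<rho> \<and>
           (\<gamma> has_vector_derivative Z (\<gamma> t)) (at t within {-\<tau>0..\<tau>0}))" if "\<bar>y\<bar> \<le> \<tau>" for y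
  proof (rule picard_existence[OF lip bound \<tau>0 \<rho>(1) \<rho>0(2) _ \<tau>L])
    have "\<bar>y\<bar> * norm v \<le> \<tau> * norm v" using that by (intro mult_right_mono) auto
    then show "norm (p + y *\<^sub>R n - p) + M * \<tau>0 \<le> \<rho>" using M\<tau> \<tau>v n by simp
  qed auto
  then obtain g where g0: "\<And>y. \<bar>y\<bar> \<le> \<tau> \<Longrightarrow> g y 0 = p + y *\<^sub>R n"
    and gin: "\<And>y t. \<bar>y\<bar> \<le> \<tau> \<Longrightarrow> t \<in> {-\<tau>0..\<tau>0} \<Longrightarrow> g y t \<in> cball p \<rho>"
    and gd: "\<And>y t. \<bar>y\<bar> \<le> \<tau> \<Longrightarrow> t \<in> {-\<tau>0..\<tau>0} \<Longrightarrow>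
        (g y has_vector_derivative Z (g y t)) (at t within {-\<tau>0..\<tau>0})"
    by metis
  have curve: "integral_curve Z W (g y) {-\<tau>0<..<\<tau>0}" if y: "\<bar>y\<bar> \<le> \<tau>" for y
    unfolding integral_curve_def
  proof (intro conjI ballI)
    fix t assume t: "t \<in> {-\<tau>0<..<\<tau>0}"
    show "g y t \<in> W" using gin[OF y, of t] t sub \<rho>0(3) by auto
    have "(g y has_vector_derivative Z (g y t)) (at t within {-\<tau>0<..<\<tau>0})"
      by (rule has_vector_derivative_within_subset[OF gd[OF y]]) (use t in auto)
    then show "(g y has_vector_derivative Z (g y t)) (at t)"
      using t by (simp add: at_within_open[OF t])
  qed auto
  define G where "G = (\<lambda>(s, y). g y s)"
  let ?I = "{-\<tau><..<\<tau>}"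
  have G_lip: "norm (G (s, y) - G (s', y')) \<le> M * \<bar>s - s'\<bar> + 2 * norm n * \<bar>y - y'\<bar>"
    if "s \<in> ?I" "s' \<in> ?I" "y \<in> ?I" "y' \<in> ?I" for s s' y y'
  proof -
    have y: "\<bar>y\<bar> \<le> \<tau>" "\<bar>y'\<bar> \<le> \<tau>" using that by auto
    have s: "s \<in> {-\<tau>0..\<tau>0}" "s' \<in> {-\<tau>0..\<tau>0}" using that \<tau> by auto
    have 1: "norm (g y s - g y s') \<le> M * \<bar>s - s'\<bar>"
      by (rule vector_derivative_bound[OF _ gd[OF y(1)]]) (use s bound gin[OF y(1)] in auto)
    have "norm (g y s' - g y' s') \<le> 2 * norm (g y 0 - g y' 0)"
    proof (rule solution_dependence[where S = "cball p \<rho>" and Z = Z and f = "g y" and g = "g y'", OF _ _ lip])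
      show "2 * (\<tau>0 - - \<tau>0) * L \<le> 1" using \<tau>L \<tau>0 \<rho>0 by (simp add: mult_nonneg_nonneg)
    qed (use gd gin y s \<tau>0 \<rho>0 in auto)
    also have "g y 0 - g y' 0 = (y - y') *\<^sub>R n" by (simp add: g0 y algebra_simps)
    finally have 2: "norm (g y s' - g y' s') \<le> 2 * norm n * \<bar>y - y'\<bar>" by (simp add: mult_ac)
    have "norm (g y s - g y' s') \<le> norm (g y s - g y s') + norm (g y s' - g y' s')"
      using norm_triangle_ineq[of "g y s - g y s'" "g y s' - g y' s'"] by simp
    with 1 2 show ?thesis by (simp add: G_def)
  qed
  have "continuous_on (?I \<times> ?I) G"
  proof (rule lipschitz_on_continuous_on)
    show "(M + 2 * norm n)-lipschitz_on (?I \<times> ?I) G"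
    proof (rule lipschitz_onI)
      fix z z' assume "z \<in> ?I \<times> ?I" "z' \<in> ?I \<times> ?I"
      then obtain s y s' y' where z: "z = (s, y)" "z' = (s', y')" "s \<in> ?I" "s' \<in> ?I" "y \<in> ?I" "y' \<in> ?I" by auto
      have "\<bar>s - s'\<bar> \<le> dist z z'" "\<bar>y - y'\<bar> \<le> dist z z'"
        unfolding z dist_norm using norm_fst_le[of "s - s'" "y - y'"] norm_snd_le[of "y - y'" "s - s'"] by auto
      then have "M * \<bar>s - s'\<bar> + 2 * norm n * \<bar>y - y'\<bar> \<le> M * dist z z' + 2 * norm n * dist z z'"
        using M by (intro add_mono mult_left_mono) auto
      with G_lip[OF z(3-6)] show "dist (G z) (G z') \<le> (M + 2 * norm n) * dist z z'"
        by (simp add: z dist_norm algebra_simps)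
    qed (use M in auto)
  qed
  moreover have "inj_on G (?I \<times> ?I)"
  proof (rule inj_onI)
    fix z z' assume zz: "z \<in> ?I \<times> ?I" "z' \<in> ?I \<times> ?I" "G z = G z'"
    then obtain s y s' y' where z: "z = (s, y)" "z' = (s', y')" "s \<in> ?I" "s' \<in> ?I" "y \<in> ?I" "y' \<in> ?I" by auto
    have y: "\<bar>y\<bar> \<le> \<tau>" "\<bar>y'\<bar> \<le> \<tau>" using z by auto
    have eq: "g y s = g y' s'" using zz z by (simp add: G_def)
    define c where "c = s' - s"
    have sh: "integral_curve Z W (\<lambda>t. g y' (t + c)) ((\<lambda>t. t - c) ` {-\<tau>0<..<\<tau>0})"
      by (rule integral_curve_shift[OF curve[OF y(2)]])
    have im: "t \<in> (\<lambda>t. t - c) ` {-\<tau>0<..<\<tau>0}" if "t + c \<in> {-\<tau>0<..<\<tau>0}" for t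
      using that by (intro image_eqI[of _ _ "t + c"]) auto
    have "g y (- c) = g y' (- c + c)"
    proof (rule integral_curve_unique[OF Z curve[OF y(1)] sh, of s])
      show "s \<in> {- \<tau>0<..<\<tau>0}" "- c \<in> {- \<tau>0<..<\<tau>0}" using z \<tau> by (auto simp: c_def)
      show "s \<in> (\<lambda>t. t - c) ` {- \<tau>0<..<\<tau>0}" "- c \<in> (\<lambda>t. t - c) ` {- \<tau>0<..<\<tau>0}"
        using z \<tau> by (auto intro!: im simp: c_def)
      show "g y s = g y' (s + c)" using eq by (simp add: c_def)
    qed
    then have e0: "g y (- c) = p + y' *\<^sub>R n" using g0[OF y(2)] by simp
    have inc: "g y t \<bullet> v < g y u \<bullet> v" if "-\<tau>0 < t" "t < u" "u < \<tau>0" for t u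
    proof (rule DERIV_pos_imp_increasing[OF that(2)])
      fix x assume x: "t \<le> x" "x \<le> u"
      then have x': "x \<in> {-\<tau>0<..<\<tau>0}" using that by auto
      have "(g y has_vector_derivative Z (g y x)) (at x)"
        using curve[OF y(1)] x' by (simp add: integral_curve_def)
      then have "((\<lambda>t. g y t \<bullet> v) has_real_derivative Z (g y x) \<bullet> v) (at x)"
        unfolding has_vector_derivative_def has_field_derivative_def
        by (auto intro!: derivative_eq_intros simp: fun_eq_iff)
      moreover have "Z (g y x) \<bullet> v > 0" by (rule dir, rule gin[OF y(1)]) (use x' in auto)
      ultimately show "\<exists>w. ((\<lambda>t. g y t \<bullet> v) has_real_derivative w) (at x) \<and> w > 0" by blast
    qed
    have "g y (- c) \<bullet> v = g y 0 \<bullet> v" using e0 g0[OF y(1)] n(1) by (simp add: inner_add_left)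
    moreover have "-\<tau>0 < - c" "- c < \<tau>0" using z \<tau> by (auto simp: c_def)
    ultimately have "c = 0" using inc[of "- c" 0] inc[of 0 "- c"] \<tau>0 by (cases "c = 0"; cases "c > 0") auto
    then have "y *\<^sub>R n = y' *\<^sub>R n" using e0 g0[OF y(1)] by simp
    then have "y = y'" using n(2) v by auto
    then show "z = z'" using \<open>c = 0\<close> by (simp add: z c_def)
  qed
  moreover have "integral_curve Z W (\<lambda>s. G (s, y)) ?I" if "y \<in> ?I" for y
  proof -
    have "\<bar>y\<bar> \<le> \<tau>" "?I \<subseteq> {-\<tau>0<..<\<tau>0}" using that \<tau> by auto
    from integral_curve_subset[OF curve[OF this(1)] _ _ this(2)] show ?thesis by (simp add: G_def)
  qed
  ultimately have "flow_box Z W \<tau> G" using \<tau> by (auto simp: flow_box_def)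
  moreover have "G (0, 0) = p" using g0[of 0] \<tau> by (simp add: G_def)
  ultimately show ?thesis by blast
qed

text \<open>A continuous injective map from an open square to the plane is a homeomorphism onto an open set,
  by invariance of domain.\<close>

lemma flow_box_inverse:
  fixes G :: "real \<times> real \<Rightarrow> real \<times> real"
  assumes "flow_box Z W \<tau> G"
  obtains H where "open (G ` ({-\<tau><..<\<tau>} \<times> {-\<tau><..<\<tau>}))"
    "homeomorphism ({-\<tau><..<\<tau>} \<times> {-\<tau><..<\<tau>}) (G ` ({-\<tau><..<\<tau>} \<times> {-\<tau><..<\<tau>})) G H"
proof -
  let ?B = "{-\<tau><..<\<tau>} \<times> {-\<tau><..<\<tau>}"
  have B: "open ?B" "continuous_on ?B G" "inj_on G ?B"
    using assms by (auto simp: flow_box_def intro!: open_Times)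
  obtain H where "homeomorphism ?B (G ` ?B) G H"
    using invariance_of_domain_homeomorphism[OF B(1,2) _ B(3)] by auto
  with invariance_of_domain[OF B(2,1,3)] that show ?thesis by blast
qed

section \<open>Orientation of leaves under a topological equivalence\<close>

lemma orbit_eq: "orbit U Z p = {\<gamma> t |\<gamma> I t. integral_curve Z U \<gamma> I \<and> 0 \<in> I \<and> t \<in> I \<and> \<gamma> 0 = p}"
  unfolding orbit_def integral_curve_def by (rule Collect_cong) blast

lemma integral_curve_mono: "integral_curve Z W \<gamma> I \<Longrightarrow> W \<subseteq> U \<Longrightarrow> integral_curve Z U \<gamma> I"
  unfolding integral_curve_def by blast

lemma loc_lip_subset:
  assumes "loc_lip Z U" "open W" "W \<subseteq> U"
  shows "loc_lip Z W"
  unfolding loc_lip_def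
proof
  fix p assume p: "p \<in> W"
  then obtain \<rho> L where \<rho>: "\<rho> > 0" "L \<ge> 0" "cball p \<rho> \<subseteq> U"
    "\<forall>x\<in>cball p \<rho>. \<forall>y\<in>cball p \<rho>. norm (Z x - Z y) \<le> L * norm (x - y)"
    using assms unfolding loc_lip_def by blast
  obtain e where e: "e > 0" "cball p e \<subseteq> W" using assms(2) p open_contains_cball by blast
  have sub: "cball p (min e \<rho>) \<subseteq> cball p e" "cball p (min e \<rho>) \<subseteq> cball p \<rho>" by auto
  have "min e \<rho> > 0" using e \<rho> by simp
  moreover have "cball p (min e \<rho>) \<subseteq> W" using sub(1) e(2) by (rule subset_trans)
  moreover have "norm (Z x - Z y) \<le> L * norm (x - y)"
    if "x \<in> cball p (min e \<rho>)" "y \<in> cball p (min e \<rho>)" for x y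
    using \<rho>(4) subsetD[OF sub(2)] that by blast
  ultimately show "\<exists>\<rho>>0. \<exists>L\<ge>0. cball p \<rho> \<subseteq> W \<and>
      (\<forall>x\<in>cball p \<rho>. \<forall>y\<in>cball p \<rho>. norm (Z x - Z y) \<le> L * norm (x - y))"
    using \<rho>(2) by blast
qed

lemma flow_box_shifted_unique:
  assumes Z: "loc_lip Z U" and G: "flow_box Z W \<tau> G" "W \<subseteq> U"
    and sy: "s \<in> {-\<tau><..<\<tau>}" "y \<in> {-\<tau><..<\<tau>}"
    and \<gamma>: "integral_curve Z U \<gamma> J" "t0 \<in> J" "\<gamma> t0 = G (s, y)"
    and t: "t \<in> J" "s + (t - t0) \<in> {-\<tau><..<\<tau>}"
  shows "\<gamma> t = G (s + (t - t0), y)"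
proof -
  have "integral_curve Z U (\<lambda>s. G (s, y)) {-\<tau><..<\<tau>}"
    using G sy integral_curve_mono unfolding flow_box_def by blast
  from integral_curve_shift[OF this, of "s - t0"]
  have c: "integral_curve Z U (\<lambda>t. G (t + (s - t0), y)) ((\<lambda>t. t - (s - t0)) ` {-\<tau><..<\<tau>})" .
  have "\<gamma> t = G (t + (s - t0), y)"
  proof (rule integral_curve_unique[OF Z \<gamma>(1) c, of t0])
    show "t0 \<in> (\<lambda>t. t - (s - t0)) ` {-\<tau><..<\<tau>}" using sy by (intro image_eqI[of _ _ s]) auto
    show "t \<in> (\<lambda>t. t - (s - t0)) ` {-\<tau><..<\<tau>}"
      using t by (intro image_eqI[of _ _ "s + (t - t0)"]) auto
  qed (use \<gamma> t in auto)
  moreover have "t + (s - t0) = s + (t - t0)" by simp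
  ultimately show ?thesis by simp
qed

text \<open>If an orbit from \<open>p\<close> meets a plaque at some time, then it is still in this plaque at a nearby
  rational time, and by uniqueness the time determines the point of the orbit.\<close>

lemma countable_plaques_of_orbit:
  assumes Z: "loc_lip Z V" and G: "flow_box Z V \<tau> G"
  shows "countable {y \<in> {-\<tau><..<\<tau>}. \<exists>s\<in>{-\<tau><..<\<tau>}. G (s, y) \<in> orbit V Z p}"
proof -
  define C where "C q w \<longleftrightarrow> (\<exists>\<sigma> J. integral_curve Z V \<sigma> J \<and> 0 \<in> J \<and> q \<in> J \<and> \<sigma> 0 = p \<and> \<sigma> q = w)" for q w
  have C_unique: "w = w'" if C: "C q w" "C q w'" for q w w'
  proof -
    obtain \<sigma> J \<sigma>' J' where "integral_curve Z V \<sigma> J" "0 \<in> J" "q \<in> J" "\<sigma> 0 = p" "\<sigma> q = w"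
      "integral_curve Z V \<sigma>' J'" "0 \<in> J'" "q \<in> J'" "\<sigma>' 0 = p" "\<sigma>' q = w'"
      using C unfolding C_def by blast
    then show ?thesis using integral_curve_unique[OF Z, of \<sigma> J \<sigma>' J' 0 q] by simp
  qed
  define f where "f q = snd (inv_into ({-\<tau><..<\<tau>} \<times> {-\<tau><..<\<tau>}) G (SOME w. C q w))" for q
  have inj: "inj_on G ({-\<tau><..<\<tau>} \<times> {-\<tau><..<\<tau>})" using G by (simp add: flow_box_def)
  have "y \<in> f ` \<rat>" if y: "y \<in> {-\<tau><..<\<tau>}" and s: "s \<in> {-\<tau><..<\<tau>}" and o: "G (s, y) \<in> orbit V Z p" for s y
  proof -
    obtain \<sigma> J t2 where \<sigma>: "integral_curve Z V \<sigma> J" "0 \<in> J" "t2 \<in> J" "\<sigma> 0 = p" "\<sigma> t2 = G (s, y)"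
      using o unfolding orbit_eq by auto
    obtain d where d: "d > 0" "ball t2 d \<subseteq> J"
      using \<sigma>(1,3) open_contains_ball unfolding integral_curve_def by blast
    \<comment> \<open>A rational time shortly after \<open>t2\<close>, before the curve leaves the plaque.\<close>
    have "t2 < t2 + min d (\<tau> - s)" using d s by auto
    then obtain q where q: "q \<in> \<rat>" "t2 < q" "q < t2 + min d (\<tau> - s)" using Rats_dense_in_real by blast
    have qJ: "q \<in> J" using d(2) q by (auto simp: dist_real_def)
    have sq: "s + (q - t2) \<in> {-\<tau><..<\<tau>}" using q s by auto
    have "\<sigma> q = G (s + (q - t2), y)"
      by (rule flow_box_shifted_unique[OF Z G _ s y \<sigma>(1,3,5) qJ sq]) simp
    then have "C q (G (s + (q - t2), y))" using \<sigma> qJ unfolding C_def by blast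
    then have "(SOME w. C q w) = G (s + (q - t2), y)"
      using C_unique by (intro some_equality) blast+
    then have "f q = y" using inv_into_f_f[OF inj, of "(s + (q - t2), y)"] sq y by (simp add: f_def)
    then show ?thesis using q by blast
  qed
  then have "{y \<in> {-\<tau><..<\<tau>}. \<exists>s\<in>{-\<tau><..<\<tau>}. G (s, y) \<in> orbit V Z p} \<subseteq> f ` \<rat>" by blast
  then show ?thesis by (rule countable_subset) (intro countable_image countable_rat)
qed

text \<open>The map \<open>h\<close> carries short forward arcs of \<open>Z\<close> at \<open>q\<close> to arcs that leave \<open>h q\<close> in the direction of
  \<open>\<epsilon> Z'\<close>. As \<open>h\<close> is only continuous, this is expressed by linear functionals \<open>u\<close> that are positive on
  \<open>Z' (h q)\<close>; the functionals needed are \<open>Z' (h q)\<close> itself and the infinitesimal rotation about the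
  origin.\<close>

definition transports :: "real vfield \<Rightarrow> real vfield \<Rightarrow> (real \<times> real) set \<Rightarrow>
    (real \<times> real \<Rightarrow> real \<times> real) \<Rightarrow> real \<Rightarrow> real \<times> real \<Rightarrow> bool" where
  "transports Z Z' U h \<epsilon> q \<longleftrightarrow> (\<forall>\<gamma> I. integral_curve Z U \<gamma> I \<longrightarrow> 0 \<in> I \<longrightarrow> \<gamma> 0 = q \<longrightarrow>
     (\<forall>u. u \<bullet> Z' (h q) > 0 \<longrightarrow> (\<forall>\<^sub>F t in at_right 0. \<epsilon> * (u \<bullet> (h (\<gamma> t) - h q)) > 0)))"

lemma connected_nonzero_sign:
  fixes f :: "'a::topological_space \<Rightarrow> real"
  assumes "connected K" "continuous_on K f" "\<And>x. x \<in> K \<Longrightarrow> f x \<noteq> 0"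
  shows "\<exists>\<epsilon>\<in>{1, -1}. \<forall>x\<in>K. \<epsilon> * f x > 0"
proof (rule ccontr)
  assume "\<not> ?thesis"
  then obtain x y where xy: "x \<in> K" "f x \<le> 0" "y \<in> K" "f y \<ge> 0" by (auto simp: not_less)
  have "connected (f ` K)" by (rule connected_continuous_image[OF assms(2,1)])
  then have "0 \<in> f ` K"
    using connectedD_interval[of "f ` K" "f x" "f y" 0] xy by auto
  then show False using assms(3) by auto
qed

text \<open>Read in flow boxes of \<open>Z\<close> at \<open>p\<close> and of \<open>Z'\<close> at \<open>h p\<close>, the map \<open>h\<close> preserves plaques: the label of
  the image plaque varies continuously along a plaque and takes countably many values. On each
  plaque \<open>h\<close> is thus an injective continuous function of time, hence monotone, and the sense of
  monotonicity depends continuously on the plaque.\<close>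

lemma leaf_map_locally_monotone:
  assumes Z: "loc_lip Z U" and Z': "loc_lip Z' V" and U: "open U" and V: "open V"
    and h: "homeomorphism U V h g" and leaf: "\<And>L. L \<in> leaves U Z \<Longrightarrow> h ` L \<in> leaves V Z'"
    and p: "p \<in> U" "Z p \<noteq> 0" "Z' (h p) \<noteq> 0"
  shows "\<exists>N. open N \<and> p \<in> N \<and> N \<subseteq> U \<and> (\<exists>\<epsilon>\<in>{1, -1}. \<forall>q\<in>N. transports Z Z' U h \<epsilon> q)"
proof -
  have h_cont: "continuous_on U h" and h_img: "h ` U = V" and h_inj: "inj_on h U"
    using h unfolding homeomorphism_def by (blast, blast, metis inj_on_inverseI)
  have "h p \<in> V" using h_img p by blast
  from flow_box_exists[OF Z' this p(3)]
  obtain \<tau>' G' where G': "flow_box Z' V \<tau>' G'" "G' (0, 0) = h p" by blast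
  let ?J = "{-\<tau>'<..<\<tau>'}"
  obtain H' where N': "open (G' ` (?J \<times> ?J))" and H': "homeomorphism (?J \<times> ?J) (G' ` (?J \<times> ?J)) G' H'"
    using flow_box_inverse[OF G'(1)] by blast
  have \<tau>': "\<tau>' > 0" using G' by (simp add: flow_box_def)
  define W where "W = U \<inter> h -` (G' ` (?J \<times> ?J))"
  have "open W" unfolding W_def using continuous_open_preimage[OF h_cont U N'] .
  have "h p \<in> G' ` (?J \<times> ?J)" using G'(2) \<tau>' by (intro image_eqI[of _ _ "(0, 0)"]) auto
  then have "p \<in> W" using p by (simp add: W_def)
  have "W \<subseteq> U" by (auto simp: W_def)
  have ZW: "loc_lip Z W" by (rule loc_lip_subset[OF Z \<open>open W\<close> \<open>W \<subseteq> U\<close>])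
  from flow_box_exists[OF ZW \<open>p \<in> W\<close> p(2)]
  obtain \<tau> G where G: "flow_box Z W \<tau> G" "G (0, 0) = p" by blast
  let ?I = "{-\<tau><..<\<tau>}"
  have N: "open (G ` (?I \<times> ?I))" using flow_box_inverse[OF G(1)] by blast
  have \<tau>: "\<tau> > 0" using G by (simp add: flow_box_def)
  have curve: "integral_curve Z U (\<lambda>s. G (s, y)) ?I" if "y \<in> ?I" for y
    using G(1) that \<open>W \<subseteq> U\<close> integral_curve_mono unfolding flow_box_def by blast
  have GW: "G z \<in> W" if "z \<in> ?I \<times> ?I" for z
    using G(1) that unfolding flow_box_def integral_curve_def by (cases z) auto
  have G_cont: "continuous_on (?I \<times> ?I) G" and G_inj: "inj_on G (?I \<times> ?I)"
    using G(1) by (auto simp: flow_box_def)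
  \<comment> \<open>The map \<open>h\<close> in the coordinates of the two flow boxes.\<close>
  define k where "k z = H' (h (G z))" for z
  have k_cont: "continuous_on (?I \<times> ?I) k"
    unfolding k_def
  proof (rule continuous_on_compose2[of "G' ` (?J \<times> ?J)" H'])
    show "continuous_on (G' ` (?J \<times> ?J)) H'" using H' by (simp add: homeomorphism_def)
    show "continuous_on (?I \<times> ?I) (\<lambda>z. h (G z))"
      by (rule continuous_on_compose2[OF h_cont G_cont]) (use GW \<open>W \<subseteq> U\<close> in auto)
    show "(\<lambda>z. h (G z)) ` (?I \<times> ?I) \<subseteq> G' ` (?J \<times> ?J)" using GW by (auto simp: W_def)
  qed
  have kJ: "k z \<in> ?J \<times> ?J" and Gk: "G' (k z) = h (G z)" if "z \<in> ?I \<times> ?I" for z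
  proof -
    have "h (G z) \<in> G' ` (?J \<times> ?J)" using GW[OF that] by (simp add: W_def)
    then show "k z \<in> ?J \<times> ?J" "G' (k z) = h (G z)"
      using H' unfolding k_def homeomorphism_def by (blast, blast)
  qed
  have snd_k: "snd (k (s, y)) = snd (k (0, y))" if s: "s \<in> ?I" and y: "y \<in> ?I" for s y
  proof (rule ccontr)
    assume ne: "snd (k (s, y)) \<noteq> snd (k (0, y))"
    have "G (0, y) \<in> U" using GW[of "(0, y)"] \<open>W \<subseteq> U\<close> y \<tau> by auto
    then have "orbit U Z (G (0, y)) \<in> leaves U Z" by (simp add: leaves_def)
    from leaf[OF this] obtain p' where p': "h ` orbit U Z (G (0, y)) = orbit V Z' p'"
      by (auto simp: leaves_def)
    have orb: "G' (k (t, y)) \<in> orbit V Z' p'" if t: "t \<in> ?I" for t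
    proof -
      have "G (t, y) \<in> orbit U Z (G (0, y))"
        unfolding orbit_eq using curve[OF y] t \<tau> by force
      then show ?thesis using p' Gk[of "(t, y)"] t y by auto
    qed
    define S where "S = (\<lambda>t. snd (k (t, y))) ` ?I"
    have "continuous_on ?I (\<lambda>t. snd (k (t, y)))"
      by (intro continuous_on_snd continuous_on_compose2[OF k_cont]) (use y in \<open>auto intro!: continuous_intros\<close>)
    then have "connected S" unfolding S_def by (intro connected_continuous_image) auto
    have "S \<subseteq> {y \<in> ?J. \<exists>s\<in>?J. G' (s, y) \<in> orbit V Z' p'}"
    proof
      fix b assume "b \<in> S"
      then obtain t where t: "t \<in> ?I" "b = snd (k (t, y))" by (auto simp: S_def)
      have "k (t, y) \<in> ?J \<times> ?J" by (rule kJ) (use t y in auto)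
      then have "fst (k (t, y)) \<in> ?J" "b \<in> ?J" using t by auto
      moreover have "G' (fst (k (t, y)), b) \<in> orbit V Z' p'" using orb[OF t(1)] t(2) by simp
      ultimately show "b \<in> {y \<in> ?J. \<exists>s\<in>?J. G' (s, y) \<in> orbit V Z' p'}" by blast
    qed
    then have "countable S" using countable_plaques_of_orbit[OF Z' G'(1)] countable_subset by blast
    moreover have "snd (k (s, y)) \<in> S" "snd (k (0, y)) \<in> S" using s \<tau> by (auto simp: S_def)
    ultimately show False using connected_uncountable[OF \<open>connected S\<close> _ _ ne] by blast
  qed
  define a where "a z = fst (k z)" for z
  have a_eq: "k (s, y) = (a (s, y), snd (k (0, y)))" if "s \<in> ?I" "y \<in> ?I" for s y
    using snd_k[OF that] by (simp add: a_def prod_eq_iff)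
  have a_inj: "s = s'" if "s \<in> ?I" "s' \<in> ?I" "y \<in> ?I" "a (s, y) = a (s', y)" for s s' y
  proof -
    have "k (s, y) = k (s', y)"
      unfolding a_eq[OF that(1,3)] a_eq[OF that(2,3)] that(4) ..
    then have "h (G (s, y)) = h (G (s', y))" using Gk[of "(s, y)"] Gk[of "(s', y)"] that by simp
    moreover have "G (s, y) \<in> U" "G (s', y) \<in> U"
      using GW[of "(s, y)"] GW[of "(s', y)"] that \<open>W \<subseteq> U\<close> by auto
    ultimately have "G (s, y) = G (s', y)" by (rule inj_onD[OF h_inj])
    then show ?thesis using inj_onD[OF G_inj, of "(s, y)" "(s', y)"] that by auto
  qed
  have a_cont: "continuous_on (?I \<times> ?I) a" unfolding a_def by (intro continuous_on_fst k_cont)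
  \<comment> \<open>Pairs of times \<open>s < s'\<close> on a common plaque.\<close>
  define K where "K = {z :: real \<times> real \<times> real. fst z \<in> ?I \<and> fst (snd z) \<in> ?I \<and> snd (snd z) \<in> ?I \<and> fst z < fst (snd z)}"
  have "convex K"
  proof (rule convexI)
    fix z w :: "real \<times> real \<times> real" and u v :: real
    assume zw: "z \<in> K" "w \<in> K" and uv: "0 \<le> u" "0 \<le> v" "u + v = 1"
    have cI: "u * c + v * d \<in> ?I" if "c \<in> ?I" "d \<in> ?I" for c d
      using convexD[of ?I c d u v] that uv by (auto simp: convex_real_interval)
    have "u * (fst z - fst (snd z)) + v * (fst w - fst (snd w)) < 0"
      by (rule convex_bound_lt) (use zw uv in \<open>auto simp: K_def\<close>)
    then have "u * fst z + v * fst w < u * fst (snd z) + v * fst (snd w)" by (simp add: algebra_simps)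
    then show "u *\<^sub>R z + v *\<^sub>R w \<in> K" using zw cI by (simp add: K_def del: greaterThanLessThan_iff)
  qed
  then have "connected K" by (rule convex_connected)
  have "\<exists>\<epsilon>\<in>{1, -1}. \<forall>z\<in>K. \<epsilon> * (a (fst (snd z), snd (snd z)) - a (fst z, snd (snd z))) > 0"
  proof (rule connected_nonzero_sign[OF \<open>connected K\<close>])
    show "continuous_on K (\<lambda>z. a (fst (snd z), snd (snd z)) - a (fst z, snd (snd z)))"
      by (intro continuous_on_diff continuous_on_compose2[OF a_cont]) (auto simp: K_def intro!: continuous_intros)
    show "a (fst (snd z), snd (snd z)) - a (fst z, snd (snd z)) \<noteq> 0" if "z \<in> K" for z
      using a_inj[of "fst (snd z)" "fst z" "snd (snd z)"] that by (auto simp: K_def)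
  qed
  then obtain \<epsilon> where \<epsilon>: "\<epsilon> \<in> {1, -1}"
    and pos: "\<And>z. z \<in> K \<Longrightarrow> \<epsilon> * (a (fst (snd z), snd (snd z)) - a (fst z, snd (snd z))) > 0"
    by blast
  have mono: "\<epsilon> * (a (s', y) - a (s, y)) > 0" if "s \<in> ?I" "s' \<in> ?I" "y \<in> ?I" "s < s'" for s s' y
    using pos[of "(s, s', y)"] that by (simp add: K_def)
  have "transports Z Z' U h \<epsilon> q" if q: "q \<in> G ` (?I \<times> ?I)" for q
    unfolding transports_def
  proof (intro allI impI)
    fix \<gamma> J u assume \<gamma>: "integral_curve Z U \<gamma> J" "0 \<in> J" "\<gamma> 0 = q" and u: "u \<bullet> Z' (h q) > 0"
    obtain s y where sy: "s \<in> ?I" "y \<in> ?I" "q = G (s, y)" using q by auto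
    define b where "b = snd (k (0, y))"
    define F where "F x = u \<bullet> G' (x, b)" for x
    have bJ: "b \<in> ?J" "a (s, y) \<in> ?J" using kJ[of "(s, y)"] sy a_eq[OF sy(1,2)] by (auto simp: b_def)
    have hq: "h q = G' (a (s, y), b)" using Gk[of "(s, y)"] sy a_eq[OF sy(1,2)] by (simp add: b_def)
    have "((\<lambda>x. G' (x, b)) has_vector_derivative Z' (G' (a (s, y), b))) (at (a (s, y)))"
      using G'(1) bJ unfolding flow_box_def integral_curve_def by auto
    then have "(F has_real_derivative u \<bullet> Z' (h q)) (at (a (s, y)))"
      unfolding F_def has_vector_derivative_def has_field_derivative_def hq
      by (auto intro!: derivative_eq_intros simp: fun_eq_iff)
    from DERIV_pos_inc_right[OF this u] DERIV_pos_inc_left[OF this u]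
    obtain d1 d2 where d: "d1 > 0" "d2 > 0" "\<And>x. 0 < x \<Longrightarrow> x < d1 \<Longrightarrow> F (a (s, y)) < F (a (s, y) + x)"
      "\<And>x. 0 < x \<Longrightarrow> x < d2 \<Longrightarrow> F (a (s, y) - x) < F (a (s, y))" by blast
    have "((\<lambda>t. a (s + t, y)) \<longlongrightarrow> a (s + 0, y)) (at_right 0)"
    proof -
      have "open (?I \<times> ?I)" by (intro open_Times open_greaterThanLessThan)
      then have "isCont a (s, y)"
        using a_cont sy(1,2) by (simp add: continuous_on_eq_continuous_at del: greaterThanLessThan_iff)
      moreover have "((\<lambda>t. (s + t, y)) \<longlongrightarrow> (s, y)) (at_right 0)" by (auto intro!: tendsto_eq_intros)
      ultimately show ?thesis using isCont_tendsto_compose by fastforce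
    qed
    then have "((\<lambda>t. a (s + t, y) - a (s, y)) \<longlongrightarrow> 0) (at_right 0)" by (simp add: LIM_zero)
    from tendstoD[OF this, of "min d1 d2"] d
    have e1: "\<forall>\<^sub>F t in at_right 0. \<bar>a (s + t, y) - a (s, y)\<bar> < min d1 d2" by (simp add: dist_real_def)
    have "open J" using \<gamma>(1) by (simp add: integral_curve_def)
    then have e2: "\<forall>\<^sub>F t in at_right 0. t \<in> J"
      using \<gamma>(2) by (auto intro: eventually_at_topological[THEN iffD2])
    have e3: "\<forall>\<^sub>F t in at_right 0. t \<in> {0<..<\<tau> - s}" using sy by (intro eventually_at_right_real) auto
    show "\<forall>\<^sub>F t in at_right 0. \<epsilon> * (u \<bullet> (h (\<gamma> t) - h q)) > 0"
      using e1 e2 e3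
    proof eventually_elim
      case (elim t)
      have st: "s + t \<in> ?I" using elim(3) sy by auto
      have "\<gamma> t = G (s + (t - 0), y)"
        by (rule flow_box_shifted_unique[OF Z G(1) \<open>W \<subseteq> U\<close> sy(1,2) \<gamma>(1,2)]) (use \<gamma> sy elim st in auto)
      then have "h (\<gamma> t) = G' (a (s + t, y), b)"
        using Gk[of "(s + t, y)"] st sy a_eq[OF st sy(2)] by (simp add: b_def)
      then have eq: "u \<bullet> (h (\<gamma> t) - h q) = F (a (s + t, y)) - F (a (s, y))"
        by (simp add: F_def hq inner_diff_right)
      have sg: "\<epsilon> * (a (s + t, y) - a (s, y)) > 0" using mono[OF sy(1) st sy(2)] elim(3) by simp
      show ?case
      proof (cases "\<epsilon> = 1")
        case True
        then show ?thesis using sg elim(1) d(3)[of "a (s + t, y) - a (s, y)"] unfolding eq by auto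
      next
        case False
        then have "\<epsilon> = -1" using \<epsilon> by auto
        then show ?thesis using sg elim(1) d(4)[of "a (s, y) - a (s + t, y)"] unfolding eq by auto
      qed
    qed
  qed
  moreover have "p \<in> G ` (?I \<times> ?I)" using G(2) \<tau> by (intro image_eqI[of _ _ "(0, 0)"]) auto
  moreover have "G ` (?I \<times> ?I) \<subseteq> U" using GW \<open>W \<subseteq> U\<close> by auto
  ultimately show ?thesis using N \<epsilon> by (intro exI[of _ "G ` (?I \<times> ?I)"]) blast
qed

lemma transports_exclusive:
  assumes Z: "loc_lip Z U" and q: "q \<in> U" "Z q \<noteq> 0" "Z' (h q) \<noteq> 0"
  shows "\<not> (transports Z Z' U h 1 q \<and> transports Z Z' U h (-1) q)"
proof
  assume t: "transports Z Z' U h 1 q \<and> transports Z Z' U h (-1) q"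
  have tr: "\<forall>\<^sub>F t in at_right 0. \<epsilon> * (u \<bullet> (h (\<gamma> t) - h q)) > 0"
    if "transports Z Z' U h \<epsilon> q" "integral_curve Z U \<gamma> I" "0 \<in> I" "\<gamma> 0 = q" "u \<bullet> Z' (h q) > 0" for \<epsilon> \<gamma> I u
    using that(1)[unfolded transports_def, rule_format, OF that(2-5)] .
  obtain \<tau> G where G: "flow_box Z U \<tau> G" "G (0, 0) = q" using flow_box_exists[OF Z q(1,2)] by blast
  then have c: "integral_curve Z U (\<lambda>s. G (s, 0)) {-\<tau><..<\<tau>}" "0 \<in> {-\<tau><..<\<tau>}" by (auto simp: flow_box_def)
  have u: "Z' (h q) \<bullet> Z' (h q) > 0" using q by simp
  have "\<forall>\<^sub>F t in at_right 0. 1 * (Z' (h q) \<bullet> (h (G (t, 0)) - h q)) > 0"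
    "\<forall>\<^sub>F t in at_right 0. (-1) * (Z' (h q) \<bullet> (h (G (t, 0)) - h q)) > 0"
    by (rule tr[OF _ c G(2) u], use t in blast)+
  then have "\<forall>\<^sub>F t in at_right (0::real). False" by eventually_elim simp
  then show False by simp
qed

text \<open>The points where the orientation of orbits is preserved and those where it is reversed form two
  disjoint open sets covering the connected set \<open>D\<close>.\<close>

lemma leaf_map_monotone:
  assumes Z: "loc_lip Z U" and Z': "loc_lip Z' V" and U: "open U" and V: "open V"
    and h: "homeomorphism U V h g" and leaf: "\<And>L. L \<in> leaves U Z \<Longrightarrow> h ` L \<in> leaves V Z'"
    and D: "connected D" "D \<subseteq> U" "\<And>p. p \<in> D \<Longrightarrow> Z p \<noteq> 0" "\<And>p. p \<in> D \<Longrightarrow> Z' (h p) \<noteq> 0"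
  shows "\<exists>\<epsilon>\<in>{1, -1}. \<forall>q\<in>D. transports Z Z' U h \<epsilon> q"
proof -
  define A where "A \<epsilon> = \<Union>{N. open N \<and> N \<subseteq> U \<and> (\<forall>q\<in>N. transports Z Z' U h \<epsilon> q)}" for \<epsilon>
  have op: "open (A \<epsilon>)" for \<epsilon> unfolding A_def by (rule open_Union) auto
  have At: "transports Z Z' U h \<epsilon> q" "q \<in> U" if "q \<in> A \<epsilon>" for q \<epsilon> using that unfolding A_def by blast+
  have "D \<subseteq> A 1 \<union> A (-1)"
  proof
    fix p assume p: "p \<in> D"
    then have "p \<in> U" using D(2) by blast
    from leaf_map_locally_monotone[OF Z Z' U V h leaf this D(3)[OF p] D(4)[OF p]]
    show "p \<in> A 1 \<union> A (-1)" unfolding A_def by auto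
  qed
  moreover have "A 1 \<inter> A (-1) \<inter> D = {}"
    using transports_exclusive[OF Z] At D by blast
  ultimately have "A 1 \<inter> D = {} \<or> A (-1) \<inter> D = {}"
    using connectedD[OF D(1) op op] by blast
  then have "D \<subseteq> A 1 \<or> D \<subseteq> A (-1)" using \<open>D \<subseteq> A 1 \<union> A (-1)\<close> by blast
  then show ?thesis using At by blast
qed

section \<open>Angular velocity near the origin\<close>

text \<open>The value \<open>cross w (Z w)\<close> is \<open>|w|\<^sup>2\<close> times the angular velocity of \<open>Z\<close> at \<open>w\<close>.\<close>

definition cross :: "real \<times> real \<Rightarrow> real \<times> real \<Rightarrow> real" where
  "cross a b = fst a * snd b - snd a * fst b"

lemma cross_diff_left: "cross (a - b) c = cross a c - cross b c"
  and cross_scaleR_left: "cross (r *\<^sub>R a) c = r * cross a c"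
  and cross_scaleR_right: "cross a (r *\<^sub>R c) = r * cross a c"
  and cross_self [simp]: "cross a a = 0"
  by (simp_all add: cross_def algebra_simps)

lemma cross_eq_inner: "cross a b = (- snd a, fst a) \<bullet> b"
  by (simp add: cross_def inner_prod_def)

lemma abs_cross_le: "\<bar>cross a b\<bar> \<le> norm a * norm b"
proof -
  have "norm (- snd a, fst a) = norm a" by (cases a) (simp add: norm_Pair add.commute)
  then show ?thesis using Cauchy_Schwarz_ineq2[of "(- snd a, fst a)" b] by (simp add: cross_eq_inner)
qed

lemma tendsto_cross [tendsto_intros]:
  "(f \<longlongrightarrow> a) F \<Longrightarrow> (g \<longlongrightarrow> b) F \<Longrightarrow> ((\<lambda>x. cross (f x) (g x)) \<longlongrightarrow> cross a b) F"
  unfolding cross_def by (intro tendsto_intros)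

lemma continuous_on_cross [continuous_intros]:
  "continuous_on S f \<Longrightarrow> continuous_on S g \<Longrightarrow> continuous_on S (\<lambda>x. cross (f x) (g x))"
  unfolding cross_def by (intro continuous_intros)

lemma cross_has_derivative:
  assumes "(w has_vector_derivative w') (at t)"
  shows "((\<lambda>t. cross a (w t)) has_real_derivative cross a w') (at t)"
  using assms unfolding cross_eq_inner has_vector_derivative_def has_field_derivative_def
  by (auto intro!: derivative_eq_intros simp: fun_eq_iff)

lemma expansion_lipschitz_norm:
  fixes f :: "real \<times> real \<Rightarrow> real"
  assumes "expansion_at f p a" "n \<ge> 1" "\<And>i j. 0 < i + j \<Longrightarrow> i + j < n \<Longrightarrow> a i j = 0"
  shows "\<exists>C>0. \<exists>\<delta>>0. \<forall>\<rho> w w'. \<rho> \<le> \<delta> \<longrightarrow> norm w \<le> \<rho> \<longrightarrow> norm w' \<le> \<rho> \<longrightarrow>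
     \<bar>f (p + w) - f (p + w')\<bar> \<le> C * \<rho> ^ (n - 1) * norm (w - w')"
proof -
  obtain C \<delta> where C: "C > 0" "\<delta> > 0" and
    est: "\<And>\<rho> x y x' y'. \<rho> \<le> \<delta> \<Longrightarrow> norm x \<le> \<rho> \<Longrightarrow> norm y \<le> \<rho> \<Longrightarrow> norm x' \<le> \<rho> \<Longrightarrow> norm y' \<le> \<rho> \<Longrightarrow>
     norm (f (fst p + x, snd p + y) - f (fst p + x', snd p + y'))
       \<le> C * \<rho> ^ (n - 1) * (norm (x - x') + norm (y - y'))"
    using expansion_lipschitz[OF assms] by blast
  have "\<bar>f (p + w) - f (p + w')\<bar> \<le> (2 * C) * \<rho> ^ (n - 1) * norm (w - w')"
    if w: "\<rho> \<le> \<delta>" "norm w \<le> \<rho>" "norm w' \<le> \<rho>" for \<rho> w w'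
  proof -
    have n: "norm (fst z) \<le> norm z" "norm (snd z) \<le> norm z" for z :: "real \<times> real"
      using norm_fst_le[of "fst z" "snd z"] norm_snd_le[of "snd z" "fst z"] by auto
    have "\<rho> \<ge> 0" using w(2) norm_ge_zero order_trans by blast
    have "norm (f (fst p + fst w, snd p + snd w) - f (fst p + fst w', snd p + snd w'))
       \<le> C * \<rho> ^ (n - 1) * (norm (fst w - fst w') + norm (snd w - snd w'))"
      by (rule est) (use w n order_trans in blast)+
    also have "\<dots> \<le> C * \<rho> ^ (n - 1) * (norm (w - w') + norm (w - w'))"
      using n[of "w - w'"] C \<open>\<rho> \<ge> 0\<close> by (intro mult_left_mono add_mono) auto
    finally show ?thesis by (simp add: plus_prod_def mult_ac)
  qed
  then show ?thesis using C by (intro exI[of _ "2 * C"] conjI exI[of _ \<delta>]) auto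
qed

lemma vfield_lipschitz:
  fixes Z :: "real vfield"
  assumes "expansion_at (fst \<circ> Z) p a" "expansion_at (snd \<circ> Z) p b" "n \<ge> 1"
    and zero: "\<And>i j. 0 < i + j \<Longrightarrow> i + j < n \<Longrightarrow> a i j = 0 \<and> b i j = 0"
  shows "\<exists>C>0. \<exists>\<delta>>0. \<forall>\<rho> w w'. \<rho> \<le> \<delta> \<longrightarrow> norm w \<le> \<rho> \<longrightarrow> norm w' \<le> \<rho> \<longrightarrow>
     norm (Z (p + w) - Z (p + w')) \<le> C * \<rho> ^ (n - 1) * norm (w - w')"
proof -
  have z: "a i j = 0" "b i j = 0" if "0 < i + j" "i + j < n" for i j using zero[OF that] by auto
  obtain C1 \<delta>1 where 1: "C1 > 0" "\<delta>1 > 0" "\<And>\<rho> w w'. \<rho> \<le> \<delta>1 \<Longrightarrow> norm w \<le> \<rho> \<Longrightarrow> norm w' \<le> \<rho> \<Longrightarrow>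
     \<bar>(fst \<circ> Z) (p + w) - (fst \<circ> Z) (p + w')\<bar> \<le> C1 * \<rho> ^ (n - 1) * norm (w - w')"
    using expansion_lipschitz_norm[OF assms(1,3) z(1)] by blast
  obtain C2 \<delta>2 where 2: "C2 > 0" "\<delta>2 > 0" "\<And>\<rho> w w'. \<rho> \<le> \<delta>2 \<Longrightarrow> norm w \<le> \<rho> \<Longrightarrow> norm w' \<le> \<rho> \<Longrightarrow>
     \<bar>(snd \<circ> Z) (p + w) - (snd \<circ> Z) (p + w')\<bar> \<le> C2 * \<rho> ^ (n - 1) * norm (w - w')"
    using expansion_lipschitz_norm[OF assms(2,3) z(2)] by blast
  have "norm (Z (p + w) - Z (p + w')) \<le> (C1 + C2) * \<rho> ^ (n - 1) * norm (w - w')"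
    if w: "\<rho> \<le> min \<delta>1 \<delta>2" "norm w \<le> \<rho>" "norm w' \<le> \<rho>" for \<rho> w w'
  proof -
    have "norm (Z (p + w) - Z (p + w')) \<le> norm (fst (Z (p + w) - Z (p + w'))) + norm (snd (Z (p + w) - Z (p + w')))"
      using norm_Pair_le[of "fst (Z (p + w) - Z (p + w'))" "snd (Z (p + w) - Z (p + w'))"]
      by (simp only: prod.collapse)
    also have "\<dots> \<le> C1 * \<rho> ^ (n - 1) * norm (w - w') + C2 * \<rho> ^ (n - 1) * norm (w - w')"
      using 1(3)[of \<rho> w w'] 2(3)[of \<rho> w w'] w by (intro add_mono) auto
    finally show ?thesis by (simp add: algebra_simps)
  qed
  then show ?thesis using 1 2 by (intro exI[of _ "C1 + C2"] conjI exI[of _ "min \<delta>1 \<delta>2"]) auto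
qed

lemma analytic_loc_lip:
  fixes Z :: "real vfield"
  assumes U: "open U" and Z: "\<And>p. p \<in> U \<Longrightarrow> vfield_analytic_at Z p"
  shows "loc_lip Z U"
  unfolding loc_lip_def
proof
  fix p assume p: "p \<in> U"
  obtain a b where ab: "expansion_at (fst \<circ> Z) p a" "expansion_at (snd \<circ> Z) p b"
    using Z[OF p] unfolding vfield_analytic_at_def analytic2_at_def by blast
  have "\<exists>C>0. \<exists>\<delta>>0. \<forall>\<rho> w w'. \<rho> \<le> \<delta> \<longrightarrow> norm w \<le> \<rho> \<longrightarrow> norm w' \<le> \<rho> \<longrightarrow>
     norm (Z (p + w) - Z (p + w')) \<le> C * \<rho> ^ (1 - 1) * norm (w - w')"
    by (rule vfield_lipschitz[OF ab]) auto
  then obtain C \<delta> where C: "C > 0" "\<delta> > 0" "\<And>\<rho> w w'. \<rho> \<le> \<delta> \<Longrightarrow> norm w \<le> \<rho> \<Longrightarrow> norm w' \<le> \<rho> \<Longrightarrow>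
     norm (Z (p + w) - Z (p + w')) \<le> C * norm (w - w')"
    by auto
  obtain e where e: "e > 0" "cball p e \<subseteq> U" using U p open_contains_cball by blast
  have "norm (Z x - Z y) \<le> C * norm (x - y)" if "x \<in> cball p (min e \<delta>)" "y \<in> cball p (min e \<delta>)" for x y
    using C(3)[of \<delta> "x - p" "y - p"] that by (simp add: dist_norm norm_minus_commute)
  moreover have "cball p (min e \<delta>) \<subseteq> U" using e(2) by auto
  ultimately show "\<exists>\<rho>>0. \<exists>L\<ge>0. cball p \<rho> \<subseteq> U \<and>
      (\<forall>x\<in>cball p \<rho>. \<forall>y\<in>cball p \<rho>. norm (Z x - Z y) \<le> L * norm (x - y))"
    using C(1,2) e(1) by (intro exI[of _ "min e \<delta>"] conjI exI[of _ C] ballI) auto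
qed

definition binary_form :: "(nat \<Rightarrow> real) \<Rightarrow> nat \<Rightarrow> real \<times> real \<Rightarrow> real" where
  "binary_form c d w = (\<Sum>k\<le>d. c k * fst w ^ (d - k) * snd w ^ k)"

lemma binary_form_scaleR: "binary_form c d (r *\<^sub>R w) = r ^ d * binary_form c d w"
  unfolding binary_form_def sum_distrib_left
proof (rule sum.cong)
  fix k assume "k \<in> {..d}"
  then have "r ^ d = r ^ (d - k) * r ^ k" by (simp flip: power_add)
  then show "c k * fst (r *\<^sub>R w) ^ (d - k) * snd (r *\<^sub>R w) ^ k = r ^ d * (c k * fst w ^ (d - k) * snd w ^ k)"
    by (simp add: power_mult_distrib mult_ac)
qed simp

lemma continuous_on_binary_form [continuous_intros]:
  "continuous_on S f \<Longrightarrow> continuous_on S (\<lambda>x. binary_form c d (f x))"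
  unfolding binary_form_def by (intro continuous_intros)

text \<open>The angular velocity of \<open>Z\<close> is governed by the form of degree \<open>n + 1\<close> on the circle of
  directions, up to an error of one order more.\<close>

lemma tangency_leading_form:
  fixes Z :: "real vfield"
  assumes a: "expansion_at (fst \<circ> Z) 0 a" and b: "expansion_at (snd \<circ> Z) 0 b"
    and low: "\<And>i j. i + j < n \<Longrightarrow> a i j = 0 \<and> b i j = 0"
  shows "\<exists>C>0. \<exists>\<delta>>0. \<forall>w. norm w \<le> \<delta> \<longrightarrow>
    \<bar>cross w (Z w) - binary_form (\<lambda>k. tangency_coeff a b (Suc n - k) k) (Suc n) w\<bar> \<le> C * norm w ^ Suc (Suc n)"
proof -
  define t where "t = tangency_coeff a b"
  have T: "expansion_at (\<lambda>(x, y). x * (snd \<circ> Z) (x, y) - y * (fst \<circ> Z) (x, y)) 0 t"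
    unfolding t_def by (rule expansion_tangency[OF a b])
  have tlow: "t i j = 0" if "i + j \<le> n" for i j
    using that low[of "i - 1" j] low[of i "j - 1"] by (auto simp: t_def tangency_coeff_def)
  have sum: "(\<Sum>(i, j)\<in>{(i, j). i + j < Suc (Suc n)}. t i j * x ^ i * y ^ j)
      = binary_form (\<lambda>k. t (Suc n - k) k) (Suc n) (x, y)" for x y
  proof -
    have fin: "finite {(i, j). i + j < Suc (Suc n)}"
      by (rule finite_subset[of _ "{..Suc n} \<times> {..Suc n}"]) auto
    have "(\<Sum>(i, j)\<in>{(i, j). i + j < Suc (Suc n)}. t i j * x ^ i * y ^ j)
        = (\<Sum>(i, j)\<in>(\<lambda>k. (Suc n - k, k)) ` {..Suc n}. t i j * x ^ i * y ^ j)"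
    proof (rule sum.mono_neutral_right[OF fin], force, intro ballI)
      fix q assume q: "q \<in> {(i, j). i + j < Suc (Suc n)} - (\<lambda>k. (Suc n - k, k)) ` {..Suc n}"
      obtain i j where ij: "q = (i, j)" by (cases q)
      have "i + j \<noteq> Suc n"
      proof
        assume "i + j = Suc n"
        then have "q = (\<lambda>k. (Suc n - k, k)) j" "j \<in> {..Suc n}" using ij by auto
        then show False using q by blast
      qed
      then show "(case q of (i, j) \<Rightarrow> t i j * x ^ i * y ^ j) = 0" using tlow[of i j] q ij by auto
    qed
    also have "\<dots> = binary_form (\<lambda>k. t (Suc n - k) k) (Suc n) (x, y)"
      by (subst sum.reindex) (auto simp: inj_on_def binary_form_def)
    finally show ?thesis .
  qed
  let ?g = "\<lambda>w. cross w (Z w) - binary_form (\<lambda>k. t (Suc n - k) k) (Suc n) w"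
  have "expansion_at ?g 0 (\<lambda>i j. if i + j < Suc (Suc n) then 0 else t i j)"
    using expansion_tail[OF T, of "Suc (Suc n)"] unfolding sum
    by (simp add: cross_def case_prod_unfold)
  then have "\<exists>C>0. \<exists>\<delta>>0. \<forall>\<rho> w w'. \<rho> \<le> \<delta> \<longrightarrow> norm w \<le> \<rho> \<longrightarrow> norm w' \<le> \<rho> \<longrightarrow>
     \<bar>?g (0 + w) - ?g (0 + w')\<bar> \<le> C * \<rho> ^ (Suc (Suc n) - 1) * norm (w - w')"
    by (rule expansion_lipschitz_norm) auto
  then obtain C \<delta> where C: "C > 0" "\<delta> > 0" "\<And>\<rho> w w'. \<rho> \<le> \<delta> \<Longrightarrow> norm w \<le> \<rho> \<Longrightarrow> norm w' \<le> \<rho> \<Longrightarrow>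
     \<bar>?g (0 + w) - ?g (0 + w')\<bar> \<le> C * \<rho> ^ (Suc (Suc n) - 1) * norm (w - w')"
    by blast
  have "?g 0 = 0" using binary_form_scaleR[of "\<lambda>k. t (Suc n - k) k" "Suc n" 0 0] by (simp add: cross_def)
  then have "\<bar>?g w\<bar> \<le> C * norm w ^ Suc (Suc n)" if "norm w \<le> \<delta>" for w
    using C(3)[of "norm w" w 0] that by (simp add: mult_ac)
  then show ?thesis using C(1,2) unfolding t_def by blast
qed

text \<open>Orientation is known only at single points and for short times. The last time at which the
  function is at least \<open>m a\<close> cannot come before \<open>b\<close>.\<close>

lemma right_increasing_imp_le:
  fixes m :: "real \<Rightarrow> real"
  assumes "a \<le> b" "continuous_on {a..b} m" "\<And>t. a \<le> t \<Longrightarrow> t < b \<Longrightarrow> \<forall>\<^sub>F s in at_right t. m s > m t"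
  shows "m a \<le> m b"
proof -
  define S where "S = {t \<in> {a..b}. m a \<le> m t}"
  have "closed S" unfolding S_def using continuous_on_closed_Collect_le[OF continuous_on_const assms(2)] by simp
  moreover have "bounded S" by (rule bounded_subset[of "{a..b}"]) (auto simp: S_def)
  ultimately have "compact S" by (simp add: compact_eq_bounded_closed)
  moreover have "a \<in> S" using assms(1) by (simp add: S_def)
  ultimately obtain t where t: "t \<in> S" "\<And>s. s \<in> S \<Longrightarrow> s \<le> t"
    using compact_attains_sup[of S] by auto
  have "t = b"
  proof (rule ccontr)
    assume "t \<noteq> b"
    then have tb: "a \<le> t" "t < b" using t(1) by (auto simp: S_def)
    from assms(3)[OF this] obtain c where c: "c > t" "\<And>s. t < s \<Longrightarrow> s < c \<Longrightarrow> m s > m t"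
      unfolding eventually_at_right_field by blast
    define s where "s = min ((t + c) / 2) b"
    have "t < s" "s < c" "s \<le> b" using c tb by (auto simp: s_def min_def)
    then have "s \<in> S" using c(2)[of s] t(1) tb by (auto simp: S_def)
    with t(2) \<open>t < s\<close> show False by fastforce
  qed
  then show ?thesis using t(1) by (simp add: S_def)
qed

lemma norm_sgn_diff_le:
  fixes w x :: "'a::real_normed_vector"
  assumes "norm x = 1" "w \<noteq> 0"
  shows "norm (sgn w - x) \<le> 2 * norm (w - x)"
proof -
  have "sgn w - w = (inverse (norm w) - 1) *\<^sub>R w" by (simp add: sgn_div_norm algebra_simps)
  then have "norm (sgn w - w) = \<bar>inverse (norm w) - 1\<bar> * norm w" by simp
  also have "\<dots> = \<bar>(inverse (norm w) - 1) * norm w\<bar>" by (simp add: abs_mult)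
  also have "(inverse (norm w) - 1) * norm w = norm x - norm w" using assms by (simp add: algebra_simps)
  also have "\<bar>\<dots>\<bar> \<le> norm (x - w)" by (rule norm_triangle_ineq3)
  finally show ?thesis using norm_triangle_ineq[of "sgn w - w" "w - x"] by (simp add: norm_minus_commute)
qed

text \<open>The rescaled fields \<open>w \<mapsto> r ^ (- \<nu>) Z (r w)\<close> have a common Lipschitz constant near \<open>x0\<close>. So they
  have solutions through \<open>x0\<close> on a common time interval, and the angular velocity of these
  solutions is close to the value \<open>R x0\<close> of the form. Scaled back, they are orbits of \<open>Z\<close> at
  distance about \<open>r\<close> from the origin that sweep a sector independent of \<open>r\<close>.\<close>

lemma sector_solution:
  fixes Z :: "real vfield"
  assumes C: "C > 0" "\<delta> > 0" "\<nu> \<ge> 1" and Z0: "Z 0 = 0"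
    and lip: "\<And>\<rho> w w'. \<rho> \<le> \<delta> \<Longrightarrow> norm w \<le> \<rho> \<Longrightarrow> norm w' \<le> \<rho> \<Longrightarrow> norm (Z w - Z w') \<le> C * \<rho> ^ (\<nu> - 1) * norm (w - w')"
    and tang: "\<And>w. norm w \<le> \<delta> \<Longrightarrow> \<bar>cross w (Z w) - binary_form c (Suc \<nu>) w\<bar> \<le> C * norm w ^ Suc (Suc \<nu>)"
    and x0: "norm x0 = 1" "\<sigma> * binary_form c (Suc \<nu>) x0 > 0" and \<sigma>: "\<bar>\<sigma>\<bar> = 1" and \<kappa>: "\<kappa> > 0"
  shows "\<exists>\<tau>>0. \<exists>e>0. \<exists>r1>0. \<forall>r. 0 < r \<longrightarrow> r < r1 \<longrightarrow> (\<exists>w. w 0 = x0 \<and>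
     (\<forall>t\<in>{-\<tau><..<\<tau>}. w t \<in> cball x0 \<kappa> \<and> (w has_vector_derivative (1 / r ^ \<nu>) *\<^sub>R Z (r *\<^sub>R w t)) (at t)) \<and>
     (\<forall>t\<in>{0..<\<tau>}. e * t \<le> \<sigma> * cross x0 (w t)))"
proof -
  let ?R = "binary_form c (Suc \<nu>)"
  define \<eta> where "\<eta> = \<sigma> * ?R x0"
  have \<eta>: "\<eta> > 0" using x0 by (simp add: \<eta>_def)
  have "continuous_on UNIV ?R" by (intro continuous_intros)
  then have "isCont ?R x0" using continuous_on_eq_continuous_at[OF open_UNIV, of ?R] by blast
  then have "\<exists>\<kappa>1>0. \<forall>w. dist w x0 < \<kappa>1 \<longrightarrow> dist (?R w) (?R x0) < \<eta> / 4"
    unfolding continuous_at_eps_delta by (rule allE[of _ "\<eta> / 4"]) (use \<eta> in simp)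
  then obtain \<kappa>1 where \<kappa>1: "\<kappa>1 > 0" "\<And>w. dist w x0 < \<kappa>1 \<Longrightarrow> dist (?R w) (?R x0) < \<eta> / 4"
    by (elim exE conjE) (rule that, assumption, blast)
  define L where "L = C * 2 ^ (\<nu> - 1)"
  have L: "L > 0" using C by (simp add: L_def)
  \<comment> \<open>The angular velocity, seen from \<open>x0\<close> instead of the moving point, is changed by at most
    \<open>\<kappa>0\<close> times the speed bound \<open>2 L\<close>. Each of the three errors is at most a quarter of \<open>\<eta>\<close>.\<close>
  define \<kappa>0 where "\<kappa>0 = min (min \<kappa> (\<kappa>1 / 2)) (min 1 (\<eta> / (8 * L)))"
  have \<kappa>0: "\<kappa>0 > 0" "\<kappa>0 \<le> \<kappa>" "\<kappa>0 < \<kappa>1" "\<kappa>0 \<le> 1" "\<kappa>0 \<le> \<eta> / (8 * L)"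
    using \<kappa> \<kappa>1 \<eta> L by (auto simp: \<kappa>0_def)
  have \<kappa>L: "\<kappa>0 * (2 * L) \<le> \<eta> / 4"
  proof -
    have "\<kappa>0 * (2 * L) \<le> \<eta> / (8 * L) * (2 * L)" using \<kappa>0 L by (intro mult_right_mono) auto
    then show ?thesis using L by simp
  qed
  define r1 where "r1 = min (\<delta> / 2) (\<eta> / (4 * C * 2 ^ Suc (Suc \<nu>)))"
  have r1: "r1 > 0" using C \<eta> by (auto simp: r1_def)
  define \<tau> where "\<tau> = min (\<kappa>0 / (2 * L)) (1 / (6 * L))"
  have \<tau>: "\<tau> > 0" "(2 * L) * \<tau> \<le> \<kappa>0" "6 * \<tau> * L \<le> 1"
  proof -
    show "\<tau> > 0" using \<kappa>0 L by (auto simp: \<tau>_def)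
    have "(2 * L) * \<tau> \<le> (2 * L) * (\<kappa>0 / (2 * L))" using L by (intro mult_left_mono) (auto simp: \<tau>_def)
    then show "(2 * L) * \<tau> \<le> \<kappa>0" using L by simp
    have "(6 * L) * \<tau> \<le> (6 * L) * (1 / (6 * L))" using L by (intro mult_left_mono) (auto simp: \<tau>_def)
    then show "6 * \<tau> * L \<le> 1" using L by (simp add: mult_ac)
  qed
  have sol: "\<exists>w. w 0 = x0 \<and>
     (\<forall>t\<in>{-\<tau><..<\<tau>}. w t \<in> cball x0 \<kappa> \<and> (w has_vector_derivative (1 / r ^ \<nu>) *\<^sub>R Z (r *\<^sub>R w t)) (at t)) \<and>
     (\<forall>t\<in>{0..<\<tau>}. \<eta> / 4 * t \<le> \<sigma> * cross x0 (w t))" if r: "0 < r" "r < r1" for r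
  proof -
    define X where "X w = (1 / r ^ \<nu>) *\<^sub>R Z (r *\<^sub>R w)" for w
    have r\<delta>: "2 * r \<le> \<delta>" using r by (simp add: r1_def)
    have n2: "norm w \<le> 2" if "w \<in> cball x0 \<kappa>0" for w
      using that \<kappa>0 x0 norm_triangle_sub[of w x0] by (simp add: dist_norm norm_minus_commute)
    have X_lip: "norm (X w - X w') \<le> L * norm (w - w')" if "norm w \<le> 2" "norm w' \<le> 2" for w w'
    proof -
      have "norm (Z (r *\<^sub>R w) - Z (r *\<^sub>R w')) \<le> C * (2 * r) ^ (\<nu> - 1) * norm (r *\<^sub>R w - r *\<^sub>R w')"
        by (rule lip[OF r\<delta>]) (use that r in \<open>auto simp: mult.commute\<close>)
      also have "norm (r *\<^sub>R w - r *\<^sub>R w') = r * norm (w - w')"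
        using r by (simp flip: scaleR_diff_right)
      also have "C * (2 * r) ^ (\<nu> - 1) * (r * norm (w - w')) = L * (r ^ (\<nu> - 1) * r) * norm (w - w')"
        by (simp add: L_def power_mult_distrib mult_ac)
      also have "r ^ (\<nu> - 1) * r = r ^ \<nu>" using C(3) by (cases \<nu>) auto
      finally have "norm (Z (r *\<^sub>R w) - Z (r *\<^sub>R w')) / r ^ \<nu> \<le> L * norm (w - w')"
        using r by (simp add: pos_divide_le_eq mult_ac)
      moreover have "norm (X w - X w') = norm (Z (r *\<^sub>R w) - Z (r *\<^sub>R w')) / r ^ \<nu>"
        unfolding X_def using r by (simp flip: scaleR_diff_right)
      ultimately show ?thesis by simp
    qed
    have X_bound: "norm (X w) \<le> 2 * L" if "w \<in> cball x0 \<kappa>0" for w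
    proof -
      have "norm (X w) \<le> L * norm w" using X_lip[OF n2[OF that], of 0] Z0 by (simp add: X_def)
      also have "\<dots> \<le> L * 2" using L n2[OF that] by (intro mult_left_mono) auto
      finally show ?thesis by simp
    qed
    have "\<exists>w. w 0 = x0 \<and> (\<forall>t\<in>{-\<tau>..\<tau>}. w t \<in> cball x0 \<kappa>0 \<and> (w has_vector_derivative X (w t)) (at t within {-\<tau>..\<tau>}))"
      by (rule picard_existence[OF _ X_bound \<tau>(1) \<kappa>0(1) less_imp_le[OF L] _ \<tau>(3)])
         (use X_lip n2 \<tau>(2) in auto)
    then obtain w where w0: "w 0 = x0" and win: "\<And>t. t \<in> {-\<tau>..\<tau>} \<Longrightarrow> w t \<in> cball x0 \<kappa>0"
      and wd: "\<And>t. t \<in> {-\<tau>..\<tau>} \<Longrightarrow> (w has_vector_derivative X (w t)) (at t within {-\<tau>..\<tau>})" by blast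
    have wd': "(w has_vector_derivative X (w t)) (at t)" if t: "t \<in> {-\<tau><..<\<tau>}" for t
    proof -
      have "(w has_vector_derivative X (w t)) (at t within {-\<tau><..<\<tau>})"
        by (rule has_vector_derivative_within_subset[OF wd]) (use t in auto)
      then show ?thesis using t by (simp add: at_within_open[OF t])
    qed
    have speed: "\<eta> / 4 \<le> \<sigma> * cross x0 (X v)" if v: "v \<in> cball x0 \<kappa>0" for v
    proof -
      have "norm (r *\<^sub>R v) \<le> r * 2" using n2[OF v] r by (simp add: mult_left_mono)
      then have nr: "norm (r *\<^sub>R v) \<le> \<delta>" using r\<delta> by simp
      have "\<bar>cross (r *\<^sub>R v) (Z (r *\<^sub>R v)) - ?R (r *\<^sub>R v)\<bar> \<le> C * norm (r *\<^sub>R v) ^ Suc (Suc \<nu>)" by (rule tang[OF nr])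
      also have "\<dots> \<le> C * (r * 2) ^ Suc (Suc \<nu>)"
        using C \<open>norm (r *\<^sub>R v) \<le> r * 2\<close> by (intro mult_left_mono power_mono) auto
      also have "\<dots> = r ^ Suc \<nu> * (C * 2 ^ Suc (Suc \<nu>) * r)" by (simp add: power_mult_distrib)
      also have "cross (r *\<^sub>R v) (Z (r *\<^sub>R v)) - ?R (r *\<^sub>R v) = r ^ Suc \<nu> * (cross v (X v) - ?R v)"
        using r by (simp add: binary_form_scaleR cross_scaleR_left cross_scaleR_right X_def algebra_simps)
      finally have "\<bar>cross v (X v) - ?R v\<bar> \<le> C * 2 ^ Suc (Suc \<nu>) * r"
        using r by (simp add: abs_mult)
      also have "\<dots> \<le> C * 2 ^ Suc (Suc \<nu>) * (\<eta> / (4 * C * 2 ^ Suc (Suc \<nu>)))"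
        using r C by (intro mult_left_mono) (auto simp: r1_def)
      also have "\<dots> = \<eta> / 4" using C by simp
      finally have dev: "\<bar>cross v (X v) - ?R v\<bar> \<le> \<eta> / 4" .
      have close: "\<bar>?R v - ?R x0\<bar> < \<eta> / 4"
        using \<kappa>1(2)[of v] v \<kappa>0(3) by (simp add: dist_real_def dist_commute)
      have "\<bar>cross (x0 - v) (X v)\<bar> \<le> norm (x0 - v) * norm (X v)" by (rule abs_cross_le)
      also have "\<dots> \<le> \<kappa>0 * (2 * L)" using v X_bound[OF v] \<kappa>0 by (intro mult_mono) (auto simp: dist_norm)
      finally have err: "\<bar>cross (x0 - v) (X v)\<bar> \<le> \<eta> / 4" using \<kappa>L by simp
      have split: "cross x0 (X v) = cross v (X v) + cross (x0 - v) (X v)" by (simp add: cross_diff_left)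
      note bounds = abs_le_D1[OF dev] abs_le_D2[OF dev] abs_le_D1[OF less_imp_le[OF close]]
        abs_le_D2[OF less_imp_le[OF close]] abs_le_D1[OF err] abs_le_D2[OF err]
      consider "\<sigma> = 1" | "\<sigma> = -1" using \<sigma> by linarith
      then show ?thesis
      proof cases
        case 1
        then have "\<eta> = ?R x0" by (simp add: \<eta>_def)
        then show ?thesis using bounds unfolding 1 split mult_1 by linarith
      next
        case 2
        then have "\<eta> = - ?R x0" by (simp add: \<eta>_def)
        then show ?thesis using bounds unfolding 2 split mult_minus1 by linarith
      qed
    qed
    have "\<eta> / 4 * t \<le> \<sigma> * cross x0 (w t)" if t: "t \<in> {0..<\<tau>}" for t
    proof -
      have "\<sigma> * cross x0 (w 0) - \<eta> / 4 * 0 \<le> \<sigma> * cross x0 (w t) - \<eta> / 4 * t"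
      proof (rule DERIV_nonneg_imp_nondecreasing[of 0 t "\<lambda>t. \<sigma> * cross x0 (w t) - \<eta> / 4 * t"])
        fix s assume s: "0 \<le> s" "s \<le> t"
        then have s': "s \<in> {-\<tau><..<\<tau>}" using t \<tau>(1) by auto
        have "((\<lambda>t. \<sigma> * cross x0 (w t) - \<eta> / 4 * t) has_real_derivative \<sigma> * cross x0 (X (w s)) - \<eta> / 4) (at s)"
          by (auto intro!: derivative_eq_intros cross_has_derivative wd'[OF s'])
        moreover have "0 \<le> \<sigma> * cross x0 (X (w s)) - \<eta> / 4" using speed[OF win] s' by auto
        ultimately show "\<exists>y. ((\<lambda>t. \<sigma> * cross x0 (w t) - \<eta> / 4 * t) has_real_derivative y) (at s) \<and> 0 \<le> y" by blast
      qed (use t in auto)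
      then show ?thesis by (simp add: w0)
    qed
    moreover have "w t \<in> cball x0 \<kappa>" if "t \<in> {-\<tau><..<\<tau>}" for t
      using win[of t] that \<kappa>0(2) by auto
    ultimately show ?thesis using w0 wd' unfolding X_def by blast
  qed
  have "\<eta> / 4 > 0" using \<eta> by simp
  show ?thesis
    by (rule exI[of _ \<tau>], rule conjI[OF \<tau>(1)], rule exI[of _ "\<eta> / 4"], rule conjI[OF \<open>\<eta> / 4 > 0\<close>],
        rule exI[of _ r1], rule conjI[OF r1], intro allI impI, rule sol)
qed

text \<open>A solution of the rescaled equation becomes an integral curve of \<open>Z\<close> after the linear change of
  time with factor \<open>r ^ (\<nu> - 1)\<close>.\<close>

lemma transports_rescaled:
  assumes tr: "transports Z Z' U h \<epsilon> (r *\<^sub>R w t)" and r: "r > 0" and \<nu>: "\<nu> \<ge> (1::nat)"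
    and wd: "\<And>s. s \<in> {-\<tau><..<\<tau>} \<Longrightarrow> r *\<^sub>R w s \<in> U \<and> (w has_vector_derivative (1 / r ^ \<nu>) *\<^sub>R Z (r *\<^sub>R w s)) (at s)"
    and t: "t \<in> {-\<tau><..<\<tau>}" and u: "u \<bullet> Z' (h (r *\<^sub>R w t)) > 0"
  shows "\<forall>\<^sub>F s in at_right t. \<epsilon> * (u \<bullet> (h (r *\<^sub>R w s) - h (r *\<^sub>R w t))) > 0"
proof -
  define k where "k = r ^ (\<nu> - 1)"
  have k: "k > 0" "r * k = r ^ \<nu>" using r \<nu> by (simp add: k_def, cases \<nu>) (auto simp: k_def)
  define I where "I = {(-\<tau> - t) / k<..<(\<tau> - t) / k}"
  have I: "t + k * s \<in> {-\<tau><..<\<tau>}" if "s \<in> I" for s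
    using that k by (auto simp: I_def field_simps)
  have "integral_curve Z U (\<lambda>s. r *\<^sub>R w (t + k * s)) I"
    unfolding integral_curve_def
  proof (intro conjI ballI)
    fix s assume s: "s \<in> I"
    show "r *\<^sub>R w (t + k * s) \<in> U" using wd I[OF s] by blast
    have 1: "(w has_vector_derivative (1 / r ^ \<nu>) *\<^sub>R Z (r *\<^sub>R w (t + k * s))) (at (t + k * s))"
      using wd I[OF s] by blast
    have 2: "((\<lambda>s. t + k * s) has_vector_derivative k) (at s)"
      by (auto intro!: derivative_eq_intros)
    have "((\<lambda>s. w (t + k * s)) has_vector_derivative k *\<^sub>R ((1 / r ^ \<nu>) *\<^sub>R Z (r *\<^sub>R w (t + k * s)))) (at s)"
      using vector_diff_chain_at[OF 2 1] by (simp add: o_def)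
    then have "((\<lambda>s. r *\<^sub>R w (t + k * s)) has_vector_derivative
        r *\<^sub>R (k *\<^sub>R ((1 / r ^ \<nu>) *\<^sub>R Z (r *\<^sub>R w (t + k * s))))) (at s)"
      by (rule has_vector_derivative_scaleR[OF DERIV_const, simplified])
    then show "((\<lambda>s. r *\<^sub>R w (t + k * s)) has_vector_derivative Z (r *\<^sub>R w (t + k * s))) (at s)"
      using k r by simp
  qed (auto simp: I_def)
  moreover have "0 \<in> I" using t k by (auto simp: I_def divide_neg_pos)
  ultimately have "\<forall>\<^sub>F s in at_right 0. \<epsilon> * (u \<bullet> (h (r *\<^sub>R w (t + k * s)) - h (r *\<^sub>R w t))) > 0"
    using tr[unfolded transports_def, rule_format, of "\<lambda>s. r *\<^sub>R w (t + k * s)" I u] u by simp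
  then obtain b where b: "b > 0" "\<And>s. 0 < s \<Longrightarrow> s < b \<Longrightarrow> \<epsilon> * (u \<bullet> (h (r *\<^sub>R w (t + k * s)) - h (r *\<^sub>R w t))) > 0"
    unfolding eventually_at_right_field by blast
  have "\<epsilon> * (u \<bullet> (h (r *\<^sub>R w s) - h (r *\<^sub>R w t))) > 0" if "t < s" "s < t + k * b" for s
    using b(2)[of "(s - t) / k"] that k(1) by (simp add: field_simps)
  moreover have "t < t + k * b" using k b by simp
  ultimately show ?thesis unfolding eventually_at_right_field by blast
qed

text \<open>In the orthonormal frame given by \<open>y0\<close>, the cross product compares the slopes
  \<open>cross y0 a / (y0 \<bullet> a)\<close> and \<open>cross y0 b / (y0 \<bullet> b)\<close>.\<close>

lemma cross_via_frame:
  assumes "norm y0 = 1"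
  shows "cross a b = (y0 \<bullet> a) * cross y0 b - (y0 \<bullet> b) * cross y0 a"
proof -
  have "(fst y0)\<^sup>2 + (snd y0)\<^sup>2 = 1" using assms by (cases y0) (simp add: norm_Pair)
  then have "cross a b = ((fst y0)\<^sup>2 + (snd y0)\<^sup>2) * cross a b" by simp
  then show ?thesis by (simp add: cross_def inner_prod_def power2_eq_square algebra_simps)
qed

lemma sector_direction:
  fixes Z :: "real vfield"
  assumes C: "C > 0" "\<delta> > 0"
    and tang: "\<And>w. norm w \<le> \<delta> \<Longrightarrow> \<bar>cross w (Z w) - binary_form c d w\<bar> \<le> C * norm w ^ Suc d"
    and y0: "norm y0 = 1" "\<sigma> * binary_form c d y0 > 0" and \<sigma>: "\<bar>\<sigma>\<bar> = 1"
  shows "\<exists>\<kappa>>0. \<exists>r>0. \<forall>y. y \<noteq> 0 \<longrightarrow> norm y < r \<longrightarrow> norm (sgn y - y0) < \<kappa> \<longrightarrow>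
    \<sigma> * cross y (Z y) > 0 \<and> y0 \<bullet> y > 0"
proof -
  let ?R = "binary_form c d"
  define \<eta> where "\<eta> = \<sigma> * ?R y0"
  have \<eta>: "\<eta> > 0" using y0 by (simp add: \<eta>_def)
  have "continuous_on UNIV ?R" by (intro continuous_intros)
  then have "isCont ?R y0" using continuous_on_eq_continuous_at[OF open_UNIV, of ?R] by blast
  then have "\<exists>\<kappa>>0. \<forall>w. dist w y0 < \<kappa> \<longrightarrow> dist (?R w) (?R y0) < \<eta> / 2"
    unfolding continuous_at_eps_delta by (rule allE[of _ "\<eta> / 2"]) (use \<eta> in simp)
  then obtain \<kappa>1 where \<kappa>1: "\<kappa>1 > 0" "\<And>w. dist w y0 < \<kappa>1 \<Longrightarrow> dist (?R w) (?R y0) < \<eta> / 2"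
    by (elim exE conjE) (rule that, assumption, blast)
  define r where "r = min \<delta> (\<eta> / (2 * C))"
  have r: "r > 0" using C \<eta> by (auto simp: r_def)
  have "\<sigma> * cross y (Z y) > 0 \<and> y0 \<bullet> y > 0"
    if y: "y \<noteq> 0" "norm y < r" "norm (sgn y - y0) < min \<kappa>1 1" for y
  proof
    have ny: "norm y > 0" using y by simp
    have ys: "y = norm y *\<^sub>R sgn y" using y(1) by (simp add: sgn_div_norm)
    have "\<bar>?R (sgn y) - ?R y0\<bar> < \<eta> / 2" using \<kappa>1(2)[of "sgn y"] y(3) by (simp add: dist_norm)
    then have "\<bar>\<sigma> * ?R (sgn y) - \<sigma> * ?R y0\<bar> < \<eta> / 2"
      using \<sigma> by (metis abs_mult mult_1 right_diff_distrib)
    then have "\<sigma> * ?R (sgn y) > \<eta> / 2" unfolding \<eta>_def by linarith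
    then have "norm y ^ d * (\<eta> / 2) < norm y ^ d * (\<sigma> * ?R (sgn y))" using ny by (intro mult_strict_left_mono) auto
    also have "\<dots> = \<sigma> * ?R y" by (subst (3) ys) (simp add: binary_form_scaleR)
    finally have 1: "norm y ^ d * (\<eta> / 2) < \<sigma> * ?R y" .
    have "C * norm y < \<eta> / 2" using y(2) C by (simp add: r_def field_simps)
    then have "norm y ^ d * (C * norm y) \<le> norm y ^ d * (\<eta> / 2)" using ny by (intro mult_left_mono) auto
    moreover have "\<bar>cross y (Z y) - ?R y\<bar> \<le> C * norm y ^ Suc d" by (rule tang) (use y(2) in \<open>simp add: r_def\<close>)
    ultimately have "\<bar>cross y (Z y) - ?R y\<bar> \<le> norm y ^ d * (\<eta> / 2)" by (simp add: mult_ac)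
    then have "\<bar>\<sigma> * cross y (Z y) - \<sigma> * ?R y\<bar> \<le> norm y ^ d * (\<eta> / 2)"
      using \<sigma> by (metis abs_mult mult_1 right_diff_distrib)
    with 1 show "\<sigma> * cross y (Z y) > 0" by linarith
    have "\<bar>y0 \<bullet> (sgn y - y0)\<bar> \<le> norm y0 * norm (sgn y - y0)" by (rule Cauchy_Schwarz_ineq2)
    also have "\<dots> < 1" using y(3) y0 by simp
    finally have "\<bar>y0 \<bullet> sgn y - 1\<bar> < 1"
      using y0 by (simp add: inner_diff_right power2_norm_eq_inner[symmetric])
    then have "y0 \<bullet> sgn y > 0" by linarith
    then have "norm y * (y0 \<bullet> sgn y) > 0" using ny by simp
    then show "y0 \<bullet> y > 0" by (subst ys) simp
  qed
  then show ?thesis using \<kappa>1(1) r by (intro exI[of _ "min \<kappa>1 1"] conjI exI[of _ r]) auto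
qed

text \<open>Take the orbit arcs of \<open>sector_solution\<close> for a sequence of radii \<open>r\<close> tending to \<open>0\<close>. Their images
  under \<open>h\<close> stay in a thin sector around \<open>\<phi> x0\<close>, in which \<open>Z'\<close> turns in the sense of \<open>\<sigma>'\<close>. As \<open>h\<close>
  transports orbits with sign \<open>\<epsilon>\<close>, the slope with respect to \<open>\<phi> x0\<close> is monotone along the images.
  In the limit, the end points of the arcs provide the direction \<open>v\<close>.\<close>

lemma boundary_direction:
  fixes Z Z' :: "real vfield"
  assumes C: "C > 0" "\<delta> > 0" "\<nu> \<ge> 1" and Z0: "Z 0 = 0"
    and lip: "\<And>\<rho> w w'. \<rho> \<le> \<delta> \<Longrightarrow> norm w \<le> \<rho> \<Longrightarrow> norm w' \<le> \<rho> \<Longrightarrow> norm (Z w - Z w') \<le> C * \<rho> ^ (\<nu> - 1) * norm (w - w')"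
    and tang: "\<And>w. norm w \<le> \<delta> \<Longrightarrow> \<bar>cross w (Z w) - binary_form c (Suc \<nu>) w\<bar> \<le> C * norm w ^ Suc (Suc \<nu>)"
    and C': "C' > 0" "\<delta>' > 0"
    and tang': "\<And>w. norm w \<le> \<delta>' \<Longrightarrow> \<bar>cross w (Z' w) - binary_form c' d' w\<bar> \<le> C' * norm w ^ Suc d'"
    and h: "continuous_on U h" "(h \<longlongrightarrow> 0) (at 0)"
    and D: "R0 > 0" "ball 0 R0 \<subseteq> U" "\<And>z. z \<noteq> 0 \<Longrightarrow> norm z < R0 \<Longrightarrow> h z \<noteq> 0"
    and tr: "\<And>z. z \<noteq> 0 \<Longrightarrow> norm z < R0 \<Longrightarrow> transports Z Z' U h \<epsilon> z"
    and lim: "\<And>v. norm v = 1 \<Longrightarrow> norm (\<phi> v) = 1"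
      "\<And>v \<kappa>'. norm v = 1 \<Longrightarrow> \<kappa>' > 0 \<Longrightarrow> \<exists>\<kappa>>0. \<exists>r>0. \<forall>z. z \<noteq> 0 \<longrightarrow> norm z < r \<longrightarrow>
         norm (sgn z - v) < \<kappa> \<longrightarrow> norm (sgn (h z) - \<phi> v) < \<kappa>'"
    and x0: "norm x0 = 1" "\<sigma> * binary_form c (Suc \<nu>) x0 > 0" "\<bar>\<sigma>\<bar> = 1"
      "\<sigma>' * binary_form c' d' (\<phi> x0) > 0" "\<bar>\<sigma>'\<bar> = 1" and \<kappa>: "\<kappa> > 0"
  shows "\<exists>v. norm v = 1 \<and> norm (v - x0) \<le> \<kappa> \<and> \<sigma> * cross x0 v > 0 \<and> \<epsilon> * (\<sigma>' * cross (\<phi> x0) (\<phi> v)) \<ge> 0"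
proof -
  define y0 where "y0 = \<phi> x0"
  have y0: "norm y0 = 1" using lim(1) x0 by (simp add: y0_def)
  obtain \<kappa>2 r2 where 2: "\<kappa>2 > 0" "r2 > 0" "\<And>y. y \<noteq> 0 \<Longrightarrow> norm y < r2 \<Longrightarrow> norm (sgn y - y0) < \<kappa>2 \<Longrightarrow>
    \<sigma>' * cross y (Z' y) > 0 \<and> y0 \<bullet> y > 0"
    using sector_direction[OF C' tang' y0] x0(4,5) unfolding y0_def by blast
  obtain \<kappa>3 r3 where 3: "\<kappa>3 > 0" "r3 > 0" "\<And>z. z \<noteq> 0 \<Longrightarrow> norm z < r3 \<Longrightarrow>
         norm (sgn z - x0) < \<kappa>3 \<Longrightarrow> norm (sgn (h z) - y0) < \<kappa>2"
    using lim(2)[OF x0(1) 2(1)] unfolding y0_def by blast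
  obtain r4 where 4: "r4 > 0" "\<And>z. z \<noteq> 0 \<Longrightarrow> norm z < r4 \<Longrightarrow> norm (h z) < r2"
    using tendstoD[OF h(2) 2(2)] unfolding eventually_at by (auto simp: dist_norm)
  define \<kappa>0 where "\<kappa>0 = min (\<kappa> / 2) (min (\<kappa>3 / 4) (1 / 2))"
  have \<kappa>0: "\<kappa>0 > 0" "2 * \<kappa>0 \<le> \<kappa>" "2 * \<kappa>0 < \<kappa>3" "\<kappa>0 < 1" using \<kappa> 3 by (auto simp: \<kappa>0_def)
  have near: "w \<noteq> 0" "norm (sgn w - x0) \<le> 2 * \<kappa>0" "norm w \<le> 2" if "w \<in> cball x0 \<kappa>0" for w
  proof -
    have w: "norm (w - x0) \<le> \<kappa>0" using that by (simp add: dist_norm norm_minus_commute)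
    then show "w \<noteq> 0" using x0(1) \<kappa>0 by auto
    then show "norm (sgn w - x0) \<le> 2 * \<kappa>0" using norm_sgn_diff_le[OF x0(1), of w] w by simp
    show "norm w \<le> 2" using w x0(1) \<kappa>0 norm_triangle_sub[of w x0] by simp
  qed
  obtain \<tau> e r1 where \<tau>: "\<tau> > 0" "e > 0" "r1 > 0"
    and sol: "\<And>r. 0 < r \<Longrightarrow> r < r1 \<Longrightarrow> \<exists>w. w 0 = x0 \<and>
     (\<forall>t\<in>{-\<tau><..<\<tau>}. w t \<in> cball x0 \<kappa>0 \<and> (w has_vector_derivative (1 / r ^ \<nu>) *\<^sub>R Z (r *\<^sub>R w t)) (at t)) \<and>
     (\<forall>t\<in>{0..<\<tau>}. e * t \<le> \<sigma> * cross x0 (w t))"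
    using sector_solution[OF C Z0 lip tang x0(1,2,3) \<kappa>0(1)] by blast
  define T where "T = \<tau> / 2"
  have T: "0 < T" "T < \<tau>" using \<tau> by (auto simp: T_def)
  define rr where "rr = min (min r1 R0) (min r3 r4) / 3"
  have rr: "rr > 0" using \<tau> D 3 4 by (auto simp: rr_def)
  have small: "norm (r *\<^sub>R w) < R0" "norm (r *\<^sub>R w) < r3" "norm (r *\<^sub>R w) < r4"
    if "0 < r" "r \<le> rr" "w \<in> cball x0 \<kappa>0" for r w
  proof -
    have "norm (r *\<^sub>R w) \<le> rr * 2" using that near(3)[OF that(3)] rr by (auto intro!: mult_mono)
    moreover have "rr * 2 < 3 * rr" using rr by simp
    moreover have "3 * rr \<le> R0" "3 * rr \<le> r3" "3 * rr \<le> r4" by (auto simp: rr_def)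
    ultimately show "norm (r *\<^sub>R w) < R0" "norm (r *\<^sub>R w) < r3" "norm (r *\<^sub>R w) < r4" by linarith+
  qed
  have step: "\<exists>z\<in>cball x0 \<kappa>0. e * T \<le> \<sigma> * cross x0 z \<and> \<epsilon> * (\<sigma>' * cross (h (r *\<^sub>R x0)) (h (r *\<^sub>R z))) \<ge> 0"
    if r: "0 < r" "r \<le> rr" for r
  proof -
    have "rr < r1" using \<tau> D 3 4 by (auto simp: rr_def min_def)
    then obtain w where w0: "w 0 = x0" and win: "\<And>t. t \<in> {-\<tau><..<\<tau>} \<Longrightarrow> w t \<in> cball x0 \<kappa>0"
      and wd: "\<And>t. t \<in> {-\<tau><..<\<tau>} \<Longrightarrow> (w has_vector_derivative (1 / r ^ \<nu>) *\<^sub>R Z (r *\<^sub>R w t)) (at t)"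
      and wc: "\<And>t. t \<in> {0..<\<tau>} \<Longrightarrow> e * t \<le> \<sigma> * cross x0 (w t)"
      using sol[of r] r by auto
    have inI: "t \<in> {-\<tau><..<\<tau>}" if "t \<in> {0..T}" for t using that T by auto
    define y where "y t = h (r *\<^sub>R w t)" for t
    have rw: "r *\<^sub>R w t \<noteq> 0" "norm (r *\<^sub>R w t) < R0" "r *\<^sub>R w t \<in> U" if "t \<in> {-\<tau><..<\<tau>}" for t
    proof -
      show "r *\<^sub>R w t \<noteq> 0" using near(1)[OF win[OF that]] r by simp
      show "norm (r *\<^sub>R w t) < R0" by (rule small(1)[OF r win[OF that]])
      then show "r *\<^sub>R w t \<in> U" using D(2) by auto
    qed
    have yp: "\<sigma>' * cross (y t) (Z' (y t)) > 0 \<and> y0 \<bullet> y t > 0" if t: "t \<in> {-\<tau><..<\<tau>}" for t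
    proof (rule 2(3))
      show "y t \<noteq> 0" unfolding y_def by (rule D(3)[OF rw(1,2)[OF t]])
      show "norm (y t) < r2" unfolding y_def by (rule 4(2)[OF rw(1)[OF t] small(3)[OF r win[OF t]]])
      have "sgn (r *\<^sub>R w t) = sgn (w t)" using r by (simp add: sgn_scaleR)
      then have "norm (sgn (r *\<^sub>R w t) - x0) < \<kappa>3" using near(2)[OF win[OF t]] \<kappa>0(3) by simp
      then show "norm (sgn (y t) - y0) < \<kappa>2" unfolding y_def by (rule 3(3)[OF rw(1)[OF t] small(2)[OF r win[OF t]]])
    qed
    have w_cont: "continuous_on {0..T} w"
      by (intro continuous_at_imp_continuous_on ballI has_vector_derivative_continuous[OF wd] inI)
    have y_cont: "continuous_on {0..T} y"
      unfolding y_def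
      by (rule continuous_on_compose2[OF h(1)]) (use rw(3) inI in \<open>auto intro!: continuous_intros w_cont\<close>)
    \<comment> \<open>The slope of the image point with respect to \<open>y0\<close>, signed so that it has to increase.\<close>
    define m where "m t = \<epsilon> * \<sigma>' * (cross y0 (y t) / (y0 \<bullet> y t))" for t
    have cross_m: "\<epsilon> * (\<sigma>' * cross (y t) (y s)) = (y0 \<bullet> y t) * (y0 \<bullet> y s) * (m s - m t)"
      if "t \<in> {-\<tau><..<\<tau>}" "s \<in> {-\<tau><..<\<tau>}" for t s
    proof -
      have "y0 \<bullet> y t \<noteq> 0" "y0 \<bullet> y s \<noteq> 0" using yp[OF that(1)] yp[OF that(2)] by auto
      then have "(y0 \<bullet> y t) * (y0 \<bullet> y s) * (m s - m t)
          = \<epsilon> * (\<sigma>' * ((y0 \<bullet> y t) * cross y0 (y s) - (y0 \<bullet> y s) * cross y0 (y t)))"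
        unfolding m_def by (simp add: field_simps)
      then show ?thesis unfolding cross_via_frame[OF y0, of "y t" "y s"] by simp
    qed
    have "m 0 \<le> m T"
    proof (rule right_increasing_imp_le[of 0 T m])
      show "continuous_on {0..T} m" unfolding m_def[abs_def]
        by (intro continuous_on_mult continuous_on_const continuous_on_divide continuous_on_cross
            continuous_on_inner y_cont) (use yp inI in force)
      fix t assume t: "0 \<le> t" "t < T"
      then have tI: "t \<in> {-\<tau><..<\<tau>}" using T by auto
      \<comment> \<open>The functional measuring the rotation about the origin in the sense of \<open>\<sigma>'\<close>.\<close>
      let ?u = "\<sigma>' *\<^sub>R (- snd (y t), fst (y t))"
      have ui: "?u \<bullet> b = \<sigma>' * cross (y t) b" for b by (simp only: inner_scaleR_left cross_eq_inner)
      have "\<forall>\<^sub>F s in at_right t. \<epsilon> * (?u \<bullet> (h (r *\<^sub>R w s) - h (r *\<^sub>R w t))) > 0"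
      proof (rule transports_rescaled[where w = w and t = t and \<tau> = \<tau>, OF tr[OF rw(1,2)[OF tI]] r(1) C(3) _ tI])
        show "?u \<bullet> Z' (h (r *\<^sub>R w t)) > 0" using yp[OF tI] unfolding ui y_def[symmetric] by blast
      qed (use rw(3) wd in auto)
      moreover have "\<forall>\<^sub>F s in at_right t. s \<in> {t<..<T}" using t by (intro eventually_at_right_real) auto
      ultimately show "\<forall>\<^sub>F s in at_right t. m t < m s"
      proof eventually_elim
        case (elim s)
        then have sI: "s \<in> {-\<tau><..<\<tau>}" using T tI by auto
        have "\<epsilon> * (\<sigma>' * cross (y t) (y s)) > 0"
          using elim(1) unfolding y_def[symmetric] inner_diff_right ui by simp
        then have "(y0 \<bullet> y t) * (y0 \<bullet> y s) * (m s - m t) > 0" using cross_m[OF tI sI] by simp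
        moreover have "(y0 \<bullet> y t) * (y0 \<bullet> y s) > 0" using yp[OF tI] yp[OF sI] by simp
        ultimately show ?case by (simp add: zero_less_mult_iff)
      qed
    qed (use T in auto)
    moreover have I2: "0 \<in> {-\<tau><..<\<tau>}" "T \<in> {-\<tau><..<\<tau>}" using T by auto
    moreover have "(y0 \<bullet> y 0) * (y0 \<bullet> y T) > 0" using yp I2 by simp
    ultimately have "\<epsilon> * (\<sigma>' * cross (y 0) (y T)) \<ge> 0"
      using cross_m[OF I2] by simp
    then have "\<epsilon> * (\<sigma>' * cross (h (r *\<^sub>R x0)) (h (r *\<^sub>R w T))) \<ge> 0" by (simp add: y_def w0)
    moreover have "e * T \<le> \<sigma> * cross x0 (w T)" using wc T by simp
    ultimately show ?thesis using win[OF I2(2)] by blast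
  qed
  define r where "r n = rr / real (Suc n)" for n
  have r: "0 < r n" "r n \<le> rr" for n using rr by (auto simp: r_def field_simps)
  have r_lim: "r \<longlonglongrightarrow> 0" unfolding r_def by (rule LIMSEQ_Suc[OF lim_const_over_n])
  obtain z where z: "\<And>n. z n \<in> cball x0 \<kappa>0" "\<And>n. e * T \<le> \<sigma> * cross x0 (z n)"
    "\<And>n. \<epsilon> * (\<sigma>' * cross (h (r n *\<^sub>R x0)) (h (r n *\<^sub>R z n))) \<ge> 0"
    using step[OF r] by metis
  obtain z' k where k: "z' \<in> cball x0 \<kappa>0" "strict_mono k" "(z \<circ> k) \<longlonglongrightarrow> z'"
    using compact_cball[of x0 \<kappa>0] z(1) unfolding compact_def by blast
  define v where "v = sgn z'"
  have v: "norm v = 1" "norm (v - x0) \<le> \<kappa>"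
    using near(1,2)[OF k(1)] \<kappa>0(2) by (auto simp: v_def norm_sgn)
  have dirlim: "(\<lambda>n. sgn (h (r (k n) *\<^sub>R q n))) \<longlonglongrightarrow> \<phi> (sgn q')"
    if q: "\<And>n. q n \<in> cball x0 \<kappa>0" "q \<longlonglongrightarrow> q'" "q' \<noteq> 0" for q q'
  proof (rule tendstoI)
    fix \<kappa>' :: real assume "\<kappa>' > 0"
    have "norm (sgn q') = 1" using q(3) by (simp add: norm_sgn)
    from lim(2)[OF this \<open>\<kappa>' > 0\<close>] obtain \<kappa>5 r5 where 5: "\<kappa>5 > 0" "r5 > 0"
      "\<And>z. z \<noteq> 0 \<Longrightarrow> norm z < r5 \<Longrightarrow> norm (sgn z - sgn q') < \<kappa>5 \<Longrightarrow> norm (sgn (h z) - \<phi> (sgn q')) < \<kappa>'" by blast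
    have "(\<lambda>n. sgn (q n)) \<longlonglongrightarrow> sgn q'" by (rule tendsto_sgn[OF q(2,3)])
    then have e1: "\<forall>\<^sub>F n in sequentially. dist (sgn (q n)) (sgn q') < \<kappa>5" using 5(1) by (rule tendstoD)
    have "(\<lambda>n. r (k n) *\<^sub>R q n) \<longlonglongrightarrow> 0 *\<^sub>R q'"
      using LIMSEQ_subseq_LIMSEQ[OF r_lim k(2)] q(2) by (intro tendsto_scaleR) (auto simp: o_def)
    then have e2: "\<forall>\<^sub>F n in sequentially. norm (r (k n) *\<^sub>R q n) < r5"
      using tendstoD[OF _ 5(2)] by fastforce
    from e1 e2 show "\<forall>\<^sub>F n in sequentially. dist (sgn (h (r (k n) *\<^sub>R q n))) (\<phi> (sgn q')) < \<kappa>'"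
    proof eventually_elim
      case (elim n)
      have "sgn (r (k n) *\<^sub>R q n) = sgn (q n)" using r(1)[of "k n"] by (simp add: sgn_scaleR)
      then show ?case
        using 5(3)[of "r (k n) *\<^sub>R q n"] elim near(1)[OF q(1)] r(1)[of "k n"] by (simp add: dist_norm)
    qed
  qed
  have "sgn x0 = x0" using x0(1) by (simp add: sgn_div_norm)
  have "x0 \<noteq> 0" using x0(1) by auto
  have "(\<lambda>n. sgn (h (r (k n) *\<^sub>R x0))) \<longlonglongrightarrow> \<phi> x0"
    using dirlim[of "\<lambda>_. x0" x0] \<kappa>0(1) \<open>x0 \<noteq> 0\<close> \<open>sgn x0 = x0\<close> by simp
  moreover have "(\<lambda>n. sgn (h (r (k n) *\<^sub>R z (k n)))) \<longlonglongrightarrow> \<phi> v"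
    using dirlim[of "z \<circ> k" z'] z(1) k(3) near(1)[OF k(1)] by (simp add: v_def o_def)
  ultimately have "(\<lambda>n. \<epsilon> * (\<sigma>' * cross (sgn (h (r (k n) *\<^sub>R x0))) (sgn (h (r (k n) *\<^sub>R z (k n))))))
      \<longlonglongrightarrow> \<epsilon> * (\<sigma>' * cross (\<phi> x0) (\<phi> v))"
    by (intro tendsto_intros)
  moreover have "\<epsilon> * (\<sigma>' * cross (sgn (h (r (k n) *\<^sub>R x0))) (sgn (h (r (k n) *\<^sub>R z (k n))))) \<ge> 0" for n
  proof -
    let ?a = "h (r (k n) *\<^sub>R x0)" and ?b = "h (r (k n) *\<^sub>R z (k n))"
    have eq: "\<epsilon> * (\<sigma>' * cross (sgn ?a) (sgn ?b)) = inverse (norm ?a) * inverse (norm ?b) * (\<epsilon> * (\<sigma>' * cross ?a ?b))"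
      by (simp add: sgn_div_norm cross_scaleR_left cross_scaleR_right)
    show ?thesis unfolding eq by (intro mult_nonneg_nonneg z(3)) auto
  qed
  ultimately have fin: "\<epsilon> * (\<sigma>' * cross (\<phi> x0) (\<phi> v)) \<ge> 0"
    by (intro LIMSEQ_le_const) auto
  have "(\<lambda>n. \<sigma> * cross x0 ((z \<circ> k) n)) \<longlonglongrightarrow> \<sigma> * cross x0 z'"
    by (intro tendsto_intros k(3))
  then have "e * T \<le> \<sigma> * cross x0 z'" by (rule LIMSEQ_le_const) (use z(2) in auto)
  then have pos: "\<sigma> * cross x0 z' > 0" using mult_pos_pos[OF \<tau>(2) T(1)] by linarith
  have eq: "\<sigma> * cross x0 v = inverse (norm z') * (\<sigma> * cross x0 z')"
    by (simp add: v_def sgn_div_norm cross_scaleR_right)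
  have "\<sigma> * cross x0 v > 0" unfolding eq by (intro mult_pos_pos pos) (use near(1)[OF k(1)] in simp)
  then show ?thesis using v fin by blast
qed

section \<open>Sign changes on the circle of directions\<close>

definition unit_vec :: "real \<Rightarrow> real \<times> real" where
  "unit_vec \<theta> = (cos \<theta>, sin \<theta>)"

lemma norm_unit_vec [simp]: "norm (unit_vec \<theta>) = 1"
  by (simp add: unit_vec_def norm_Pair)

lemma continuous_on_unit_vec [continuous_intros]:
  fixes f :: "'a::t2_space \<Rightarrow> real"
  shows "continuous_on S f \<Longrightarrow> continuous_on S (\<lambda>x. unit_vec (f x))"
  unfolding unit_vec_def by (intro continuous_on_Pair continuous_on_cos continuous_on_sin)

lemma cross_unit_vec: "cross (unit_vec a) (unit_vec b) = sin (b - a)"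
  by (simp add: cross_def unit_vec_def sin_diff mult.commute)

lemma unit_vec_eqD:
  assumes "unit_vec a = unit_vec b" "\<bar>a - b\<bar> < 2 * pi"
  shows "a = b"
proof -
  have "cos (a - b) = 1"
    using assms(1) by (simp add: unit_vec_def cos_diff power2_eq_square[symmetric])
  then obtain n :: int where n: "a - b = n * 2 * pi" unfolding cos_one_2pi_int by auto
  have "\<bar>real_of_int n\<bar> * (2 * pi) < 1 * (2 * pi)" using assms(2) n by (simp add: abs_mult)
  then have "\<bar>real_of_int n\<bar> < 1" using mult_less_cancel_right_pos[of "2 * pi"] by simp
  then have "n = 0" by linarith
  then show ?thesis using n by simp
qed

lemma unit_vec_antipode: "unit_vec (\<theta> + pi) = - unit_vec \<theta>"
  by (simp add: unit_vec_def)

lemma unit_vec_surj: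
  assumes "norm v = 1"
  obtains \<theta> where "a \<le> \<theta>" "\<theta> < a + 2 * pi" "v = unit_vec \<theta>"
proof -
  have "(fst v)\<^sup>2 + (snd v)\<^sup>2 = 1" using assms by (cases v) (simp add: norm_Pair)
  then obtain t where t: "fst v = cos t" "snd v = sin t" using sincos_total_2pi by blast
  define n where "n = \<lfloor>(t - a) / (2 * pi)\<rfloor>"
  define \<theta> where "\<theta> = t - 2 * pi * n"
  have "cos \<theta> = cos t" "sin \<theta> = sin t"
    unfolding \<theta>_def by (simp_all add: cos_diff sin_diff)
  then have "v = unit_vec \<theta>" using t by (simp add: unit_vec_def prod_eq_iff)
  moreover have "real_of_int n \<le> (t - a) / (2 * pi)" "(t - a) / (2 * pi) < real_of_int n + 1"
    unfolding n_def by linarith+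
  then have "2 * pi * n \<le> t - a" "t - a < 2 * pi * (n + 1)" by (simp_all add: field_simps)
  then have "a \<le> \<theta>" "\<theta> < a + 2 * pi" by (simp_all add: \<theta>_def algebra_simps)
  ultimately show ?thesis using that by blast
qed

text \<open>Values of both signs occur arbitrarily close to the point. In this form the notion is visibly
  invariant under homeomorphisms of the line, including the decreasing ones.\<close>

definition sign_changes :: "(real \<Rightarrow> real) \<Rightarrow> real set" where
  "sign_changes p = {\<theta>. \<forall>\<delta>>0. (\<exists>x. \<bar>x - \<theta>\<bar> < \<delta> \<and> p x > 0) \<and> (\<exists>x. \<bar>x - \<theta>\<bar> < \<delta> \<and> p x < 0)}"

lemma sign_changes_zero:
  assumes "continuous_on UNIV p" "\<theta> \<in> sign_changes p"
  shows "p \<theta> = 0"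
proof (rule ccontr)
  assume "p \<theta> \<noteq> 0"
  then have "\<bar>p \<theta>\<bar> > 0" by simp
  moreover have "isCont p \<theta>" using assms(1) by (simp add: continuous_on_eq_continuous_at)
  ultimately have "\<exists>\<delta>>0. \<forall>x. dist x \<theta> < \<delta> \<longrightarrow> dist (p x) (p \<theta>) < \<bar>p \<theta>\<bar>"
    unfolding continuous_at_eps_delta by blast
  then obtain \<delta> where \<delta>: "\<delta> > 0" "\<And>x. dist x \<theta> < \<delta> \<Longrightarrow> dist (p x) (p \<theta>) < \<bar>p \<theta>\<bar>" by blast
  obtain x y where "\<bar>x - \<theta>\<bar> < \<delta>" "p x > 0" "\<bar>y - \<theta>\<bar> < \<delta>" "p y < 0"
    using assms(2) \<delta>(1) unfolding sign_changes_def by blast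
  then show False using \<delta>(2)[of x] \<delta>(2)[of y] unfolding dist_real_def by linarith
qed

lemma constant_sign_between:
  fixes p :: "real \<Rightarrow> real"
  assumes "continuous_on {a..b} p" "\<And>x. a \<le> x \<Longrightarrow> x \<le> b \<Longrightarrow> p x \<noteq> 0" "a \<le> b"
  shows "p a * p b > 0"
proof (rule ccontr)
  assume "\<not> ?thesis"
  moreover have "p a \<noteq> 0" "p b \<noteq> 0" using assms by auto
  ultimately have "p a < 0 \<and> p b > 0 \<or> p a > 0 \<and> p b < 0"
    by (auto simp: zero_less_mult_iff not_less neq_iff)
  then have "\<exists>x\<ge>a. x \<le> b \<and> p x = 0"
    using IVT'[of p a 0 b] IVT2'[of p b 0 a] assms by force
  then show False using assms(2) by blast
qed

text \<open>Induction on the number of zeros, splitting off the largest one, \<open>z\<close>, at a point \<open>m\<close> between it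
  and the previous zero.\<close>

lemma odd_card_sign_changes_iff:
  assumes p: "continuous_on UNIV p"
  shows "a < b \<Longrightarrow> p a \<noteq> 0 \<Longrightarrow> p b \<noteq> 0 \<Longrightarrow> finite {x \<in> {a..b}. p x = 0} \<Longrightarrow>
    odd (card (sign_changes p \<inter> {a..b})) \<longleftrightarrow> p a * p b < 0"
proof (induction "card {x \<in> {a..b}. p x = 0}" arbitrary: b rule: less_induct)
  case less
  let ?N = "{x \<in> {a..b}. p x = 0}"
  have sub: "sign_changes p \<inter> {a..b} \<subseteq> ?N" using sign_changes_zero[OF p] by auto
  have pc: "continuous_on {c..d} p" for c d using p by (rule continuous_on_subset) simp
  show ?case
  proof (cases "?N = {}")
    case True
    then have "p a * p b > 0" using constant_sign_between[OF pc, of a b] less.prems(1) by auto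
    moreover have "sign_changes p \<inter> {a..b} = {}" using sub True by auto
    ultimately show ?thesis by simp
  next
    case False
    define z where "z = Max ?N"
    have zN: "z \<in> ?N" and zmax: "\<And>x. x \<in> ?N \<Longrightarrow> x \<le> z"
      using Max_in[OF less.prems(4) False] Max_ge[OF less.prems(4)] by (auto simp: z_def)
    have z: "a < z" "z < b" "p z = 0" using zN less.prems by (auto simp: order_less_le)
    have "\<exists>m. a < m \<and> m < z \<and> (\<forall>x. m \<le> x \<longrightarrow> x < z \<longrightarrow> p x \<noteq> 0)"
    proof -
      define m0 where "m0 = Max (insert a (?N - {z}))"
      have fin: "finite (insert a (?N - {z}))" using less.prems(4) by simp
      have "m0 \<in> insert a (?N - {z})" unfolding m0_def by (rule Max_in[OF fin]) simp
      then have m0: "a \<le> m0" "m0 < z" using z zmax by (auto simp: order_less_le)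
      have "p x \<noteq> 0" if x: "m0 < x" "x < z" for x
      proof
        assume "p x = 0"
        then have "x \<in> insert a (?N - {z})" using x m0 z by auto
        then have "x \<le> m0" unfolding m0_def by (rule Max_ge[OF fin])
        then show False using x by simp
      qed
      then show ?thesis using m0 by (intro exI[of _ "(m0 + z) / 2"]) auto
    qed
    then obtain m where m: "a < m" "m < z" "\<And>x. m \<le> x \<Longrightarrow> x < z \<Longrightarrow> p x \<noteq> 0" by blast
    have right: "p x \<noteq> 0" if "z < x" "x \<le> b" for x using zmax[of x] that m z by force
    have sgn_left: "p m * p x > 0" if "m \<le> x" "x < z" for x
      by (rule constant_sign_between[OF pc]) (use that m in auto)
    have sgn_right: "p x * p b > 0" if "z < x" "x \<le> b" for x
      by (rule constant_sign_between[OF pc]) (use that right in auto)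
    have "z \<notin> {x \<in> {a..m}. p x = 0}" using m by simp
    moreover have "{x \<in> {a..m}. p x = 0} \<subseteq> ?N" using z m by auto
    ultimately have N_m: "{x \<in> {a..m}. p x = 0} \<subset> ?N" using zN by blast
    then have card: "card {x \<in> {a..m}. p x = 0} < card ?N" by (rule psubset_card_mono[OF less.prems(4)])
    have "finite {x \<in> {a..m}. p x = 0}" using N_m less.prems(4) finite_subset by blast
    then have IH: "odd (card (sign_changes p \<inter> {a..m})) \<longleftrightarrow> p a * p m < 0"
      using less.hyps[OF card] m less.prems by simp
    have z_iff: "z \<in> sign_changes p \<longleftrightarrow> p m * p b < 0"
    proof
      assume "z \<in> sign_changes p"
      moreover have "min (z - m) (b - z) > 0" using m z by simp
      ultimately obtain x y where x: "\<bar>x - z\<bar> < min (z - m) (b - z)" "p x > 0"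
        and y: "\<bar>y - z\<bar> < min (z - m) (b - z)" "p y < 0"
        unfolding sign_changes_def by blast
      have xy: "x \<noteq> z" "y \<noteq> z" using x y z by auto
      have "m \<le> x" "x \<le> b" "m \<le> y" "y \<le> b" using x(1) y(1) by auto
      show "p m * p b < 0"
      proof (rule ccontr)
        assume "\<not> ?thesis"
        moreover have "p m \<noteq> 0" "p b \<noteq> 0" using m less.prems by auto
        ultimately have "p m * p b > 0" by (auto simp: not_less order_less_le)
        then show False
          using sgn_left[of x] sgn_right[of x] sgn_left[of y] sgn_right[of y] x(2) y(2) xy
            \<open>m \<le> x\<close> \<open>x \<le> b\<close> \<open>m \<le> y\<close> \<open>y \<le> b\<close>
          by (cases "x < z"; cases "y < z"; auto simp: zero_less_mult_iff)
      qed
    next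
      assume ch: "p m * p b < 0"
      show "z \<in> sign_changes p" unfolding sign_changes_def
      proof (intro CollectI allI impI)
        fix \<delta> :: real assume \<delta>: "\<delta> > 0"
        define x where "x = max m (z - \<delta> / 2)"
        define y where "y = min b (z + \<delta> / 2)"
        have x: "m \<le> x" "x < z" "\<bar>x - z\<bar> < \<delta>" using m \<delta> by (auto simp: x_def)
        have y: "z < y" "y \<le> b" "\<bar>y - z\<bar> < \<delta>" using z \<delta> by (auto simp: y_def)
        have "p m * p x > 0" "p y * p b > 0" using sgn_left x sgn_right y by auto
        then have "p x > 0 \<and> p y < 0 \<or> p x < 0 \<and> p y > 0"
          using ch by (auto simp: zero_less_mult_iff mult_less_0_iff)
        then show "(\<exists>x. \<bar>x - z\<bar> < \<delta> \<and> p x > 0) \<and> (\<exists>x. \<bar>x - z\<bar> < \<delta> \<and> p x < 0)" using x(3) y(3) by blast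
      qed
    qed
    have split: "sign_changes p \<inter> {a..b} = (sign_changes p \<inter> {a..m}) \<union> (sign_changes p \<inter> {z})"
    proof -
      have disj: "x \<le> m \<or> x = z" if "x \<in> sign_changes p" "a \<le> x" "x \<le> b" for x
        using sign_changes_zero[OF p that(1)] m(3)[of x] right[of x] that by fastforce
      show ?thesis using m z by (auto dest: disj)
    qed
    have fin: "finite (sign_changes p \<inter> {a..b})" using sub less.prems(4) finite_subset by blast
    have "card (sign_changes p \<inter> {a..b}) = card (sign_changes p \<inter> {a..m}) + card (sign_changes p \<inter> {z})"
      unfolding split
    proof (rule card_Un_disjoint)
      show "finite (sign_changes p \<inter> {a..m})" using fin unfolding split by simp
    qed (use m in auto)
    moreover have "card (sign_changes p \<inter> {z}) = (if z \<in> sign_changes p then 1 else 0)"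
      by auto
    ultimately have "odd (card (sign_changes p \<inter> {a..b})) \<longleftrightarrow> (p a * p m < 0) \<noteq> (p m * p b < 0)"
      using IH z_iff by auto
    moreover have "p m \<noteq> 0" using m by auto
    ultimately show ?thesis using less.prems(2,3) by (auto simp: mult_less_0_iff linorder_neq_iff)
  qed
qed

lemma sign_changes_shiftI:
  assumes "\<And>x. p (x + c) = s * p x" "s \<noteq> 0" "\<theta> \<in> sign_changes p"
  shows "\<theta> + c \<in> sign_changes p"
  unfolding sign_changes_def
proof (intro CollectI allI impI)
  fix \<delta> :: real assume "\<delta> > 0"
  then obtain x y where xy: "\<bar>x - \<theta>\<bar> < \<delta>" "p x > 0" "\<bar>y - \<theta>\<bar> < \<delta>" "p y < 0"
    using assms(3) unfolding sign_changes_def by blast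
  have near: "\<bar>(x + c) - (\<theta> + c)\<bar> < \<delta>" "\<bar>(y + c) - (\<theta> + c)\<bar> < \<delta>" using xy by auto
  show "(\<exists>x. \<bar>x - (\<theta> + c)\<bar> < \<delta> \<and> p x > 0) \<and> (\<exists>x. \<bar>x - (\<theta> + c)\<bar> < \<delta> \<and> p x < 0)"
  proof (cases "s > 0")
    case True
    then have "p (x + c) > 0" "p (y + c) < 0" using xy by (auto simp: assms(1) mult_pos_neg)
    then show ?thesis using near by blast
  next
    case False
    then have "s < 0" using assms(2) by simp
    then have "p (x + c) < 0" "p (y + c) > 0" using xy by (auto simp: assms(1) mult_neg_pos mult_neg_neg)
    then show ?thesis using near by blast
  qed
qed

lemma sign_changes_shift_iff:
  assumes "\<And>x. p (x + c) = s * p x" "s \<noteq> 0"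
  shows "\<theta> + c \<in> sign_changes p \<longleftrightarrow> \<theta> \<in> sign_changes p"
proof
  assume "\<theta> + c \<in> sign_changes p"
  moreover have "p (x + - c) = inverse s * p x" for x using assms(1)[of "x - c"] assms(2) by simp
  ultimately have "\<theta> + c + - c \<in> sign_changes p"
    using assms(2) by (intro sign_changes_shiftI[of p "- c" "inverse s"]) auto
  then show "\<theta> \<in> sign_changes p" by simp
qed (rule sign_changes_shiftI[where p = p and c = c and s = s, OF assms])

lemma sign_changes_unit_vec:
  assumes per: "\<And>x y. unit_vec x = unit_vec y \<Longrightarrow> p x = p y"
    and \<theta>: "\<theta> \<in> sign_changes p" "unit_vec \<theta> = unit_vec \<theta>'"
  shows "\<theta>' \<in> sign_changes p"
proof -
  define c where "c = \<theta>' - \<theta>"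
  have "cos c = 1"
    using \<theta>(2) by (simp add: c_def unit_vec_def cos_diff power2_eq_square[symmetric])
  moreover from this have "sin c = 0" using sin_cos_squared_add[of c] by simp
  ultimately have "unit_vec (x + c) = unit_vec x" for x
    by (simp add: unit_vec_def cos_add sin_add)
  then have "p (x + c) = 1 * p x" for x using per[of "x + c" x] by simp
  from sign_changes_shiftI[where p = p and c = c and s = 1, OF this _ \<theta>(1)]
  show ?thesis by (simp add: c_def)
qed

text \<open>Sign changes come in antipodal pairs. Hence their number is twice the number on a half circle,
  and the latter is odd if and only if the function has opposite signs at antipodal points.\<close>

lemma card_sign_changes_circle:
  assumes p: "continuous_on UNIV p" and per: "\<And>x y. unit_vec x = unit_vec y \<Longrightarrow> p x = p y"
    and anti: "\<And>x. p (x + pi) = (-1) ^ d * p x"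
    and a: "p a \<noteq> 0" and fin: "finite {x \<in> {a..a + pi}. p x = 0}"
  shows "\<exists>k. card (unit_vec ` sign_changes p) = 2 * k \<and> (odd k \<longleftrightarrow> odd d)"
proof -
  define S where "S = sign_changes p"
  define A where "A = S \<inter> {a..a + pi}"
  have pi_iff: "\<theta> + pi \<in> S \<longleftrightarrow> \<theta> \<in> S" for \<theta>
    unfolding S_def by (rule sign_changes_shift_iff[where p = p and c = pi and s = "(-1) ^ d", OF anti]) simp
  have "p (a + pi) \<noteq> 0" using a by (simp add: anti)
  then have ends: "a \<notin> S" "a + pi \<notin> S" using sign_changes_zero[OF p] a unfolding S_def by blast+
  have "finite A" using fin by (rule finite_subset[rotated]) (auto simp: A_def S_def sign_changes_zero[OF p])
  have S2: "S \<inter> {a..<a + 2 * pi} = A \<union> (\<lambda>x. x + pi) ` A"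
  proof (intro equalityI subsetI)
    fix x assume x: "x \<in> S \<inter> {a..<a + 2 * pi}"
    show "x \<in> A \<union> (\<lambda>x. x + pi) ` A"
    proof (cases "x \<le> a + pi")
      case True
      then show ?thesis using x by (auto simp: A_def)
    next
      case False
      then have "x - pi \<in> A" using x pi_iff[of "x - pi"] by (auto simp: A_def)
      then have "x - pi + pi \<in> (\<lambda>x. x + pi) ` A" by (rule imageI)
      then show ?thesis by simp
    qed
  next
    fix x assume "x \<in> A \<union> (\<lambda>x. x + pi) ` A"
    then show "x \<in> S \<inter> {a..<a + 2 * pi}"
    proof
      assume "x \<in> A"
      then have "x \<in> S" "a \<le> x" "x \<le> a + pi" by (auto simp: A_def)
      moreover from this have "x < a + 2 * pi" using pi_gt_zero by linarith
      ultimately show ?thesis by simp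
    next
      assume "x \<in> (\<lambda>x. x + pi) ` A"
      then obtain y where y: "x = y + pi" "y \<in> S" "a \<le> y" "y \<le> a + pi" by (auto simp: A_def)
      then have "y \<noteq> a + pi" using ends by auto
      then have "a \<le> x" "x < a + 2 * pi" using y pi_gt_zero by linarith+
      then show ?thesis using y pi_iff[of y] by auto
    qed
  qed
  have "A \<inter> (\<lambda>x. x + pi) ` A = {}"
  proof (rule ccontr)
    assume "A \<inter> (\<lambda>x. x + pi) ` A \<noteq> {}"
    then obtain y where y: "y \<in> A" "y + pi \<in> A" by auto
    then have "y = a" by (auto simp: A_def)
    then show False using y ends by (auto simp: A_def)
  qed
  then have "card (S \<inter> {a..<a + 2 * pi}) = card A + card ((\<lambda>x. x + pi) ` A)"
    unfolding S2 using \<open>finite A\<close> by (intro card_Un_disjoint) auto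
  also have "card ((\<lambda>x. x + pi) ` A) = card A" by (rule card_image) simp
  finally have c1: "card (S \<inter> {a..<a + 2 * pi}) = 2 * card A" by simp
  have img: "unit_vec ` S = unit_vec ` (S \<inter> {a..<a + 2 * pi})"
  proof
    show "unit_vec ` S \<subseteq> unit_vec ` (S \<inter> {a..<a + 2 * pi})"
    proof
      fix v assume "v \<in> unit_vec ` S"
      then obtain x where x: "x \<in> S" "v = unit_vec x" by blast
      obtain y where y: "a \<le> y" "y < a + 2 * pi" "v = unit_vec y"
        using unit_vec_surj[of v a] x(2) by auto
      have "y \<in> S" unfolding S_def
        by (rule sign_changes_unit_vec[OF per]) (use x y in \<open>auto simp: S_def\<close>)
      then show "v \<in> unit_vec ` (S \<inter> {a..<a + 2 * pi})" using y by auto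
    qed
  qed auto
  have "inj_on unit_vec (S \<inter> {a..<a + 2 * pi})"
    by (rule inj_onI) (auto intro!: unit_vec_eqD)
  then have "card (unit_vec ` S) = 2 * card A" unfolding img using c1 card_image by metis
  moreover have "odd (card A) \<longleftrightarrow> p a * p (a + pi) < 0"
    unfolding A_def S_def
    by (rule odd_card_sign_changes_iff[OF p]) (use a fin \<open>p (a + pi) \<noteq> 0\<close> pi_gt_zero in auto)
  moreover have "p a * p (a + pi) < 0 \<longleftrightarrow> odd d"
  proof -
    have "p a * p a > 0" using a not_real_square_gt_zero[of "p a"] by blast
    then show ?thesis by (cases "even d") (auto simp: anti not_less)
  qed
  ultimately show ?thesis unfolding S_def by blast
qed

text \<open>Where \<open>p\<close> is positive, \<open>q\<close> is nonnegative on a neighbourhood, hence positive at points arbitrarily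
  close.\<close>

lemma sign_changes_mono:
  assumes q: "continuous_on UNIV p" and pq: "\<And>x. p x * q x \<ge> (0::real)"
    and nz: "\<And>a b. a < b \<Longrightarrow> \<exists>x. a < x \<and> x < b \<and> q x \<noteq> 0"
  shows "sign_changes p \<subseteq> sign_changes q"
proof
  fix \<theta> assume \<theta>: "\<theta> \<in> sign_changes p"
  have move: "\<exists>y. \<bar>y - \<theta>\<bar> < \<delta> \<and> p x * p y > 0 \<and> q y \<noteq> 0" if x: "\<bar>x - \<theta>\<bar> < \<delta>" "p x \<noteq> 0" for x \<delta>
  proof -
    have "isCont p x" using q by (simp add: continuous_on_eq_continuous_at)
    moreover have "\<bar>p x\<bar> > 0" using x by simp
    ultimately have "\<exists>\<eta>>0. \<forall>y. dist y x < \<eta> \<longrightarrow> dist (p y) (p x) < \<bar>p x\<bar>"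
      unfolding continuous_at_eps_delta by blast
    then obtain \<eta> where \<eta>: "\<eta> > 0" "\<And>y. dist y x < \<eta> \<Longrightarrow> dist (p y) (p x) < \<bar>p x\<bar>" by blast
    define e where "e = min \<eta> (\<delta> - \<bar>x - \<theta>\<bar>)"
    have "e > 0" using \<eta>(1) x by (simp add: e_def)
    then have "x - e < x + e" by simp
    then obtain y where y: "x - e < y" "y < x + e" "q y \<noteq> 0" using nz by blast
    have "\<bar>y - x\<bar> < e" using y by linarith
    then have yx: "\<bar>y - x\<bar> < \<eta>" "\<bar>y - x\<bar> < \<delta> - \<bar>x - \<theta>\<bar>" by (auto simp: e_def)
    have "\<bar>p y - p x\<bar> < \<bar>p x\<bar>" using \<eta>(2)[of y] yx(1) by (simp add: dist_real_def)
    then have "p x * p y > 0" by (auto simp: zero_less_mult_iff abs_if split: if_splits)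
    moreover have "\<bar>y - \<theta>\<bar> < \<delta>" using yx(2) by linarith
    ultimately show ?thesis using y(3) by blast
  qed
  show "\<theta> \<in> sign_changes q" unfolding sign_changes_def
  proof (intro CollectI allI impI conjI)
    fix \<delta> :: real assume "\<delta> > 0"
    then obtain x y where xy: "\<bar>x - \<theta>\<bar> < \<delta>" "p x > 0" "\<bar>y - \<theta>\<bar> < \<delta>" "p y < 0"
      using \<theta> unfolding sign_changes_def by blast
    obtain x' where x': "\<bar>x' - \<theta>\<bar> < \<delta>" "p x * p x' > 0" "q x' \<noteq> 0" using move[OF xy(1)] xy(2) by auto
    then have "p x' > 0" using xy(2) by (simp add: zero_less_mult_iff)
    then have "q x' > 0" using pq[of x'] x'(3) by (auto simp: zero_le_mult_iff)
    then show "\<exists>x. \<bar>x - \<theta>\<bar> < \<delta> \<and> q x > 0" using x'(1) by blast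
    obtain y' where y': "\<bar>y' - \<theta>\<bar> < \<delta>" "p y * p y' > 0" "q y' \<noteq> 0" using move[OF xy(3)] xy(4) by auto
    then have "p y' < 0" using xy(4) by (simp add: zero_less_mult_iff)
    then have "q y' < 0" using pq[of y'] y'(3) by (auto simp: zero_le_mult_iff)
    then show "\<exists>x. \<bar>x - \<theta>\<bar> < \<delta> \<and> q x < 0" using y'(1) by blast
  qed
qed

text \<open>The condition on \<open>g\<close> says that it is strictly monotone, in the sense of \<open>s\<close>, on every interval
  shorter than a full turn; the intermediate value theorem then shows that it is open.\<close>

lemma increments_surj:
  fixes g :: "real \<Rightarrow> real"
  assumes g: "continuous_on UNIV g" and s: "s \<in> {1, -1}"
    and inc: "\<And>x y. x < y \<Longrightarrow> y < x + 2 * pi \<Longrightarrow> s * (g y - g x) > 0"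
    and \<delta>: "\<delta> > 0"
  shows "\<exists>\<eta>>0. \<forall>y. \<bar>y - g \<theta>\<bar> < \<eta> \<longrightarrow> (\<exists>x. \<bar>x - \<theta>\<bar> < \<delta> \<and> g x = y)"
proof -
  define e where "e = min (\<delta> / 2) pi"
  have e: "e > 0" "e < \<delta>" "e < 2 * pi" using \<delta> pi_gt_zero by (auto simp: e_def min_def)
  \<comment> \<open>The interval of radius \<open>\<eta>\<close> around \<open>g \<theta>\<close> lies between the values of \<open>g\<close> at \<open>\<theta> - e\<close> and \<open>\<theta> + e\<close>.\<close>
  define \<eta> where "\<eta> = min (s * (g (\<theta> + e) - g \<theta>)) (s * (g \<theta> - g (\<theta> - e)))"
  have "\<eta> > 0" using inc[of \<theta> "\<theta> + e"] inc[of "\<theta> - e" \<theta>] e by (simp add: \<eta>_def)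
  moreover have "\<exists>x. \<bar>x - \<theta>\<bar> < \<delta> \<and> g x = y" if y: "\<bar>y - g \<theta>\<bar> < \<eta>" for y
  proof -
    have "\<bar>s * y - s * g \<theta>\<bar> = \<bar>y - g \<theta>\<bar>" using s by auto
    then have "s * g (\<theta> - e) \<le> s * y" "s * y \<le> s * g (\<theta> + e)"
      using y by (auto simp: \<eta>_def right_diff_distrib)
    moreover have "continuous_on {\<theta> - e..\<theta> + e} (\<lambda>x. s * g x)"
      by (intro continuous_intros continuous_on_subset[OF g]) auto
    ultimately obtain x where x: "\<theta> - e \<le> x" "x \<le> \<theta> + e" "s * g x = s * y"
      using IVT'[of "\<lambda>x. s * g x" "\<theta> - e" "s * y" "\<theta> + e"] e by auto
    then have "g x = y" using s by auto
    moreover have "\<bar>x - \<theta>\<bar> < \<delta>" using x e by auto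
    ultimately show ?thesis by blast
  qed
  ultimately show ?thesis by blast
qed

lemma sign_changes_comp:
  fixes g :: "real \<Rightarrow> real"
  assumes g: "continuous_on UNIV g" and s: "s \<in> {1, -1}"
    and inc: "\<And>x y. x < y \<Longrightarrow> y < x + 2 * pi \<Longrightarrow> s * (g y - g x) > 0"
  shows "\<theta> \<in> sign_changes (\<lambda>x. q (g x)) \<longleftrightarrow> g \<theta> \<in> sign_changes q"
proof
  assume \<theta>: "\<theta> \<in> sign_changes (\<lambda>x. q (g x))"
  show "g \<theta> \<in> sign_changes q" unfolding sign_changes_def
  proof (intro CollectI allI impI)
    fix \<delta> :: real assume \<delta>: "\<delta> > 0"
    have "isCont g \<theta>" using g by (simp add: continuous_on_eq_continuous_at)
    then have "\<exists>\<eta>>0. \<forall>y. dist y \<theta> < \<eta> \<longrightarrow> dist (g y) (g \<theta>) < \<delta>"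
      using \<delta> unfolding continuous_at_eps_delta by blast
    then obtain \<eta> where \<eta>: "\<eta> > 0" "\<And>y. dist y \<theta> < \<eta> \<Longrightarrow> dist (g y) (g \<theta>) < \<delta>" by blast
    obtain x y where "\<bar>x - \<theta>\<bar> < \<eta>" "q (g x) > 0" "\<bar>y - \<theta>\<bar> < \<eta>" "q (g y) < 0"
      using \<theta> \<eta>(1) unfolding sign_changes_def by blast
    then show "(\<exists>x. \<bar>x - g \<theta>\<bar> < \<delta> \<and> q x > 0) \<and> (\<exists>x. \<bar>x - g \<theta>\<bar> < \<delta> \<and> q x < 0)"
      using \<eta>(2)[of x] \<eta>(2)[of y] by (auto simp: dist_real_def)
  qed
next
  assume \<theta>: "g \<theta> \<in> sign_changes q"
  show "\<theta> \<in> sign_changes (\<lambda>x. q (g x))" unfolding sign_changes_def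
  proof (intro CollectI allI impI)
    fix \<delta> :: real assume "\<delta> > 0"
    then obtain \<eta> where \<eta>: "\<eta> > 0" "\<And>y. \<bar>y - g \<theta>\<bar> < \<eta> \<Longrightarrow> \<exists>x. \<bar>x - \<theta>\<bar> < \<delta> \<and> g x = y"
      using increments_surj[OF g s inc] by blast
    obtain x y where "\<bar>x - g \<theta>\<bar> < \<eta>" "q x > 0" "\<bar>y - g \<theta>\<bar> < \<eta>" "q y < 0"
      using \<theta> \<eta>(1) unfolding sign_changes_def by blast
    then show "(\<exists>x. \<bar>x - \<theta>\<bar> < \<delta> \<and> q (g x) > 0) \<and> (\<exists>x. \<bar>x - \<theta>\<bar> < \<delta> \<and> q (g x) < 0)"
      using \<eta>(2)[of x] \<eta>(2)[of y] by blast
  qed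
qed

text \<open>Lift the circle map to the angle by means of a continuous logarithm. The increment \<open>g y - g x\<close>
  does not vanish on the connected set of pairs with \<open>x < y < x + 2 \<pi>\<close>, so that it has constant
  sign there.\<close>

lemma circle_map_lift:
  fixes \<phi> :: "real \<times> real \<Rightarrow> real \<times> real"
  assumes \<phi>: "continuous_on (sphere 0 1) \<phi>" "\<phi> ` sphere 0 1 \<subseteq> sphere 0 1" "inj_on \<phi> (sphere 0 1)"
  shows "\<exists>g s. continuous_on UNIV g \<and> (\<forall>\<theta>. \<phi> (unit_vec \<theta>) = unit_vec (g \<theta>)) \<and> s \<in> {1, -1} \<and>
    (\<forall>x y. x < y \<longrightarrow> y < x + 2 * pi \<longrightarrow> s * (g y - g x) > (0::real))"
proof -
  define f where "f \<theta> = Complex (fst (\<phi> (unit_vec \<theta>))) (snd (\<phi> (unit_vec \<theta>)))" for \<theta>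
  have fc: "continuous_on UNIV (\<lambda>\<theta>. \<phi> (unit_vec \<theta>))"
    by (rule continuous_on_compose2[OF \<phi>(1)]) (auto intro!: continuous_intros)
  have "continuous_on UNIV f"
    unfolding f_def Complex_eq by (intro continuous_intros continuous_on_fst continuous_on_snd fc)
  moreover have nf: "norm (f \<theta>) = 1" for \<theta>
  proof -
    have "norm (\<phi> (unit_vec \<theta>)) = 1" using \<phi>(2) by (auto simp: image_subset_iff)
    then show ?thesis by (simp add: f_def cmod_def norm_prod_def)
  qed
  moreover have "contractible (UNIV :: real set)" by (rule convex_imp_contractible) simp
  ultimately obtain l where l: "continuous_on UNIV l" "\<And>\<theta>. f \<theta> = exp (l \<theta>)"
    using continuous_logarithm_on_contractible[of UNIV f] by (metis UNIV_I norm_zero zero_neq_one)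
  define g where "g \<theta> = Im (l \<theta>)" for \<theta>
  have g: "continuous_on UNIV g" unfolding g_def by (intro continuous_intros l)
  have fg: "\<phi> (unit_vec \<theta>) = unit_vec (g \<theta>)" for \<theta>
  proof -
    have "exp (Re (l \<theta>)) = 1" using nf[of \<theta>] l(2)[of \<theta>] by simp
    then have "f \<theta> = cis (g \<theta>)" by (simp add: l(2) exp_eq_polar g_def)
    then have "fst (\<phi> (unit_vec \<theta>)) = cos (g \<theta>)" "snd (\<phi> (unit_vec \<theta>)) = sin (g \<theta>)"
      unfolding f_def by (simp_all add: complex_eq_iff)
    then show ?thesis by (simp add: unit_vec_def prod_eq_iff)
  qed
  define K where "K = {z :: real \<times> real. fst z < snd z \<and> snd z < fst z + 2 * pi}"
  have "convex K"
  proof (rule convexI)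
    fix z w :: "real \<times> real" and u v :: real
    assume zw: "z \<in> K" "w \<in> K" and uv: "0 \<le> u" "0 \<le> v" "u + v = 1"
    have "u * (fst z - snd z) + v * (fst w - snd w) < 0"
      by (rule convex_bound_lt) (use zw uv in \<open>auto simp: K_def\<close>)
    moreover have "u * (snd z - fst z) + v * (snd w - fst w) < 2 * pi"
      by (rule convex_bound_lt) (use zw uv in \<open>auto simp: K_def\<close>)
    ultimately show "u *\<^sub>R z + v *\<^sub>R w \<in> K" by (simp add: K_def algebra_simps)
  qed
  then have "connected K" by (rule convex_connected)
  have "\<exists>s\<in>{1, -1}. \<forall>z\<in>K. s * (g (snd z) - g (fst z)) > 0"
  proof (rule connected_nonzero_sign[OF \<open>connected K\<close>])
    show "continuous_on K (\<lambda>z. g (snd z) - g (fst z))"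
      by (intro continuous_intros continuous_on_compose2[OF g]) auto
    fix z assume "z \<in> K"
    then have z: "fst z \<noteq> snd z" "\<bar>fst z - snd z\<bar> < 2 * pi" by (auto simp: K_def)
    then have "unit_vec (fst z) \<noteq> unit_vec (snd z)" using unit_vec_eqD by blast
    then have "\<phi> (unit_vec (fst z)) \<noteq> \<phi> (unit_vec (snd z))" using inj_onD[OF \<phi>(3), of "unit_vec (fst z)" "unit_vec (snd z)"] by auto
    then show "g (snd z) - g (fst z) \<noteq> 0" by (auto simp: fg)
  qed
  then obtain s where "s \<in> {1, -1}" "\<And>z. z \<in> K \<Longrightarrow> s * (g (snd z) - g (fst z)) > 0" by blast
  then have "\<forall>x y. x < y \<longrightarrow> y < x + 2 * pi \<longrightarrow> s * (g y - g x) > 0"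
    by (auto simp: K_def)
  with g fg \<open>s \<in> {1, -1}\<close> show ?thesis by blast
qed

lemma sgn_sin: 
  fixes x :: real
  assumes "\<bar>x\<bar> < pi"
  shows "sgn (sin x) = sgn x"
proof (cases "x = 0")
  case False
  then show ?thesis
    using sin_gt_zero[of x] sin_gt_zero[of "- x"] assms by (cases "x > 0") (auto simp: abs_if)
qed simp

text \<open>The sense in which \<open>v\<close> deviates from \<open>x0\<close> is the sign of \<open>R\<close>, and the sense in which \<open>\<phi> v\<close> deviates
  from \<open>\<phi> x0\<close> is \<open>\<epsilon>\<close> times the sign of \<open>R'\<close>. The lift \<open>g\<close> relates the two senses by \<open>s\<close>.\<close>

lemma direction_signs_agree:
  assumes g: "continuous_on UNIV g" "\<And>\<theta>. \<phi> (unit_vec \<theta>) = unit_vec (g \<theta>)"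
    and s: "s \<in> {1, -1}" and \<epsilon>: "\<epsilon> \<in> {1, -1}"
    and inc: "\<And>x y. x < y \<Longrightarrow> y < x + 2 * pi \<Longrightarrow> s * (g y - g x) > (0::real)"
    and H: "\<And>x0 \<sigma> \<sigma>' \<kappa>. norm x0 = 1 \<Longrightarrow> \<sigma> * R x0 > 0 \<Longrightarrow> \<bar>\<sigma>\<bar> = 1 \<Longrightarrow> \<sigma>' * R' (\<phi> x0) > 0 \<Longrightarrow> \<bar>\<sigma>'\<bar> = 1 \<Longrightarrow> \<kappa> > 0 \<Longrightarrow>
      \<exists>v. norm v = 1 \<and> norm (v - x0) \<le> \<kappa> \<and> \<sigma> * cross x0 v > 0 \<and> \<epsilon> * (\<sigma>' * cross (\<phi> x0) (\<phi> v)) \<ge> (0::real)"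
  shows "\<epsilon> * s * (R (unit_vec \<theta>) * R' (unit_vec (g \<theta>))) \<ge> 0"
proof (cases "R (unit_vec \<theta>) = 0 \<or> R' (unit_vec (g \<theta>)) = 0")
  case False
  define \<sigma> where "\<sigma> = sgn (R (unit_vec \<theta>))"
  define \<sigma>' where "\<sigma>' = sgn (R' (unit_vec (g \<theta>)))"
  have \<sigma>: "\<sigma> * R (unit_vec \<theta>) > 0" "\<bar>\<sigma>\<bar> = 1" "\<sigma>' * R' (\<phi> (unit_vec \<theta>)) > 0" "\<bar>\<sigma>'\<bar> = 1"
    using False by (auto simp: \<sigma>_def \<sigma>'_def g(2) sgn_if)
  have "isCont g \<theta>" using g(1) by (simp add: continuous_on_eq_continuous_at)
  then have "\<exists>\<delta>>0. \<forall>y. dist y \<theta> < \<delta> \<longrightarrow> dist (g y) (g \<theta>) < pi"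
    using pi_gt_zero unfolding continuous_at_eps_delta by blast
  then obtain \<delta>0 where \<delta>0: "\<delta>0 > 0" "\<And>y. dist y \<theta> < \<delta>0 \<Longrightarrow> dist (g y) (g \<theta>) < pi" by blast
  define \<delta> where "\<delta> = min \<delta>0 (pi / 2)"
  have \<delta>: "\<delta> > 0" "\<delta> \<le> \<delta>0" "\<delta> < pi" using \<delta>0 pi_gt_zero by (auto simp: \<delta>_def min_def)
  have cd: "cos \<delta> < 1" using cos_monotone_0_pi[of 0 \<delta>] \<delta> by simp
  \<comment> \<open>Half of the chord spanned by the angle \<open>\<delta>\<close>.\<close>
  define \<kappa> where "\<kappa> = sqrt (2 - 2 * cos \<delta>) / 2"
  have \<kappa>: "\<kappa> > 0" using cd by (simp add: \<kappa>_def)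
  obtain v where v: "norm v = 1" "norm (v - unit_vec \<theta>) \<le> \<kappa>" "\<sigma> * cross (unit_vec \<theta>) v > 0"
    "\<epsilon> * (\<sigma>' * cross (\<phi> (unit_vec \<theta>)) (\<phi> v)) \<ge> 0"
    using H[OF norm_unit_vec \<sigma> \<kappa>] by blast
  obtain t where t: "\<theta> - pi \<le> t" "t < \<theta> - pi + 2 * pi" "v = unit_vec t"
    by (rule unit_vec_surj[OF v(1), of "\<theta> - pi"])
  define a where "a = t - \<theta>"
  have api: "\<bar>a\<bar> \<le> pi" using t by (auto simp: a_def)
  have "(norm (v - unit_vec \<theta>))\<^sup>2 = (cos t - cos \<theta>)\<^sup>2 + (sin t - sin \<theta>)\<^sup>2"
    by (simp add: t(3) unit_vec_def norm_Pair)
  also have "\<dots> = 2 - 2 * cos a"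
    using sin_cos_squared_add[of t] sin_cos_squared_add[of \<theta>]
    by (simp add: a_def cos_diff power2_eq_square algebra_simps)
  finally have "2 - 2 * cos a \<le> \<kappa>\<^sup>2" using power_mono[OF v(2), of 2] by simp
  also have "\<kappa>\<^sup>2 < 2 - 2 * cos \<delta>" using cd by (simp add: \<kappa>_def power_divide)
  finally have "cos \<delta> < cos \<bar>a\<bar>" by simp
  then have a\<delta>: "\<bar>a\<bar> < \<delta>" using cos_mono_less_eq[of \<delta> "\<bar>a\<bar>"] \<delta> api by simp
  define b where "b = g t - g \<theta>"
  have b: "\<bar>b\<bar> < pi" using \<delta>0(2)[of t] a\<delta> \<delta>(2) by (simp add: a_def b_def dist_real_def)
  have "\<sigma> * sin a > 0" using v(3) by (simp add: t(3) cross_unit_vec a_def)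
  then have "sgn \<sigma> * sgn (sin a) = 1" by (simp add: sgn_mult[symmetric])
  then have sa: "sgn \<sigma> * sgn a = 1" using sgn_sin[of a] a\<delta> \<delta> by simp
  then have "a \<noteq> 0" by auto
  have "s * b * a > 0"
  proof (cases "a > 0")
    case True
    then have "s * b > 0" using inc[of \<theta> t] a\<delta> \<delta> pi_gt_zero by (simp add: a_def b_def)
    then show ?thesis using True by simp
  next
    case False
    then have "a < 0" using \<open>a \<noteq> 0\<close> by simp
    then have "s * (g \<theta> - g t) > 0" using inc[of t \<theta>] a\<delta> \<delta> pi_gt_zero by (simp add: a_def)
    then have "s * b < 0" by (simp add: b_def algebra_simps)
    then show ?thesis using \<open>a < 0\<close> by (rule mult_neg_neg)
  qed
  then have sb: "sgn s * sgn b * sgn a = 1" by (simp add: sgn_mult[symmetric])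
  have "\<epsilon> * (\<sigma>' * sin b) \<ge> 0" using v(4) by (simp add: t(3) g(2) cross_unit_vec b_def)
  then have "sgn (\<epsilon> * (\<sigma>' * sin b)) \<ge> 0" unfolding sgn_if by simp
  then have "sgn \<epsilon> * (sgn \<sigma>' * sgn b) \<ge> 0" by (simp only: sgn_mult sgn_sin[OF b])
  moreover have "sgn \<sigma> = \<sigma>" "sgn \<sigma>' = \<sigma>'" by (simp_all add: \<sigma>_def \<sigma>'_def)
  moreover have "sgn s = s" "sgn \<epsilon> = \<epsilon>" using s \<epsilon> by auto
  moreover have "\<sigma> = 1 \<or> \<sigma> = -1" "\<sigma>' = 1 \<or> \<sigma>' = -1" using \<sigma>(2,4) by linarith+
  moreover have "sgn a = 1 \<or> sgn a = -1" using \<open>a \<noteq> 0\<close> by (simp add: sgn_if)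
  moreover have "sgn b = 1 \<or> sgn b = -1" using sb by (auto simp: sgn_if)
  ultimately have "\<epsilon> * s * (\<sigma> * \<sigma>') = 1" using s \<epsilon> sa sb by auto
  then have one: "\<epsilon> * s * (\<sigma> * \<sigma>') = 1" .
  define A where "A = \<bar>R (unit_vec \<theta>)\<bar>"
  define B where "B = \<bar>R' (unit_vec (g \<theta>))\<bar>"
  have R: "R (unit_vec \<theta>) = \<sigma> * A" "R' (unit_vec (g \<theta>)) = \<sigma>' * B"
    by (simp_all add: \<sigma>_def \<sigma>'_def A_def B_def sgn_mult_abs)
  have "\<epsilon> * s * (R (unit_vec \<theta>) * R' (unit_vec (g \<theta>))) = (\<epsilon> * s * (\<sigma> * \<sigma>')) * (A * B)"
    unfolding R by (simp only: mult_ac)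
  also have "\<dots> = A * B" unfolding one by simp
  finally show ?thesis by (simp add: A_def B_def)
qed auto

text \<open>Off the vertical axis a zero of the form is determined up to sign by its slope, and the slope is
  a root of the polynomial with coefficients \<open>c\<close>.\<close>

lemma finite_unit_zeros:
  assumes "k \<le> d" "c k \<noteq> 0"
  shows "finite {v. norm v = 1 \<and> binary_form c d v = 0}"
proof -
  define T where "T = {t::real. (\<Sum>k\<le>d. c k * t ^ k) = 0}"
  have "finite T" unfolding T_def using polyfun_finite_roots[of c d] assms by blast
  define f where "f t = ((1 / sqrt (1 + t\<^sup>2), t / sqrt (1 + t\<^sup>2)) :: real \<times> real)" for t
  have "{v. norm v = 1 \<and> binary_form c d v = 0} \<subseteq> {(0, 1), (0, -1)} \<union> f ` T \<union> (\<lambda>t. - f t) ` T"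
  proof
    fix v assume v: "v \<in> {v. norm v = 1 \<and> binary_form c d v = 0}"
    obtain x y where xy: "v = (x, y)" by (cases v)
    have n: "x\<^sup>2 + y\<^sup>2 = 1" using v xy by (simp add: norm_Pair)
    show "v \<in> {(0, 1), (0, -1)} \<union> f ` T \<union> (\<lambda>t. - f t) ` T"
    proof (cases "x = 0")
      case True
      then have "y = 1 \<or> y = -1" using n by (simp add: power2_eq_1_iff)
      then show ?thesis using xy True by auto
    next
      case False
      define t where "t = y / x"
      have y: "y = t * x" using False by (simp add: t_def)
      have "binary_form c d v = x ^ d * (\<Sum>k\<le>d. c k * t ^ k)"
        unfolding binary_form_def sum_distrib_left
      proof (rule sum.cong)
        fix k assume "k \<in> {..d}"
        then have "x ^ d = x ^ (d - k) * x ^ k" by (simp flip: power_add)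
        then show "c k * fst v ^ (d - k) * snd v ^ k = x ^ d * (c k * t ^ k)"
          by (simp add: xy y power_mult_distrib mult_ac)
      qed simp
      then have "t \<in> T" using v False by (simp add: T_def)
      have "x\<^sup>2 * (1 + t\<^sup>2) = 1" using n by (simp add: y power_mult_distrib algebra_simps)
      then have "(\<bar>x\<bar> * sqrt (1 + t\<^sup>2))\<^sup>2 = 1" by (simp add: power_mult_distrib)
      then have "\<bar>x\<bar> * sqrt (1 + t\<^sup>2) = 1 \<or> \<bar>x\<bar> * sqrt (1 + t\<^sup>2) = - 1" by (simp only: power2_eq_1_iff)
      moreover have "\<bar>x\<bar> * sqrt (1 + t\<^sup>2) \<ge> 0" by simp
      ultimately have "\<bar>x\<bar> * sqrt (1 + t\<^sup>2) = 1" by linarith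
      moreover have "sqrt (1 + t\<^sup>2) > 0" by (simp add: add_pos_nonneg)
      ultimately have ax: "\<bar>x\<bar> = 1 / sqrt (1 + t\<^sup>2)" by (simp add: eq_divide_eq)
      have "v = f t \<or> v = - f t"
      proof (cases "x > 0")
        case True
        then have "x = 1 / sqrt (1 + t\<^sup>2)" using ax by simp
        then show ?thesis by (simp add: xy y f_def)
      next
        case False
        then have "- x = 1 / sqrt (1 + t\<^sup>2)" using ax by simp
        then have "x = - (1 / sqrt (1 + t\<^sup>2))" by linarith
        then show ?thesis by (simp add: xy y f_def)
      qed
      then show ?thesis using \<open>t \<in> T\<close> by blast
    qed
  qed
  then show ?thesis by (rule finite_subset) (use \<open>finite T\<close> in auto)
qed

lemma binary_form_on_circle:
  assumes "k \<le> d" "c k \<noteq> 0"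
  defines "p \<equiv> \<lambda>\<theta>. binary_form c d (unit_vec \<theta>)"
  shows "continuous_on UNIV p" "p (x + pi) = (-1) ^ d * p x"
    "finite {x \<in> {a..a + pi}. p x = 0}" "a < b \<Longrightarrow> \<exists>x. a < x \<and> x < b \<and> p x \<noteq> 0"
proof -
  show "continuous_on UNIV p" unfolding p_def by (intro continuous_intros)
  show "p (x + pi) = (-1) ^ d * p x"
    using binary_form_scaleR[of c d "-1" "unit_vec x"] by (simp add: p_def unit_vec_antipode)
  have fin: "finite {x \<in> {a..a + pi}. p x = 0}" for a
  proof -
    have "inj_on unit_vec {a..a + pi}"
    proof (rule inj_onI)
      fix x y assume xy: "x \<in> {a..a + pi}" "y \<in> {a..a + pi}" "unit_vec x = unit_vec y"
      have "\<bar>x - y\<bar> \<le> pi" using xy(1,2) by auto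
      then have "\<bar>x - y\<bar> < 2 * pi" using pi_gt_zero by linarith
      with xy(3) show "x = y" by (rule unit_vec_eqD)
    qed
    from finite_vimage_IntI[OF finite_unit_zeros[of k d c, OF assms(1,2)] this]
    show ?thesis by (rule finite_subset[rotated]) (auto simp: p_def)
  qed
  then show "finite {x \<in> {a..a + pi}. p x = 0}" .
  assume ab: "a < b"
  show "\<exists>x. a < x \<and> x < b \<and> p x \<noteq> 0"
  proof (rule ccontr)
    assume "\<not> ?thesis"
    then have "{a<..<min b (a + pi)} \<subseteq> {x \<in> {a..a + pi}. p x = 0}" by auto
    then have "finite {a<..<min b (a + pi)}" using fin finite_subset by blast
    then show False using ab pi_gt_zero infinite_Ioo[of a "min b (a + pi)"] by simp
  qed
qed

text \<open>By \<open>direction_signs_agree\<close> the functions \<open>R\<close> and \<open>\<plusminus> R' \<circ> \<phi>\<close> on the circle never have opposite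
  strict signs, and their zeros are nowhere dense; so they change sign at the same points. Thus \<open>\<phi>\<close>
  is a bijection between the sign changes of the two forms, and half their number has the parity
  of \<open>d\<close> and of \<open>d'\<close>.\<close>

lemma parity_of_tangent_cones:
  assumes c: "k \<le> d" "c k \<noteq> 0" and c': "k' \<le> d'" "c' k' \<noteq> 0"
    and \<phi>: "continuous_on (sphere 0 1) \<phi>" "\<phi> ` sphere 0 1 = sphere 0 1" "inj_on \<phi> (sphere 0 1)"
    and \<epsilon>: "\<epsilon> \<in> {1, -1}"
    and H: "\<And>x0 \<sigma> \<sigma>' \<kappa>. norm x0 = 1 \<Longrightarrow> \<sigma> * binary_form c d x0 > 0 \<Longrightarrow> \<bar>\<sigma>\<bar> = 1 \<Longrightarrow>
      \<sigma>' * binary_form c' d' (\<phi> x0) > 0 \<Longrightarrow> \<bar>\<sigma>'\<bar> = 1 \<Longrightarrow> \<kappa> > 0 \<Longrightarrow>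
      \<exists>v. norm v = 1 \<and> norm (v - x0) \<le> \<kappa> \<and> \<sigma> * cross x0 v > 0 \<and> \<epsilon> * (\<sigma>' * cross (\<phi> x0) (\<phi> v)) \<ge> (0::real)"
  shows "odd d \<longleftrightarrow> odd d'"
proof -
  define p where "p \<theta> = binary_form c d (unit_vec \<theta>)" for \<theta>
  define q where "q \<theta> = binary_form c' d' (unit_vec \<theta>)" for \<theta>
  note P = binary_form_on_circle[where k = k and d = d and c = c, OF c, folded p_def]
  note Q = binary_form_on_circle[where k = k' and d = d' and c = c', OF c', folded q_def]
  obtain g s where g: "continuous_on UNIV g" and fg: "\<And>\<theta>. \<phi> (unit_vec \<theta>) = unit_vec (g \<theta>)"
    and s: "s \<in> {1, -1}" and inc: "\<And>x y. x < y \<Longrightarrow> y < x + 2 * pi \<Longrightarrow> s * (g y - g x) > (0::real)"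
    using circle_map_lift[OF \<phi>(1) equalityD1[OF \<phi>(2)] \<phi>(3)] by blast
  define Q' where "Q' \<theta> = (\<epsilon> * s) * q \<theta>" for \<theta>
  have es: "\<epsilon> * s = 1 \<or> \<epsilon> * s = -1" using \<epsilon> s by auto
  have pq: "p x * Q' (g x) \<ge> 0" for x
  proof -
    have "\<epsilon> * s * (binary_form c d (unit_vec x) * binary_form c' d' (unit_vec (g x))) \<ge> 0"
      by (rule direction_signs_agree[where \<phi> = \<phi> and R = "binary_form c d" and R' = "binary_form c' d'"])
        (fact g fg s \<epsilon> inc H)+
    moreover have "p x * Q' (g x) = \<epsilon> * s * (binary_form c d (unit_vec x) * binary_form c' d' (unit_vec (g x)))"
      by (simp add: p_def q_def Q'_def)
    ultimately show ?thesis by simp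
  qed
  have nzQ: "\<exists>x. a < x \<and> x < b \<and> Q' (g x) \<noteq> 0" if "a < b" for a b
  proof -
    have "(b - a) / 2 > 0" using that by simp
    from increments_surj[OF g s inc this, of "(a + b) / 2"]
    obtain \<eta> where \<eta>: "\<eta> > 0" "\<And>y. \<bar>y - g ((a + b) / 2)\<bar> < \<eta> \<Longrightarrow> \<exists>x. \<bar>x - (a + b) / 2\<bar> < (b - a) / 2 \<and> g x = y"
      by blast
    obtain y where y: "g ((a + b) / 2) < y" "y < g ((a + b) / 2) + \<eta>" "q y \<noteq> 0"
      using Q(4)[of "g ((a + b) / 2)" "g ((a + b) / 2) + \<eta>"] \<eta>(1) by auto
    then obtain x where x: "\<bar>x - (a + b) / 2\<bar> < (b - a) / 2" "g x = y" using \<eta>(2)[of y] by auto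
    then have "a < x" "x < b" by (auto simp: abs_less_iff field_simps)
    moreover have "Q' (g x) \<noteq> 0" using x(2) y(3) es by (auto simp: Q'_def)
    ultimately show ?thesis by blast
  qed
  have Q'g_cont: "continuous_on UNIV (\<lambda>x. Q' (g x))"
    unfolding Q'_def by (intro continuous_intros continuous_on_compose2[OF Q(1) g]) auto
  have "sign_changes p = sign_changes (\<lambda>x. Q' (g x))"
  proof
    show "sign_changes p \<subseteq> sign_changes (\<lambda>x. Q' (g x))"
      by (rule sign_changes_mono[OF P(1) pq nzQ])
    show "sign_changes (\<lambda>x. Q' (g x)) \<subseteq> sign_changes p"
      by (rule sign_changes_mono[OF Q'g_cont _ P(4)]) (use pq in \<open>simp_all add: mult.commute\<close>)
  qed
  then have "\<theta> \<in> sign_changes p \<longleftrightarrow> g \<theta> \<in> sign_changes Q'" for \<theta>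
    using sign_changes_comp[OF g s inc] by simp
  moreover have "sign_changes Q' = sign_changes q"
    using es by (auto simp: Q'_def[abs_def] sign_changes_def)
  ultimately have iff: "\<theta> \<in> sign_changes p \<longleftrightarrow> g \<theta> \<in> sign_changes q" for \<theta> by simp
  have "\<phi> ` unit_vec ` sign_changes p = unit_vec ` sign_changes q"
  proof
    show "\<phi> ` unit_vec ` sign_changes p \<subseteq> unit_vec ` sign_changes q"
      using iff by (auto simp: fg)
    show "unit_vec ` sign_changes q \<subseteq> \<phi> ` unit_vec ` sign_changes p"
    proof
      fix w assume "w \<in> unit_vec ` sign_changes q"
      then obtain t where t: "t \<in> sign_changes q" "w = unit_vec t" by blast
      have "w \<in> \<phi> ` sphere 0 1" using \<phi>(2) t(2) by simp
      then obtain v where v: "norm v = 1" "w = \<phi> v" by auto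
      obtain \<theta> where \<theta>: "v = unit_vec \<theta>" using unit_vec_surj[OF v(1)] by blast
      have "g \<theta> \<in> sign_changes q"
        by (rule sign_changes_unit_vec[of q, OF _ t(1)]) (use t(2) v(2) in \<open>auto simp: q_def \<theta> fg\<close>)
      then show "w \<in> \<phi> ` unit_vec ` sign_changes p" using iff v(2) \<theta> by blast
    qed
  qed
  moreover have sub: "unit_vec ` sign_changes p \<subseteq> sphere 0 1" by auto
  ultimately have "card (unit_vec ` sign_changes q) = card (unit_vec ` sign_changes p)"
    using card_image[OF inj_on_subset[OF \<phi>(3) sub]] by simp
  moreover have "\<exists>m. card (unit_vec ` sign_changes p) = 2 * m \<and> (odd m \<longleftrightarrow> odd d)"
  proof -
    obtain a where a: "p a \<noteq> 0" using P(4)[of 0 1] by auto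
    have "p x = p y" if "unit_vec x = unit_vec y" for x y using that by (simp add: p_def)
    from card_sign_changes_circle[where p = p and d = d and a = a, OF P(1) this P(2) a P(3)]
    show ?thesis .
  qed
  moreover have "\<exists>m. card (unit_vec ` sign_changes q) = 2 * m \<and> (odd m \<longleftrightarrow> odd d')"
  proof -
    obtain a where a: "q a \<noteq> 0" using Q(4)[of 0 1] by auto
    have "q x = q y" if "unit_vec x = unit_vec y" for x y using that by (simp add: q_def)
    from card_sign_changes_circle[where p = q and d = d' and a = a, OF Q(1) this Q(2) a Q(3)]
    show ?thesis .
  qed
  ultimately show ?thesis by auto
qed

section \<open>Boundary map of a blow-spherical homeomorphism\<close>

lemma sph_blow_inv_eq: "sph_blow_inv w = (sgn w, norm w)"
  by (simp add: sph_blow_inv_def sgn_div_norm)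

lemma sph_transform_neighbourhood:
  fixes K :: "'a::euclidean_space set"
  assumes "e > 0" "cball 0 e \<subseteq> K" "norm x = 1" "0 \<le> r" "r \<le> e"
  shows "(x, r) \<in> sph_transform K"
proof -
  have pos: "(x, r) \<in> {z \<in> sphere 0 1 \<times> {0..}. sph_blow z \<in> K - {0}}" if "0 < r" "r \<le> e" for r
    using that assms by (auto simp: sph_blow_def)
  show ?thesis
  proof (cases "r > 0")
    case True
    then show ?thesis
      unfolding sph_transform_def by (intro subsetD[OF closure_subset] pos assms(5))
  next
    case False
    then have "r = 0" using assms by simp
    show ?thesis unfolding sph_transform_def closure_approachable
    proof (intro allI impI)
      fix \<epsilon> :: real assume "\<epsilon> > 0"
      then have "0 < min e (\<epsilon> / 2)" "min e (\<epsilon> / 2) \<le> e" "dist (x, min e (\<epsilon> / 2)) (x, r) < \<epsilon>"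
        using assms(1) \<open>r = 0\<close> by (auto simp: dist_Pair_Pair)
      then show "\<exists>y\<in>{z \<in> sphere 0 1 \<times> {0..}. sph_blow z \<in> K - {0}}. dist y (x, r) < \<epsilon>"
        using pos by blast
    qed
  qed
qed

lemma sph_transform_subset: "sph_transform (K :: 'a::euclidean_space set) \<subseteq> sphere 0 1 \<times> {0..}"
  unfolding sph_transform_def by (rule closure_minimal) (auto intro: closed_Times)

text \<open>The extension of \<open>h\<close> to the spherical blow-ups maps the boundary sphere to itself, because the
  radius \<open>|h z|\<close> tends to \<open>0\<close> with \<open>|z|\<close> and because points off the boundary stay off the boundary.
  Continuity of the extension at the boundary is the last claim.\<close>

lemma blow_spherical_boundary_map:
  fixes h :: "'a::euclidean_space \<Rightarrow> 'a"
  assumes bs: "blow_spherical_homeo K (h ` K) h"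
    and K: "0 \<in> interior K" and hK: "0 \<in> interior (h ` K)"
  shows "\<exists>\<phi>. continuous_on (sphere 0 1) \<phi> \<and> \<phi> ` sphere 0 1 = sphere 0 1 \<and> inj_on \<phi> (sphere 0 1) \<and>
    (\<forall>v \<kappa>'. norm v = 1 \<longrightarrow> \<kappa>' > 0 \<longrightarrow> (\<exists>\<kappa>>0. \<exists>r>0. \<forall>z. z \<noteq> 0 \<longrightarrow> norm z < r \<longrightarrow>
         norm (sgn z - v) < \<kappa> \<longrightarrow> norm (sgn (h z) - \<phi> v) < \<kappa>'))"
proof -
  let ?T = "sph_transform K" and ?T' = "sph_transform (h ` K)"
  obtain \<Phi> \<Psi> where hom: "homeomorphism ?T ?T' \<Phi> \<Psi>"
    and off: "\<And>z. z \<in> ?T - sph_boundary K \<Longrightarrow> \<Phi> z \<in> ?T' - sph_boundary (h ` K) \<and> \<Phi> z = sph_blow_inv (h (sph_blow z))"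
    and h0: "h 0 = 0" and hc: "continuous_on K h"
    using bs unfolding blow_spherical_homeo_def by blast
  obtain e where e: "e > 0" "cball 0 e \<subseteq> K" using K mem_interior_cball by blast
  obtain e' where e': "e' > 0" "cball 0 e' \<subseteq> h ` K" using hK mem_interior_cball by blast
  have bd: "sph_boundary X \<subseteq> sphere 0 1 \<times> {0}" for X :: "'a set" by (auto simp: sph_boundary_def)
  have T: "(x, r) \<in> ?T" if "norm x = 1" "0 \<le> r" "r \<le> e" for x r
    by (rule sph_transform_neighbourhood[OF e that])
  have \<Phi>: "\<Phi> (x, r) = (sgn (h (r *\<^sub>R x)), norm (h (r *\<^sub>R x)))" if "norm x = 1" "0 < r" "r \<le> e" for x r
  proof -
    have "(x, r) \<in> ?T - sph_boundary K" using T[of x r] that bd[of K] by auto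
    from off[OF this] show ?thesis by (simp add: sph_blow_inv_eq sph_blow_def)
  qed
  have \<Phi>T: "\<Phi> z \<in> ?T'" if "z \<in> ?T" for z using hom that by (auto simp: homeomorphism_def)
  have \<Phi>c: "continuous_on ?T \<Phi>" using hom by (simp add: homeomorphism_def)
  define \<phi> where "\<phi> x = fst (\<Phi> (x, 0))" for x
  have \<phi>: "\<Phi> (x, 0) = (\<phi> x, 0)" if x: "norm x = 1" for x
  proof -
    define r where "r n = e / real (Suc n)" for n
    have r: "0 < r n" "r n \<le> e" for n using e by (auto simp: r_def field_simps)
    have r0: "r \<longlonglongrightarrow> 0" unfolding r_def by (rule LIMSEQ_Suc[OF lim_const_over_n])
    have "(x, r n) \<in> ?T" "(x, 0) \<in> ?T" for n using T[OF x] r[of n] e(1) by auto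
    then have "(\<lambda>n. \<Phi> (x, r n)) \<longlonglongrightarrow> \<Phi> (x, 0)"
      by (intro continuous_on_tendsto_compose[OF \<Phi>c] tendsto_Pair tendsto_const r0 always_eventually allI)
    then have "(\<lambda>n. snd (\<Phi> (x, r n))) \<longlonglongrightarrow> snd (\<Phi> (x, 0))" by (rule tendsto_snd)
    then have 1: "(\<lambda>n. norm (h (r n *\<^sub>R x))) \<longlonglongrightarrow> snd (\<Phi> (x, 0))" using \<Phi>[OF x r] by simp
    have "isCont h 0" using hc K continuous_on_interior by blast
    moreover have "(\<lambda>n. r n *\<^sub>R x) \<longlonglongrightarrow> 0" using tendsto_scaleR[OF r0 tendsto_const[of x]] by simp
    ultimately have "(\<lambda>n. h (r n *\<^sub>R x)) \<longlonglongrightarrow> h 0" by (rule isCont_tendsto_compose)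
    then have "(\<lambda>n. norm (h (r n *\<^sub>R x))) \<longlonglongrightarrow> 0" using h0 tendsto_norm_zero by simp
    with 1 have "snd (\<Phi> (x, 0)) = 0" using LIMSEQ_unique by blast
    then show ?thesis by (simp add: \<phi>_def prod_eq_iff)
  qed
  have "continuous_on (sphere 0 1) \<phi>"
    unfolding \<phi>_def
    by (intro continuous_on_fst continuous_on_compose2[OF \<Phi>c]) (use T e in \<open>auto intro!: continuous_intros\<close>)
  moreover have "\<phi> ` sphere 0 1 \<subseteq> sphere 0 1"
  proof
    fix y assume "y \<in> \<phi> ` sphere 0 1"
    then obtain x where x: "norm x = 1" "y = \<phi> x" by auto
    have "\<Phi> (x, 0) \<in> ?T'" using \<Phi>T T x e by simp
    then have "(y, 0) \<in> sphere 0 1 \<times> {0::real..}"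
      unfolding \<phi>[OF x(1)] x(2) by (rule subsetD[OF sph_transform_subset])
    then show "y \<in> sphere 0 1" by simp
  qed
  moreover have "sphere 0 1 \<subseteq> \<phi> ` sphere 0 1"
  proof
    fix y :: 'a assume "y \<in> sphere 0 1"
    then have y: "(y, 0) \<in> ?T'" using sph_transform_neighbourhood[OF e', of y 0] e' by simp
    define z where "z = \<Psi> (y, 0)"
    have z: "z \<in> ?T" "\<Phi> z = (y, 0)" using hom y by (auto simp: homeomorphism_def z_def)
    have "snd z = 0"
    proof (rule ccontr)
      assume "snd z \<noteq> 0"
      then have "z \<in> ?T - sph_boundary K" using z(1) bd[of K] by auto
      then have "\<Phi> z \<notin> sph_boundary (h ` K)" using off by blast
      then have "(y, 0) \<notin> sph_boundary (h ` K)" unfolding z(2) .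
      then show False using y \<open>y \<in> sphere 0 1\<close> by (simp add: sph_boundary_def)
    qed
    then have z0: "z = (fst z, 0)" by (simp add: prod_eq_iff)
    have "norm (fst z) = 1" using subsetD[OF sph_transform_subset z(1)] by auto
    from \<phi>[OF this] z(2) have "y = \<phi> (fst z)" unfolding z0[symmetric] by simp
    then show "y \<in> \<phi> ` sphere 0 1" using \<open>norm (fst z) = 1\<close> by auto
  qed
  moreover have "inj_on \<phi> (sphere 0 1)"
  proof (rule inj_onI)
    fix x y assume "x \<in> sphere 0 1" "y \<in> sphere 0 1" and xy: "\<phi> x = \<phi> y"
    then have n: "norm x = 1" "norm y = 1" by simp_all
    have "(x, 0) = \<Psi> (\<Phi> (x, 0))"
      by (rule homeomorphism_apply1[OF hom T[OF n(1) order_refl less_imp_le[OF e(1)]], symmetric])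
    also have "\<Phi> (x, 0) = \<Phi> (y, 0)" unfolding \<phi>[OF n(1)] \<phi>[OF n(2)] xy ..
    also have "\<Psi> (\<Phi> (y, 0)) = (y, 0)"
      by (rule homeomorphism_apply1[OF hom T[OF n(2) order_refl less_imp_le[OF e(1)]]])
    finally show "x = y" by simp
  qed
  moreover have "\<exists>\<kappa>>0. \<exists>r>0. \<forall>z. z \<noteq> 0 \<longrightarrow> norm z < r \<longrightarrow>
         norm (sgn z - v) < \<kappa> \<longrightarrow> norm (sgn (h z) - \<phi> v) < \<kappa>'" if v: "norm v = 1" and "\<kappa>' > 0" for v \<kappa>'
  proof -
    have "(v, 0) \<in> ?T" using T v e by simp
    then have "\<exists>d>0. \<forall>z\<in>?T. dist z (v, 0) < d \<longrightarrow> dist (\<Phi> z) (\<Phi> (v, 0)) < \<kappa>'"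
      using \<Phi>c \<open>\<kappa>' > 0\<close> unfolding continuous_on_iff by blast
    then obtain d where d: "d > 0" "\<And>z. z \<in> ?T \<Longrightarrow> dist z (v, 0) < d \<Longrightarrow> dist (\<Phi> z) (\<Phi> (v, 0)) < \<kappa>'" by blast
    have "norm (sgn (h z) - \<phi> v) < \<kappa>'" if z: "z \<noteq> 0" "norm z < min e (d / 2)" "norm (sgn z - v) < d / 2" for z
    proof -
      have sz: "norm (sgn z) = 1" "norm z *\<^sub>R sgn z = z" using z(1) by (auto simp: norm_sgn sgn_div_norm)
      have "dist (sgn z, norm z) (v, 0) \<le> norm (sgn z - v) + norm (norm z)"
        unfolding dist_norm using norm_Pair_le[of "sgn z - v" "norm z"] by simp
      also have "\<dots> < d" using z by simp
      finally have "dist (\<Phi> (sgn z, norm z)) (\<Phi> (v, 0)) < \<kappa>'" using d(2) T[OF sz(1)] z by simp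
      moreover have "\<Phi> (sgn z, norm z) = (sgn (h z), norm (h z))" using \<Phi>[OF sz(1), of "norm z"] sz(2) z by simp
      ultimately show ?thesis using dist_fst_le[of "\<Phi> (sgn z, norm z)" "\<Phi> (v, 0)"] \<phi>[OF v] by (simp add: dist_norm)
    qed
    then show ?thesis using d(1) e(1) by (intro exI[of _ "d / 2"] conjI exI[of _ "min e (d / 2)"]) auto
  qed
  ultimately show ?thesis by (intro exI[of _ \<phi>] conjI subset_antisym allI impI)
qed

section \<open>Parity of the order\<close>

text \<open>Summary of the local analysis of \<open>Z\<close> at the origin: a nonzero form of degree \<open>\<nu> + 1\<close> describes
  the angular velocity, and the Lipschitz constant decreases like \<open>\<rho> ^ (\<nu> - 1)\<close>.\<close>

lemma vfield_tangent_form: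
  fixes Z :: "real vfield"
  assumes germ: "real_vfield_germ Z" and res: "resolution Z cs"
    and nodic: "no_real_dicritical_component Z cs" and order: "vfield_order Z = enat \<nu>"
  obtains c k C \<delta> where "\<nu> \<ge> 1" "k \<le> Suc \<nu>" "c k \<noteq> 0" "C > 0" "\<delta> > 0"
    "\<And>\<rho> w w'. \<rho> \<le> \<delta> \<Longrightarrow> norm w \<le> \<rho> \<Longrightarrow> norm w' \<le> \<rho> \<Longrightarrow> norm (Z w - Z w') \<le> C * \<rho> ^ (\<nu> - 1) * norm (w - w')"
    "\<And>w. norm w \<le> \<delta> \<Longrightarrow> \<bar>cross w (Z w) - binary_form c (Suc \<nu>) w\<bar> \<le> C * norm w ^ Suc (Suc \<nu>)"
proof -
  have an: "vfield_analytic_at Z 0" and Z0: "Z 0 = 0" using germ by (auto simp: real_vfield_germ_def)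
  obtain a b i0 j0 where a: "expansion_at (fst \<circ> Z) 0 a" and b: "expansion_at (snd \<circ> Z) 0 b"
    and low: "\<And>i j. i + j < \<nu> \<Longrightarrow> a i j = 0 \<and> b i j = 0"
    and top: "i0 + j0 = \<nu>" "a i0 j0 \<noteq> 0 \<or> b i0 j0 \<noteq> 0"
    by (rule vfield_order_expansions[OF an order], rule that, assumption+)
  have \<nu>: "\<nu> \<ge> 1"
  proof (rule ccontr)
    assume "\<not> ?thesis"
    then have "i0 = 0" "j0 = 0" using top(1) by auto
    then show False using top(2) expansion_at_value[OF a] expansion_at_value[OF b] Z0 by simp
  qed
  obtain i j where ij: "i + j = Suc \<nu>" "tangency_coeff a b i j \<noteq> 0"
    using nondicritical_tangent_cone[OF germ res nodic a b low top] by blast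
  define c where "c k = tangency_coeff a b (Suc \<nu> - k) k" for k
  have "Suc \<nu> - j = i" using ij(1) by simp
  then have c: "j \<le> Suc \<nu>" "c j \<noteq> 0" using ij by (auto simp: c_def)
  have "\<exists>C>0. \<exists>\<delta>>0. \<forall>\<rho> w w'. \<rho> \<le> \<delta> \<longrightarrow> norm w \<le> \<rho> \<longrightarrow> norm w' \<le> \<rho> \<longrightarrow>
     norm (Z (0 + w) - Z (0 + w')) \<le> C * \<rho> ^ (\<nu> - 1) * norm (w - w')"
    by (rule vfield_lipschitz[OF a b \<nu> low])
  from this[unfolded add_0] obtain C1 \<delta>1 where 1: "C1 > 0" "\<delta>1 > 0" "\<And>\<rho> w w'. \<rho> \<le> \<delta>1 \<Longrightarrow> norm w \<le> \<rho> \<Longrightarrow> norm w' \<le> \<rho> \<Longrightarrow>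
     norm (Z w - Z w') \<le> C1 * \<rho> ^ (\<nu> - 1) * norm (w - w')" by blast
  have "\<exists>C>0. \<exists>\<delta>>0. \<forall>w. norm w \<le> \<delta> \<longrightarrow>
     \<bar>cross w (Z w) - binary_form c (Suc \<nu>) w\<bar> \<le> C * norm w ^ Suc (Suc \<nu>)"
    unfolding c_def[abs_def] by (rule tangency_leading_form[OF a b low])
  then obtain C2 \<delta>2 where 2: "C2 > 0" "\<delta>2 > 0" and "\<forall>w. norm w \<le> \<delta>2 \<longrightarrow>
     \<bar>cross w (Z w) - binary_form c (Suc \<nu>) w\<bar> \<le> C2 * norm w ^ Suc (Suc \<nu>)"
    by blast
  then have 3: "\<bar>cross w (Z w) - binary_form c (Suc \<nu>) w\<bar> \<le> C2 * norm w ^ Suc (Suc \<nu>)"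
    if "norm w \<le> \<delta>2" for w using that by blast
  show ?thesis
  proof (rule that[of j c "max C1 C2" "min \<delta>1 \<delta>2", OF \<nu> c])
    fix \<rho> :: real and w w' :: "real \<times> real"
    assume w: "\<rho> \<le> min \<delta>1 \<delta>2" "norm w \<le> \<rho>" "norm w' \<le> \<rho>"
    have "\<rho> \<ge> 0" using w(2) norm_ge_zero order_trans by blast
    have "norm (Z w - Z w') \<le> C1 * \<rho> ^ (\<nu> - 1) * norm (w - w')" by (rule 1(3)) (use w in auto)
    also have "\<dots> \<le> max C1 C2 * \<rho> ^ (\<nu> - 1) * norm (w - w')"
      using \<open>\<rho> \<ge> 0\<close> by (intro mult_right_mono) auto
    finally show "norm (Z w - Z w') \<le> max C1 C2 * \<rho> ^ (\<nu> - 1) * norm (w - w')" .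
  next
    fix w :: "real \<times> real" assume w: "norm w \<le> min \<delta>1 \<delta>2"
    have "\<bar>cross w (Z w) - binary_form c (Suc \<nu>) w\<bar> \<le> C2 * norm w ^ Suc (Suc \<nu>)" by (rule 3) (use w in auto)
    also have "\<dots> \<le> max C1 C2 * norm w ^ Suc (Suc \<nu>)" by (intro mult_right_mono) auto
    finally show "\<bar>cross w (Z w) - binary_form c (Suc \<nu>) w\<bar> \<le> max C1 C2 * norm w ^ Suc (Suc \<nu>)" .
  qed (use 1 2 in auto)
qed

theorem corollary5p12:
  fixes Z Z' :: "real vfield"
    and cs cs' :: "inf_near_point list"
    and \<nu> \<nu>' :: nat
    and h :: "real \<times> real \<Rightarrow> real \<times> real"
  assumes "real_vfield_germ Z" and "real_vfield_germ Z'"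
    and "resolution Z cs" and "resolution Z' cs'"
    and "no_real_dicritical_component Z cs" and "no_real_dicritical_component Z' cs'"
    and "real_generalized_curve Z cs" and "real_generalized_curve Z' cs'"
    and "vfield_order Z = enat \<nu>" and "vfield_order Z' = enat \<nu>'"
    and "topological_equivalence Z Z' h"
    and "blow_spherical_germ h"
  shows "[\<nu> = \<nu>'] (mod 2)"
proof -
  obtain c k C \<delta> where \<nu>: "\<nu> \<ge> 1" and c: "k \<le> Suc \<nu>" "c k \<noteq> 0" and C: "C > 0" "\<delta> > 0"
    and lip: "\<And>\<rho> w w'. \<rho> \<le> \<delta> \<Longrightarrow> norm w \<le> \<rho> \<Longrightarrow> norm w' \<le> \<rho> \<Longrightarrow> norm (Z w - Z w') \<le> C * \<rho> ^ (\<nu> - 1) * norm (w - w')"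
    and tang: "\<And>w. norm w \<le> \<delta> \<Longrightarrow> \<bar>cross w (Z w) - binary_form c (Suc \<nu>) w\<bar> \<le> C * norm w ^ Suc (Suc \<nu>)"
    by (rule vfield_tangent_form[OF assms(1,3,5,9)], rule that, assumption+)
  obtain c' k' C' \<delta>' where c': "k' \<le> Suc \<nu>'" "c' k' \<noteq> 0" and C': "C' > 0" "\<delta>' > 0"
    and tang': "\<And>w. norm w \<le> \<delta>' \<Longrightarrow> \<bar>cross w (Z' w) - binary_form c' (Suc \<nu>') w\<bar> \<le> C' * norm w ^ Suc (Suc \<nu>')"
    by (rule vfield_tangent_form[OF assms(2,4,6,10)], rule that, assumption+)
  have Z0: "Z 0 = 0" using assms(1) by (simp add: real_vfield_germ_def)
  obtain U V g where U: "open U" "0 \<in> U" and V: "open V" "0 \<in> V"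
    and an: "\<And>p. p \<in> U \<Longrightarrow> vfield_analytic_at Z p" "\<And>p. p \<in> V \<Longrightarrow> vfield_analytic_at Z' p"
    and hom: "homeomorphism U V h g" and leaf: "\<And>L. L \<in> leaves U Z \<Longrightarrow> h ` L \<in> leaves V Z'"
    and h0: "h 0 = 0"
    using assms(11) unfolding topological_equivalence_def by blast
  have h_cont: "continuous_on U h" using hom by (simp add: homeomorphism_def)
  have h_inj: "h x = h y \<Longrightarrow> x \<in> U \<Longrightarrow> y \<in> U \<Longrightarrow> x = y" for x y
    using homeomorphism_apply1[OF hom] by metis
  have "isCont h 0" using h_cont U by (simp add: continuous_on_eq_continuous_at)
  then have h_lim: "(h \<longlongrightarrow> 0) (at 0)" using h0 by (simp add: isCont_def)
  obtain K where K: "0 \<in> interior K" "blow_spherical_homeo K (h ` K) h"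
    using assms(12) unfolding blow_spherical_germ_def by blast
  have "open (h ` (interior K \<inter> U))"
  proof -
    have "openin (top_of_set U) (interior K \<inter> U)" using U(1) by (simp add: openin_open_eq open_Int)
    from homeomorphism_imp_open_map[OF hom this] show ?thesis using V(1) by (simp add: openin_open_eq)
  qed
  moreover have "h ` (interior K \<inter> U) \<subseteq> h ` K" using interior_subset by blast
  moreover have "0 \<in> h ` (interior K \<inter> U)" using K(1) U(2) h0 by (intro image_eqI[of _ _ 0]) auto
  ultimately have hK: "0 \<in> interior (h ` K)" using interiorI by blast
  obtain \<phi> where \<phi>: "continuous_on (sphere 0 1) \<phi>" "\<phi> ` sphere 0 1 = sphere 0 1" "inj_on \<phi> (sphere 0 1)"
    and lim: "\<And>v \<kappa>'. norm v = 1 \<Longrightarrow> \<kappa>' > 0 \<Longrightarrow> \<exists>\<kappa>>0. \<exists>r>0. \<forall>z. z \<noteq> 0 \<longrightarrow> norm z < r \<longrightarrow>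
         norm (sgn z - v) < \<kappa> \<longrightarrow> norm (sgn (h z) - \<phi> v) < \<kappa>'"
    using blow_spherical_boundary_map[OF K(2,1) hK] by blast
  have \<phi>_norm: "norm (\<phi> v) = 1" if "norm v = 1" for v
  proof -
    have "\<phi> v \<in> \<phi> ` sphere 0 1" using that by (intro imageI) simp
    then show ?thesis unfolding \<phi>(2) by simp
  qed
  obtain r1 where r1: "r1 > 0" "\<And>w. w \<noteq> 0 \<Longrightarrow> norm w < r1 \<Longrightarrow> Z w \<noteq> 0"
    using real_singularity_isolated[OF assms(1,3,7)] unfolding eventually_at by (auto simp: dist_norm)
  obtain r2 where r2: "r2 > 0" "\<And>w. w \<noteq> 0 \<Longrightarrow> norm w < r2 \<Longrightarrow> Z' w \<noteq> 0"
    using real_singularity_isolated[OF assms(2,4,8)] unfolding eventually_at by (auto simp: dist_norm)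
  obtain r3 where r3: "r3 > 0" "\<And>z. z \<noteq> 0 \<Longrightarrow> norm z < r3 \<Longrightarrow> norm (h z) < r2"
    using tendstoD[OF h_lim r2(1)] unfolding eventually_at by (auto simp: dist_norm)
  obtain r4 where r4: "r4 > 0" "ball 0 r4 \<subseteq> U" using U open_contains_ball by blast
  define R0 where "R0 = min (min r1 r3) r4"
  have R0: "R0 > 0" "ball 0 R0 \<subseteq> U" using r1 r3 r4 by (auto simp: R0_def)
  have inU: "z \<in> U" if "norm z < R0" for z using that R0(2) by auto
  have hnz: "h z \<noteq> 0" if "z \<noteq> 0" "norm z < R0" for z
    using h_inj[of z 0] h0 U(2) inU[OF that(2)] that(1) by auto
  have "connected (ball 0 R0 - {0 :: real \<times> real})"
    using R0(1) aff_dim_open[of "ball 0 R0 :: (real \<times> real) set"]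
    by (intro connected_punctured_convex) auto
  from leaf_map_monotone[OF analytic_loc_lip[OF U(1) an(1)] analytic_loc_lip[OF V(1) an(2)] U(1) V(1) hom leaf this]
  have "\<exists>\<epsilon>\<in>{1, -1}. \<forall>q\<in>ball 0 R0 - {0}. transports Z Z' U h \<epsilon> q"
    using R0(2) r1(2) r2(2) r3(2) hnz by (auto simp: R0_def)
  then obtain \<epsilon> where \<epsilon>: "\<epsilon> \<in> {1, -1}" and tr': "\<forall>q\<in>ball 0 R0 - {0}. transports Z Z' U h \<epsilon> q"
    by blast
  have tr: "transports Z Z' U h \<epsilon> q" if "q \<noteq> 0" "norm q < R0" for q
    by (rule bspec[OF tr']) (use that in simp)
  have "odd (Suc \<nu>) \<longleftrightarrow> odd (Suc \<nu>')"
  proof (rule parity_of_tangent_cones[where c = c and c' = c' and k = k and k' = k', OF c c' \<phi> \<epsilon>])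
    fix x0 :: "real \<times> real" and \<sigma> \<sigma>' \<kappa> :: real
    assume "norm x0 = 1" "\<sigma> * binary_form c (Suc \<nu>) x0 > 0" "\<bar>\<sigma>\<bar> = 1"
      "\<sigma>' * binary_form c' (Suc \<nu>') (\<phi> x0) > 0" "\<bar>\<sigma>'\<bar> = 1" "\<kappa> > 0"
    from boundary_direction[OF C \<nu> Z0 lip tang C' tang' h_cont h_lim R0 hnz tr \<phi>_norm lim this]
    show "\<exists>v. norm v = 1 \<and> norm (v - x0) \<le> \<kappa> \<and> \<sigma> * cross x0 v > 0 \<and>
        \<epsilon> * (\<sigma>' * cross (\<phi> x0) (\<phi> v)) \<ge> 0" .
  qed
  then show ?thesis by (auto simp: cong_def mod2_eq_if)
qed

end
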